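(* Let $\alpha$ be a partition. Then, for any triple of partitions $\lambda$, $\mu$, $\nu$ of the same size, there is an $L\in\mathbb{N}$ such that for all $n\ge L$, $$\mathsf{g}\bigl(\lambda+n\alpha,\ \mu+n\alpha',\ \nu+(n^{|\alpha|})\bigr)=\mathsf{g}\bigl(\lambda+L\alpha,\ \mu+L\alpha',\ \nu+(L^{|\alpha|})\bigr).$$
   Context: $\mathbb{N}$ is the set of positive integers. A partition is a weakly decreasing sequence of positive integers; its size $|\alpha|$ is the sum of its parts, and $\alpha'$ is the conjugate partition, obtained by transposing the diagram of $\alpha$. The partition $(n^{r})$ has $r$ parts, all equal to $n$. The sum of two partitions is taken coordinatewise after appending zeros to the shorter one, and $n\alpha$ is the partition $\alpha$ with every part multiplied by $n$. For partitions $\lambda,\mu,\nu$ of $m$, let $\chi^\lambda$ denote the irreducible complex character of the symmetric group $S_m$ associated to $\lambda$. The Kronecker coefficient is $\mathsf{g}(\lambda,\mu,\nu)=\langle\chi^\lambda\otimes\chi^\mu,\chi^\nu\rangle$, the multiplicity of $\chi^\nu$ in $\chi^\lambda\otimes\chi^\mu$. *)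

theory Defs
  imports Complex_Main "HOL-Library.Function_Algebras" "HOL-Combinatorics.Permutations"
begin

section \<open>Partitions\<close>

definition is_partition :: "nat list \<Rightarrow> bool" where
  "is_partition p \<longleftrightarrow> sorted_wrt (\<ge>) p \<and> 0 \<notin> set p"

text \<open>The \<open>j\<close>-th part (counted from 0) of the conjugate of \<open>p\<close> is the number of parts of \<open>p\<close>
  that exceed \<open>j\<close>, that is, the length of the \<open>j\<close>-th column of the diagram of \<open>p\<close>.\<close>

definition conjugate :: "nat list \<Rightarrow> nat list" where
  "conjugate p = (case p of [] \<Rightarrow> [] | a # _ \<Rightarrow> map (\<lambda>j. length (filter (\<lambda>x. j < x) p)) [0..<a])"

fun padd :: "nat list \<Rightarrow> nat list \<Rightarrow> nat list" where
  "padd [] ys = ys"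
| "padd xs [] = xs"
| "padd (x # xs) (y # ys) = (x + y) # padd xs ys"

definition pscale :: "nat \<Rightarrow> nat list \<Rightarrow> nat list" where
  "pscale n p = map (\<lambda>x. n * x) p"

section \<open>Traces on subspaces of complex function spaces\<close>

definition fscale :: "complex \<Rightarrow> ('a \<Rightarrow> complex) \<Rightarrow> 'a \<Rightarrow> complex" where
  "fscale c f = (\<lambda>x. c * f x)"

interpretation cfun: vector_space fscale
  by standard (auto simp: fscale_def fun_eq_iff algebra_simps)

text \<open>The trace of a linear endomorphism \<open>F\<close> of the finite-dimensional subspace \<open>V\<close>, computed in
  some basis of \<open>V\<close>; the value does not depend on the basis. Nothing is claimed when \<open>V\<close> is
  infinite-dimensional or not mapped into itself by \<open>F\<close>.\<close>

definition trace_on :: "('a \<Rightarrow> complex) set \<Rightarrow> (('a \<Rightarrow> complex) \<Rightarrow> 'a \<Rightarrow> complex) \<Rightarrow> complex" where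
  "trace_on V F =
     (let B = (SOME B. cfun.independent B \<and> cfun.span B = V)
      in \<Sum>b\<in>B. cfun.representation B (F b) b)"

section \<open>Irreducible characters of the symmetric groups\<close>

text \<open>The irreducible representation of the symmetric group on \<open>{1..m}\<close> associated to a partition
  \<open>p\<close> of \<open>m\<close> is the Specht module: the span of the polytabloids inside the permutation module on
  tabloids. In this convention \<open>[m]\<close> gives the trivial and \<open>replicate m 1\<close> the sign
  representation. Rows and columns of diagrams are numbered from 0.\<close>

definition diagram :: "nat list \<Rightarrow> (nat \<times> nat) set" where
  "diagram p = {(i, j). i < length p \<and> j < p ! i}"

definition tableaux :: "nat list \<Rightarrow> (nat \<times> nat \<Rightarrow> nat) set" where
  "tableaux p = {T. bij_betw T (diagram p) {1..sum_list p}}"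

text \<open>A tabloid, the row-equivalence class of a tableau, is encoded as the sequence of the sets of
  entries of its rows.\<close>

definition tabloid :: "nat list \<Rightarrow> (nat \<times> nat \<Rightarrow> nat) \<Rightarrow> nat \<Rightarrow> nat set" where
  "tabloid p T = (\<lambda>i. {T (i, j) | j. (i, j) \<in> diagram p})"

definition column_stabilizer :: "nat list \<Rightarrow> (nat \<times> nat \<Rightarrow> nat) \<Rightarrow> (nat \<Rightarrow> nat) set" where
  "column_stabilizer p T =
     {s. s permutes {1..sum_list p} \<and>
         (\<forall>j. s ` {T (i, j) | i. (i, j) \<in> diagram p} = {T (i, j) | i. (i, j) \<in> diagram p})}"

text \<open>Elements of the permutation module are represented by their coefficient functions on
  tabloids.\<close>

definition polytabloid :: "nat list \<Rightarrow> (nat \<times> nat \<Rightarrow> nat) \<Rightarrow> (nat \<Rightarrow> nat set) \<Rightarrow> complex" where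
  "polytabloid p T =
     (\<lambda>X. \<Sum>s\<in>column_stabilizer p T. if X = tabloid p (s \<circ> T) then of_int (sign s) else 0)"

definition specht_module :: "nat list \<Rightarrow> ((nat \<Rightarrow> nat set) \<Rightarrow> complex) set" where
  "specht_module p = cfun.span (polytabloid p ` tableaux p)"

text \<open>A permutation \<open>s\<close> sends the tabloid \<open>X\<close> to \<open>\<lambda>i. s ` X i\<close>, hence the inverse in the action on
  coefficient functions.\<close>

definition perm_action :: "(nat \<Rightarrow> nat) \<Rightarrow> ((nat \<Rightarrow> nat set) \<Rightarrow> complex) \<Rightarrow> (nat \<Rightarrow> nat set) \<Rightarrow> complex"
  where "perm_action s f = (\<lambda>X. f (\<lambda>i. inv s ` X i))"

definition irr_char :: "nat list \<Rightarrow> (nat \<Rightarrow> nat) \<Rightarrow> complex" where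
  "irr_char p s = trace_on (specht_module p) (perm_action s)"

section \<open>Kronecker coefficients\<close>

definition char_inner :: "nat \<Rightarrow> ((nat \<Rightarrow> nat) \<Rightarrow> complex) \<Rightarrow> ((nat \<Rightarrow> nat) \<Rightarrow> complex) \<Rightarrow> complex" where
  "char_inner m f g = (\<Sum>s | s permutes {1..m}. f s * cnj (g s)) / fact m"

text \<open>Meaningful for three partitions of the same size.\<close>

definition kronecker :: "nat list \<Rightarrow> nat list \<Rightarrow> nat list \<Rightarrow> complex" where
  "kronecker p q r = char_inner (sum_list p) (\<lambda>s. irr_char p s * irr_char q s) (irr_char r)"

end

theory Submission
  imports Defs "HOL-Library.FuncSet"
begin

text \<open>
  Put \<open>N = |\<alpha>|\<close>. For a content vector \<open>\<pi>\<close> of size \<open>m\<close>, the symmetric group \<open>S\<^sub>m\<close> permutes the colorings of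
  its points with \<open>\<pi> i\<close> points of color \<open>i\<close>; let \<open>\<phi> \<pi>\<close> be the character of this action, which is that of
  the Young permutation module. By the Jacobi-Trudi formula the irreducible characters attached to
  \<open>\<lambda> + n\<alpha>\<close> and \<open>\<mu> + n\<alpha>'\<close> are signed sums of characters \<open>\<phi> (u + n\<alpha>)\<close> and \<open>\<phi> (v + n\<alpha>')\<close>, with vectors
  \<open>u\<close>, \<open>v\<close> that do not depend on \<open>n\<close>. A product \<open>\<phi> \<pi> * \<phi> \<kappa>\<close> is the sum of \<open>\<phi> M\<close> over the nonnegative
  integer matrices \<open>M\<close> with row sums \<open>\<pi>\<close> and column sums \<open>\<kappa>\<close> (lemma \<open>perm_char_times\<close>), and
  the inner product of \<open>\<phi> M\<close> with the irreducible character of a partition is a Kostka number. So the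
  Kronecker coefficient is a signed sum of Kostka numbers of shape \<open>\<nu> + (n^N)\<close> whose contents are the
  matrices with margins \<open>u + n\<alpha>\<close> and \<open>v + n\<alpha>'\<close> (lemma \<open>kronecker_expansion\<close>).

  Such a Kostka number vanishes unless every entry of \<open>M\<close> is at most \<open>\<nu>\<^sub>0 + n\<close>, where \<open>\<nu>\<^sub>0\<close> is the first
  part of \<open>\<nu>\<close>. The 0-1 matrix \<open>D\<close> of the diagram of \<open>\<alpha>\<close> is the only matrix with margins \<open>\<alpha>\<close>, \<open>\<alpha>'\<close> and
  entries at most 1, and this is robust: the weights \<open>2\<alpha> i - 2j - 1\<close> are sums of a row and a column
  term, so the margins fix the weighted sum of \<open>M\<close>, while they are positive on the diagram and
  negative off it; hence \<open>M - nD\<close> is bounded independently of \<open>n\<close> (lemma \<open>near_diagram_matrix\<close>).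
  Therefore \<open>M = nD + B\<close> with \<open>B\<close> in a fixed finite set, and for a fixed \<open>B\<close> the Kostka number has
  \<open>N\<close> rows and \<open>N\<close> content entries that grow with \<open>n\<close>; peeling off horizontal strips shows that it
  becomes constant (lemma \<open>stabilizes_alt_kostka\<close>).

  It remains to identify the trace character \<open>\<chi>\<close> of the Specht module with the Jacobi-Trudi
  combination \<open>\<psi>\<close>. Both are real valued, and \<open>\<langle>\<chi>, \<chi>\<rangle> = \<langle>\<chi>, \<psi>\<rangle> = \<langle>\<psi>, \<psi>\<rangle> = 1\<close>, whence \<open>\<parallel>\<chi> - \<psi>\<parallel> = 0\<close>. The
  products with \<open>\<chi>\<close> are computed from the Young symmetrizer, \<open>\<langle>\<psi>, \<psi>\<rangle>\<close> from the fact that a Kostka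
  number vanishes unless the shape dominates the content.\<close>

section \<open>Permutation characters on colorings\<close>

definition avg :: "'a set \<Rightarrow> (('a \<Rightarrow> 'a) \<Rightarrow> real) \<Rightarrow> real" where
  "avg A f = (\<Sum>s | s permutes A. f s) / fact (card A)"

text \<open>Contents are integer valued, since subscripts such as \<open>p i - i + \<rho> i\<close> in the Jacobi-Trudi sum may be
  negative; there are then no colorings and the permutation character is 0.\<close>

definition colorings :: "'a set \<Rightarrow> 'i set \<Rightarrow> ('i \<Rightarrow> int) \<Rightarrow> ('a \<Rightarrow> 'i) set" where
  "colorings A I \<pi> = {f \<in> A \<rightarrow>\<^sub>E I. \<forall>i\<in>I. int (card {x\<in>A. f x = i}) = \<pi> i}"

definition perm_char :: "'a set \<Rightarrow> 'i set \<Rightarrow> ('i \<Rightarrow> int) \<Rightarrow> ('a \<Rightarrow> 'a) \<Rightarrow> real" where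
  "perm_char A I \<pi> s = real (card {f \<in> colorings A I \<pi>. f \<circ> s = f})"

definition comps :: "nat \<Rightarrow> int \<Rightarrow> (nat \<Rightarrow> nat) set" where
  "comps l r = {c. (\<forall>j\<ge>l. c j = 0) \<and> int (\<Sum>j<l. c j) = r}"

text \<open>Matrices with row sums \<open>\<pi>\<close> and column sums \<open>\<kappa>\<close>. The rows are indexed by any set, as the row index is
  itself a pair when three characters are multiplied.\<close>

definition contingency :: "'i set \<Rightarrow> ('i \<Rightarrow> int) \<Rightarrow> nat \<Rightarrow> (nat \<Rightarrow> int) \<Rightarrow> ('i \<Rightarrow> nat \<Rightarrow> nat) set" where
  "contingency I \<pi> l \<kappa> =
     {M \<in> PiE I (\<lambda>i. comps l (\<pi> i)). \<forall>j<l. int (\<Sum>i\<in>I. M i j) = \<kappa> j}"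

lemma finite_comps [simp]: "finite (comps l r)"
proof (rule finite_subset)
  show "comps l r \<subseteq> {c. \<forall>x. (x \<in> {..<l} \<longrightarrow> c x \<in> {..nat r}) \<and> (x \<notin> {..<l} \<longrightarrow> c x = 0)}"
  proof clarsimp
    fix c x assume c: "c \<in> comps l r"
    have "c x \<le> (\<Sum>j<l. c j)" if "x < l" using that by (intro member_le_sum) auto
    then show "(x < l \<longrightarrow> c x \<le> nat r) \<and> (\<not> x < l \<longrightarrow> c x = 0)"
      using c by (auto simp: comps_def le_nat_iff simp flip: of_nat_sum)
  qed
qed (intro finite_set_of_finite_funs; simp)

lemma finite_contingency [simp]: "finite I \<Longrightarrow> finite (contingency I \<pi> l \<kappa>)"
  unfolding contingency_def by (rule finite_subset[of _ "PiE I (\<lambda>i. comps l (\<pi> i))"]) (auto intro: finite_PiE)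

lemma finite_colorings: "finite A \<Longrightarrow> finite I \<Longrightarrow> finite (colorings A I \<pi>)"
  unfolding colorings_def by (rule finite_subset[of _ "A \<rightarrow>\<^sub>E I"]) (auto intro: finite_PiE)

lemma card_eq_sum_fibres:
  assumes "finite S" "finite T" "\<And>x. x \<in> S \<Longrightarrow> g x \<in> T"
  shows "card S = (\<Sum>t\<in>T. card {x\<in>S. g x = t})"
  using sum.group[of S T g "\<lambda>_. 1::nat"] assms by (simp add: image_subset_iff)

lemma card_vimage_permutes:
  assumes "s permutes A"
  shows "card {x\<in>A. P (s x)} = card {x\<in>A. P x}"
proof -
  have "bij_betw s {x\<in>A. P (s x)} {x\<in>A. P x}"
    by (rule bij_betwI[where g="inv s"])
      (use assms permutes_inv[OF assms] in \<open>auto simp: permutes_in_image permutes_inverses\<close>)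
  then show ?thesis by (rule bij_betw_same_card)
qed

lemma permutes_between_equal_fibres:
  assumes "finite A" and "\<And>i. card {x\<in>A. f x = i} = card {x\<in>A. g x = i}"
  obtains s where "s permutes A" "\<And>x. x \<in> A \<Longrightarrow> f x = g (s x)"
proof -
  have "image_mset f (mset_set A) = image_mset g (mset_set A)"
    using assms by (intro multiset_eqI)
      (simp add: count_image_mset_eq_card_vimage vimage_def Int_def conj_commute)
  from image_mset_eq_implies_permutes[OF \<open>finite A\<close> this] show ?thesis using that by metis
qed

lemma colorings_compose:
  assumes "f \<in> colorings A I \<pi>" "s permutes A"
  shows "f \<circ> s \<in> colorings A I \<pi>"
  using assms card_vimage_permutes[OF assms(2), of "\<lambda>y. f y = i" for i]
  by (auto simp: colorings_def PiE_iff extensional_def permutes_in_image permutes_not_in)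

lemma colorings_transitive:
  assumes "finite A" "f \<in> colorings A I \<pi>" "g \<in> colorings A I \<pi>"
  obtains s where "s permutes A" "f = g \<circ> s"
proof -
  have "card {x\<in>A. f x = i} = card {x\<in>A. g x = i}" for i
  proof (cases "i \<in> I")
    case True
    then have "int (card {x\<in>A. f x = i}) = int (card {x\<in>A. g x = i})"
      using assms by (simp add: colorings_def)
    then show ?thesis by simp
  next
    case False
    then have "{x\<in>A. f x = i} = {}" "{x\<in>A. g x = i} = {}" using assms by (auto simp: colorings_def)
    then show ?thesis by (simp only:)
  qed
  from permutes_between_equal_fibres[OF \<open>finite A\<close>, of f g, OF this]
  obtain s where s: "s permutes A" "\<And>x. x \<in> A \<Longrightarrow> f x = g (s x)" by metis
  have "f x = g (s x)" for x
    using s assms by (cases "x \<in> A") (auto simp: colorings_def PiE_iff extensional_def permutes_not_in)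
  then show ?thesis using that s(1) by (auto simp: fun_eq_iff)
qed

lemma colorings_nonempty:
  assumes "finite A" "finite I" and nonneg: "\<And>i. i \<in> I \<Longrightarrow> \<pi> i \<ge> 0" and "(\<Sum>i\<in>I. \<pi> i) = int (card A)"
  shows "colorings A I \<pi> \<noteq> {}"
proof -
  define S where "S = (SIGMA i:I. {..<nat (\<pi> i)})"
  have "int (card S) = (\<Sum>i\<in>I. \<pi> i)"
    using assms by (simp add: S_def)
  then have "int (card A) = int (card S)"
    using assms(4) by (simp only:)
  moreover have "finite S"
    using \<open>finite I\<close> by (simp add: S_def)
  ultimately have "card A = card S" "finite S"
    by (simp_all only: of_nat_eq_iff)
  then obtain b where b: "bij_betw b A S"
    using finite_same_card_bij[OF \<open>finite A\<close>] by blast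
  define f where "f = (\<lambda>x\<in>A. fst (b x))"
  have "card {x\<in>A. f x = i} = nat (\<pi> i)" if "i \<in> I" for i
  proof -
    have "b ` {x\<in>A. f x = i} = {z \<in> b ` A. fst z = i}"
      by (auto simp: f_def)
    also have "\<dots> = {i} \<times> {..<nat (\<pi> i)}"
      using that unfolding bij_betw_imp_surj_on[OF b] by (auto simp: S_def)
    finally have "b ` {x\<in>A. f x = i} = {i} \<times> {..<nat (\<pi> i)}" .
    moreover have "inj_on b {x\<in>A. f x = i}"
      using bij_betw_imp_inj_on[OF b] by (rule inj_on_subset) auto
    ultimately show ?thesis
      using card_image[of b "{x\<in>A. f x = i}"] by (simp add: card_cartesian_product_singleton)
  qed
  moreover have "f x \<in> I" if "x \<in> A" for x
    using that bij_betwE[OF b] by (auto simp: f_def S_def)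
  moreover have "f \<in> extensional A" by (simp add: f_def)
  ultimately have "f \<in> colorings A I \<pi>"
    using nonneg by (simp add: colorings_def PiE_iff)
  then show ?thesis by blast
qed

lemma card_permutes: "finite A \<Longrightarrow> card {s. s permutes A} = fact (card A)"
  using card_permutations by blast

text \<open>Burnside's count of orbits: the average number of fixed points of a transitive action is 1.\<close>

lemma avg_perm_char:
  fixes A :: "'a set" and I :: "'i set"
  assumes A: "finite A" and I: "finite I"
    and nonneg: "\<And>i. i \<in> I \<Longrightarrow> \<pi> i \<ge> 0" and total: "(\<Sum>i\<in>I. \<pi> i) = int (card A)"
  shows "avg A (perm_char A I \<pi>) = 1"
proof -
  obtain g where g: "g \<in> colorings A I \<pi>"
    using colorings_nonempty[of A I \<pi>] assms by blast
  let ?G = "{s. s permutes A}" and ?X = "colorings A I \<pi>"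
  have fin: "finite ?G" "finite ?X" using A I by (auto simp: finite_permutations finite_colorings)
  have stab: "card {s\<in>?G. f \<circ> s = f} = card {s\<in>?G. g \<circ> s = f}" if f: "f \<in> ?X" for f
  proof -
    obtain t where t: "t permutes A" "f = g \<circ> t" using colorings_transitive[OF A f g] .
    have "bij_betw (\<lambda>s. t \<circ> s) {s\<in>?G. f \<circ> s = f} {s\<in>?G. g \<circ> s = f}"
      using t by (intro bij_betwI[where g="\<lambda>s. inv t \<circ> s"])
        (auto simp: permutes_compose permutes_inv comp_assoc, auto simp: fun_eq_iff permutes_inverses)
    then show ?thesis by (rule bij_betw_same_card)
  qed
  have "(\<Sum>s\<in>?G. card {f\<in>?X. f \<circ> s = f}) = (\<Sum>f\<in>?X. card {s\<in>?G. f \<circ> s = f})"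
    by (rule sum_multicount_gen[symmetric]) (use fin in auto)
  also have "\<dots> = (\<Sum>f\<in>?X. card {s\<in>?G. g \<circ> s = f})" by (intro sum.cong stab refl)
  also have "\<dots> = card ?G"
    by (rule card_eq_sum_fibres[symmetric]) (use fin colorings_compose[OF g] in auto)
  finally have "(\<Sum>s\<in>?G. perm_char A I \<pi> s) = real (card ?G)"
    by (simp add: perm_char_def flip: of_nat_sum)
  then show ?thesis by (simp add: avg_def card_permutes A)
qed

text \<open>A pair of colorings is one coloring by pairs of colors, and a permutation fixes both members iff it
  fixes the pair. The numbers of points with a given pair of colors form the matrix.\<close>

lemma perm_char_times:
  fixes A :: "'a set" and I :: "'i set"
  assumes A: "finite A" and I: "finite I" and s: "s permutes A"
  shows "perm_char A I \<pi> s * perm_char A {..<l} \<kappa> s =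
    (\<Sum>M\<in>contingency I \<pi> l \<kappa>. perm_char A (I \<times> {..<l}) (\<lambda>(i, j). int (M i j)) s)"
proof -
  let ?F = "{f \<in> colorings A I \<pi>. f \<circ> s = f}" and ?K = "{g \<in> colorings A {..<l} \<kappa>. g \<circ> s = g}"
  define H where "H = {h \<in> A \<rightarrow>\<^sub>E I \<times> {..<l}. h \<circ> s = h \<and>
     (\<forall>i\<in>I. int (card {x\<in>A. fst (h x) = i}) = \<pi> i) \<and> (\<forall>j<l. int (card {x\<in>A. snd (h x) = j}) = \<kappa> j)}"
  define mat where "mat h = (\<lambda>i\<in>I. \<lambda>j. card {x\<in>A. h x = (i, j)})" for h :: "'a \<Rightarrow> 'i \<times> nat"
  have finH: "finite H"
    unfolding H_def using A I by (intro finite_subset[OF _ finite_PiE[of A "\<lambda>_. I \<times> {..<l}"]]) auto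
  have rows: "(\<Sum>j<l. card {x\<in>A. h x = (i, j)}) = card {x\<in>A. fst (h x) = i}"
    if h: "h \<in> A \<rightarrow>\<^sub>E I \<times> {..<l}" for h and i
  proof -
    have "{x\<in>{x\<in>A. fst (h x) = i}. snd (h x) = j} = {x\<in>A. h x = (i, j)}" for j
      by (auto simp: prod_eq_iff)
    moreover have "snd (h x) \<in> {..<l}" if "x \<in> A" for x
      using PiE_mem[OF h that] by (simp add: mem_Times_iff)
    ultimately show ?thesis
      using card_eq_sum_fibres[of "{x\<in>A. fst (h x) = i}" "{..<l}" "\<lambda>x. snd (h x)"] A by simp
  qed
  have cols: "(\<Sum>i\<in>I. card {x\<in>A. h x = (i, j)}) = card {x\<in>A. snd (h x) = j}"
    if h: "h \<in> A \<rightarrow>\<^sub>E I \<times> {..<l}" for h and j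
  proof -
    have "{x\<in>{x\<in>A. snd (h x) = j}. fst (h x) = i} = {x\<in>A. h x = (i, j)}" for i
      by (auto simp: prod_eq_iff)
    moreover have "fst (h x) \<in> I" if "x \<in> A" for x
      using PiE_mem[OF h that] by (simp add: mem_Times_iff)
    ultimately show ?thesis
      using card_eq_sum_fibres[of "{x\<in>A. snd (h x) = j}" I "\<lambda>x. fst (h x)"] A I by simp
  qed
  have bij: "bij_betw (\<lambda>(f, g). \<lambda>x\<in>A. (f x, g x)) (?F \<times> ?K) H"
  proof (rule bij_betwI[where g="\<lambda>h. ((\<lambda>x\<in>A. fst (h x)), (\<lambda>x\<in>A. snd (h x)))"])
    show "(\<lambda>(f, g). \<lambda>x\<in>A. (f x, g x)) \<in> ?F \<times> ?K \<rightarrow> H"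
      using s by (auto simp: H_def colorings_def fun_eq_iff permutes_in_image cong: conj_cong)
    show "(\<lambda>h. ((\<lambda>x\<in>A. fst (h x)), (\<lambda>x\<in>A. snd (h x)))) \<in> H \<rightarrow> ?F \<times> ?K"
      using s by (auto simp: H_def colorings_def fun_eq_iff permutes_in_image PiE_iff mem_Times_iff cong: conj_cong)
  qed (auto simp: H_def colorings_def fun_eq_iff PiE_iff extensional_def)
  have mat: "mat h \<in> contingency I \<pi> l \<kappa>" if h: "h \<in> H" for h
  proof -
    have zero: "card {x\<in>A. h x = (i, j)} = 0" if "j \<ge> l" for i j
    proof -
      have "{x\<in>A. h x = (i, j)} = {}" using h that by (force simp: H_def PiE_iff)
      then show ?thesis by (simp only: card.empty)
    qed
    show ?thesis
      using h rows[of h] cols[of h] zero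
      by (auto simp: contingency_def comps_def mat_def H_def simp flip: of_nat_sum)
  qed
  have fibre: "{h\<in>H. mat h = M} = {h \<in> colorings A (I \<times> {..<l}) (\<lambda>(i, j). int (M i j)). h \<circ> s = h}"
    if M: "M \<in> contingency I \<pi> l \<kappa>" for M
  proof -
    have "h \<in> H \<and> mat h = M \<longleftrightarrow> h \<in> colorings A (I \<times> {..<l}) (\<lambda>(i, j). int (M i j)) \<and> h \<circ> s = h" for h
    proof
      assume "h \<in> H \<and> mat h = M"
      then show "h \<in> colorings A (I \<times> {..<l}) (\<lambda>(i, j). int (M i j)) \<and> h \<circ> s = h"
        by (auto simp: H_def colorings_def mat_def)
    next
      assume h: "h \<in> colorings A (I \<times> {..<l}) (\<lambda>(i, j). int (M i j)) \<and> h \<circ> s = h"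
      then have hP: "h \<in> A \<rightarrow>\<^sub>E I \<times> {..<l}" by (simp add: colorings_def)
      have cnt: "card {x\<in>A. h x = (i, j)} = M i j" if "i \<in> I" "j < l" for i j
        using h that by (auto simp: colorings_def)
      have M0: "M i j = 0" if "i \<in> I" "j \<ge> l" for i j
        using M that by (auto simp: contingency_def comps_def)
      have h0: "card {x\<in>A. h x = (i, j)} = 0" if "j \<ge> l" for i j
      proof -
        have "{x\<in>A. h x = (i, j)} = {}" using hP that by (force simp: PiE_iff)
        then show ?thesis by (simp only: card.empty)
      qed
      have "mat h i = M i" if "i \<in> I" for i
        using that cnt M0 h0 by (auto simp: mat_def fun_eq_iff) (metis linorder_not_less)
      moreover have "mat h i = M i" if "i \<notin> I" for i
        using that M by (auto simp: mat_def contingency_def PiE_iff extensional_def)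
      ultimately have "mat h = M" by auto
      moreover have "h \<in> H"
      proof -
        have "int (card {x\<in>A. fst (h x) = i}) = \<pi> i" if "i \<in> I" for i
          using M that cnt by (auto simp: contingency_def comps_def PiE_iff simp flip: rows[OF hP])
        moreover have "int (card {x\<in>A. snd (h x) = j}) = \<kappa> j" if "j < l" for j
          using M that cnt by (auto simp: contingency_def simp flip: cols[OF hP])
        ultimately show ?thesis using h hP by (auto simp: H_def)
      qed
      ultimately show "h \<in> H \<and> mat h = M" by simp
    qed
    then show ?thesis by blast
  qed
  have "card ?F * card ?K = card H"
    using bij_betw_same_card[OF bij] by (simp add: card_cartesian_product)
  also have "\<dots> = (\<Sum>M\<in>contingency I \<pi> l \<kappa>. card {h\<in>H. mat h = M})"
    by (rule card_eq_sum_fibres) (use finH I mat in auto)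
  also have "\<dots> = (\<Sum>M\<in>contingency I \<pi> l \<kappa>. card {h \<in> colorings A (I \<times> {..<l}) (\<lambda>(i, j). int (M i j)). h \<circ> s = h})"
    by (intro sum.cong refl) (simp add: fibre)
  finally show ?thesis
    by (simp add: perm_char_def flip: of_nat_mult of_nat_sum)
qed

section \<open>Alternating counts of contingency matrices and Jacobi-Trudi characters\<close>

text \<open>The alternating sum over \<open>\<rho>\<close> of the numbers of matrices with row sums \<open>L\<close> and column sums \<open>x i + \<rho> i\<close>,
  computed one row at a time (see \<open>alternating_sum_contingency\<close>). For \<open>x i = p i - i\<close> with a partition
  \<open>p\<close> it is the Kostka number of shape \<open>p\<close> and content \<open>L\<close>.\<close>

fun alt_kostka :: "nat \<Rightarrow> (nat \<Rightarrow> int) \<Rightarrow> int list \<Rightarrow> int" where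
  "alt_kostka l x [] =
     (\<Sum>\<rho> | \<rho> permutes {..<l}. sign \<rho> * (if \<forall>i<l. x i + int (\<rho> i) = 0 then 1 else 0))"
| "alt_kostka l x (r # L) = (\<Sum>c\<in>comps l r. alt_kostka l (\<lambda>i. x i - int (c i)) L)"

text \<open>The vectors \<open>x i = p i - i\<close> for partitions \<open>p\<close> with at most \<open>l\<close> parts. The value at \<open>l\<close> encodes the
  part 0 that follows the last one, so that the last row obeys the same condition as the others.\<close>

definition shifted_partition :: "nat \<Rightarrow> (nat \<Rightarrow> int) \<Rightarrow> bool" where
  "shifted_partition l x \<longleftrightarrow> (\<forall>i<l. x (Suc i) < x i) \<and> x l = - int l"

text \<open>The horizontal strips of size \<open>r\<close> that can be removed from the partition: what is left of row \<open>i\<close> is at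
  least as long as row \<open>i + 1\<close> was.\<close>

definition strips :: "nat \<Rightarrow> (nat \<Rightarrow> int) \<Rightarrow> int \<Rightarrow> (nat \<Rightarrow> nat) set" where
  "strips l x r = {c \<in> comps l r. \<forall>i<l. int (c i) < x i - x (Suc i)}"

lemma finite_strips [simp]: "finite (strips l x r)"
  by (simp add: strips_def)

lemma sign_permutes_compose:
  "finite S \<Longrightarrow> p permutes S \<Longrightarrow> q permutes S \<Longrightarrow> sign (p \<circ> q) = sign p * sign q"
  by (meson permutes_imp_permutation sign_compose)

lemma comps_compose:
  assumes "\<tau> permutes {..<l}"
  shows "bij_betw (\<lambda>c. c \<circ> \<tau>) (comps l r) (comps l r)"
proof -
  have *: "c \<circ> \<tau> \<in> comps l r" if "c \<in> comps l r" "\<tau> permutes {..<l}" for c \<tau>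
    using that sum.permute[OF that(2), of c] by (auto simp: comps_def permutes_not_in o_def simp del: of_nat_sum)
  show ?thesis
    by (rule bij_betwI[where g="\<lambda>c. c \<circ> inv \<tau>"])
      (use * assms permutes_inv[OF assms] in \<open>auto simp: comp_assoc permutes_inv_o\<close>)
qed

text \<open>The sum over \<open>\<rho>\<close> is antisymmetric in \<open>x\<close>, since the number of matrices is symmetric in the columns.\<close>

lemma alt_kostka_permute:
  assumes \<tau>: "\<tau> permutes {..<l}"
  shows "alt_kostka l (x \<circ> \<tau>) L = sign \<tau> * alt_kostka l x L"
proof (induction L arbitrary: x)
  case Nil
  let ?G = "{\<rho>. \<rho> permutes {..<l}}"
  have all: "(\<forall>i<l. x (\<tau> i) + int (\<rho> (\<tau> i)) = 0) = (\<forall>i<l. x i + int (\<rho> i) = 0)" for \<rho>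
    using ball_simps(9)[of \<tau> "{..<l}" "\<lambda>i. x i + int (\<rho> i) = 0"]
    unfolding permutes_image[OF \<tau>] by (auto simp: Ball_def)
  have "alt_kostka l (x \<circ> \<tau>) [] = (\<Sum>\<rho>\<in>?G. sign (\<rho> \<circ> \<tau>) * (if \<forall>i<l. x (\<tau> i) + int ((\<rho> \<circ> \<tau>) i) = 0 then 1 else 0))"
    unfolding alt_kostka.simps by (subst sum_permutations_compose_right[OF \<tau>]) simp
  also have "\<dots> = (\<Sum>\<rho>\<in>?G. sign \<tau> * (sign \<rho> * (if \<forall>i<l. x i + int (\<rho> i) = 0 then 1 else 0)))"
    using \<tau> by (intro sum.cong refl) (simp add: all sign_permutes_compose[of "{..<l}"])
  finally show ?case by (simp add: sum_distrib_left)
next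
  case (Cons r L)
  have "alt_kostka l (x \<circ> \<tau>) (r # L) = (\<Sum>c\<in>comps l r. alt_kostka l (\<lambda>i. (x \<circ> \<tau>) i - int ((c \<circ> \<tau>) i)) L)"
    unfolding alt_kostka.simps
    by (subst sum.reindex_bij_betw[OF comps_compose[OF \<tau>], symmetric]) simp
  also have "\<dots> = (\<Sum>c\<in>comps l r. alt_kostka l ((\<lambda>i. x i - int (c i)) \<circ> \<tau>) L)"
    by (simp add: o_def)
  finally show ?case by (simp add: Cons.IH sum_distrib_left)
qed

lemma alt_kostka_low:
  assumes "i < l" "x i \<le> - int l"
  shows "alt_kostka l x L = 0"
  using assms
proof (induction L arbitrary: x)
  case Nil
  have "\<not> (\<forall>i<l. x i + int (\<rho> i) = 0)" if "\<rho> permutes {..<l}" for \<rho>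
  proof -
    have "\<rho> i < l" using Nil that by (metis lessThan_iff permutes_in_image)
    then have "x i + int (\<rho> i) \<noteq> 0" using Nil by linarith
    then show ?thesis using Nil by blast
  qed
  then show ?case unfolding alt_kostka.simps by (intro sum.neutral) auto
next
  case (Cons r L)
  then show ?case unfolding alt_kostka.simps by (intro sum.neutral ballI Cons.IH) auto
qed

lemma sum_exchange_adjacent:
  fixes c :: "nat \<Rightarrow> nat"
  assumes "Suc i < l" "d \<le> c i"
  shows "sum (c(i := c (Suc i) + d, Suc i := c i - d)) {..<l} = sum c {..<l}"
proof -
  have "sum f {..<l} = f i + (f (Suc i) + sum f ({..<l} - {i} - {Suc i}))" for f :: "nat \<Rightarrow> nat"
    using assms by (subst sum.remove[of _ i], simp, simp, subst sum.remove[of _ "Suc i"]) auto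
  note this[of c] this[of "c(i := c (Suc i) + d, Suc i := c i - d)"]
  moreover have "sum (c(i := c (Suc i) + d, Suc i := c i - d)) ({..<l} - {i} - {Suc i})
      = sum c ({..<l} - {i} - {Suc i})"
    by (intro sum.cong) auto
  ultimately show ?thesis using assms by simp
qed

text \<open>The Pieri rule. The compositions that are no horizontal strips cancel in pairs: at the first row that
  becomes too short, exchange the values of \<open>x - c\<close> in this row and the next, which changes the sign by
  antisymmetry. In the last row there is no partner, but there \<open>x - c\<close> is so low that its term is 0.\<close>

lemma alt_kostka_Cons_strips:
  assumes x: "shifted_partition l x"
  shows "alt_kostka l x (r # L) = (\<Sum>c\<in>strips l x r. alt_kostka l (\<lambda>i. x i - int (c i)) L)"
proof -
  define f where "f c = alt_kostka l (\<lambda>i. x i - int (c i)) L" for c :: "nat \<Rightarrow> nat"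
  define bad where "bad c i \<longleftrightarrow> x i - x (Suc i) \<le> int (c i)" for c :: "nat \<Rightarrow> nat" and i
  define V where "V i = {c \<in> comps l r. bad c i \<and> (\<forall>j<i. \<not> bad c j)}" for i
  have zero: "sum f (V i) = 0" if i: "i < l" for i
  proof (cases "Suc i = l")
    case True
    have "f c = 0" if "c \<in> V i" for c
      unfolding f_def using that x i True
      by (intro alt_kostka_low[of i]) (auto simp: V_def bad_def shifted_partition_def)
    then show ?thesis by (simp add: sum.neutral)
  next
    case False
    then have Si: "Suc i < l" using i by simp
    \<comment> \<open>in terms of \<open>c\<close>, exchanging two adjacent values of \<open>x - c\<close> moves \<open>d\<close> units between rows\<close>
    define d where "d = nat (x i - x (Suc i))"
    have d: "int d = x i - x (Suc i)"
      using x i by (auto simp: d_def shifted_partition_def)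
    let ?\<tau> = "transpose i (Suc i)"
    define \<Phi> where "\<Phi> c = c(i := c (Suc i) + d, Suc i := c i - d)" for c :: "nat \<Rightarrow> nat"
    have \<Phi>V: "\<Phi> c \<in> V i" if "c \<in> V i" for c
    proof -
      have "d \<le> c i" using that d by (simp add: V_def bad_def)
      then have "\<Phi> c \<in> comps l r"
        using that Si sum_exchange_adjacent[OF Si, of d c] by (auto simp: V_def comps_def \<Phi>_def simp del: of_nat_sum)
      moreover have "bad (\<Phi> c) i" "\<forall>j<i. \<not> bad (\<Phi> c) j"
        using that d by (auto simp: V_def bad_def \<Phi>_def)
      ultimately show ?thesis by (simp add: V_def)
    qed
    have \<Phi>\<Phi>: "\<Phi> (\<Phi> c) = c" if "c \<in> V i" for c
      using that d by (auto simp: \<Phi>_def V_def bad_def fun_eq_iff)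
    have bij: "bij_betw \<Phi> (V i) (V i)"
      by (rule bij_betwI[where g=\<Phi>]) (auto simp: \<Phi>V \<Phi>\<Phi>)
    have neg: "f (\<Phi> c) = - f c" if "c \<in> V i" for c
    proof -
      have "(\<lambda>j. x j - int (\<Phi> c j)) = (\<lambda>j. x j - int (c j)) \<circ> ?\<tau>"
        using that d by (auto simp: \<Phi>_def V_def bad_def fun_eq_iff transpose_def of_nat_diff)
      moreover have "?\<tau> permutes {..<l}" using Si by (intro permutes_swap_id) auto
      ultimately show ?thesis
        by (simp add: f_def alt_kostka_permute sign_swap_id)
    qed
    have "sum f (V i) = (\<Sum>c\<in>V i. f (\<Phi> c))"
      by (rule sum.reindex_bij_betw[OF bij, symmetric])
    also have "\<dots> = - sum f (V i)" by (simp add: neg sum_negf)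
    finally show ?thesis by simp
  qed
  have split: "comps l r = strips l x r \<union> (\<Union>i<l. V i)"
  proof -
    have "\<exists>i<l. c \<in> V i" if c: "c \<in> comps l r" "c \<notin> strips l x r" for c
    proof -
      obtain i where i: "i < l" "bad c i" using c by (auto simp: strips_def bad_def not_less)
      define j where "j = (LEAST i. bad c i)"
      have "bad c j" "j \<le> i" "\<forall>k<j. \<not> bad c k"
        unfolding j_def using i(2) by (auto intro: LeastI Least_le dest: not_less_Least)
      then show ?thesis using i c by (auto simp: V_def intro!: exI[of _ j])
    qed
    then show ?thesis by (auto simp: V_def strips_def)
  qed
  have fin: "finite (V i)" for i by (simp add: V_def)
  have "sum f (comps l r) = sum f (strips l x r) + sum f (\<Union>i<l. V i)"
    unfolding split
  proof (rule sum.union_disjoint)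
    show "strips l x r \<inter> (\<Union>i<l. V i) = {}" by (fastforce simp: V_def strips_def bad_def)
  qed (use fin in simp_all)
  also have "sum f (\<Union>i<l. V i) = (\<Sum>i<l. sum f (V i))"
    by (intro sum.UNION_disjoint) (use fin in \<open>auto simp: V_def, metis linorder_neqE_nat\<close>)
  also have "\<dots> = 0" using zero by simp
  finally show ?thesis by (simp add: f_def)
qed

lemma shifted_partition_strip:
  assumes "shifted_partition l x" "c \<in> strips l x r"
  shows "shifted_partition l (\<lambda>i. x i - int (c i))"
  using assms by (force simp: shifted_partition_def strips_def comps_def)

lemma shifted_partition_ge:
  assumes "shifted_partition l x" "i \<le> l"
  shows "- int i \<le> x i"
  using assms(2)
proof (induction rule: inc_induct)
  case base
  then show ?case using assms by (simp add: shifted_partition_def)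
next
  case (step i)
  then show ?case using assms by (force simp: shifted_partition_def)
qed

lemma alt_kostka_Nil:
  assumes x: "shifted_partition l x"
  shows "alt_kostka l x [] = (if \<forall>i<l. x i = - int i then 1 else 0)"
proof -
  have "\<rho> = id" if \<rho>: "\<rho> permutes {..<l}" "\<forall>i<l. x i + int (\<rho> i) = 0" for \<rho>
  proof (rule permutes_natset_le[OF \<rho>(1)], intro ballI)
    fix i assume "i \<in> {..<l}"
    then show "\<rho> i \<le> i" using \<rho>(2) shifted_partition_ge[OF x, of i] by force
  qed
  then have "alt_kostka l x [] = (\<Sum>\<rho> | \<rho> permutes {..<l}. if \<rho> = id then (if \<forall>i<l. x i = - int i then 1 else 0) else 0)"
    unfolding alt_kostka.simps
    by (intro sum.cong refl) (auto simp: eq_neg_iff_add_eq_0)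
  then show ?thesis by (simp add: sum.delta finite_permutations permutes_id)
qed

lemma alt_kostka_Cons_nonzero:
  assumes "shifted_partition l x" "alt_kostka l x (r # L) \<noteq> 0"
  obtains c where "c \<in> strips l x r" "alt_kostka l (\<lambda>i. x i - int (c i)) L \<noteq> 0"
  using assms by (auto simp del: alt_kostka.simps simp: alt_kostka_Cons_strips elim: sum.not_neutral_contains_not_neutral)

text \<open>Removing a horizontal strip shortens every column by at most one, so the number of nonzero parts is at
  most the number of content entries.\<close>

lemma alt_kostka_nonzero_length:
  assumes "shifted_partition l x" "alt_kostka l x L \<noteq> 0" "length L \<le> i" "i < l"
  shows "x i = - int i"
  using assms
proof (induction L arbitrary: x i)
  case Nil
  then show ?case by (auto simp: alt_kostka_Nil simp del: alt_kostka.simps split: if_splits)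
next
  case (Cons r L)
  obtain c where c: "c \<in> strips l x r" "alt_kostka l (\<lambda>i. x i - int (c i)) L \<noteq> 0"
    using alt_kostka_Cons_nonzero Cons.prems by metis
  obtain k where k: "i = Suc k" "length L \<le> k" using Cons.prems(3) by (cases i) auto
  have "x k - int (c k) = - int k"
    using Cons.IH[OF shifted_partition_strip[OF Cons.prems(1) c(1)] c(2)] k Cons.prems by simp
  moreover have "int (c k) < x k - x i" using c(1) k Cons.prems by (simp add: strips_def)
  ultimately show ?case using shifted_partition_ge[OF Cons.prems(1), of i] k Cons.prems by simp
qed

lemma alt_kostka_nonzero_suffix:
  assumes "shifted_partition l x" "alt_kostka l x (L1 @ L2) \<noteq> 0"
  obtains y where "shifted_partition l y" "\<And>i. y i \<le> x i" "alt_kostka l y L2 \<noteq> 0"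
  using assms
proof (induction L1 arbitrary: x thesis)
  case Nil
  then show ?case by simp
next
  case (Cons r L1)
  obtain c where c: "c \<in> strips l x r" "alt_kostka l (\<lambda>i. x i - int (c i)) (L1 @ L2) \<noteq> 0"
    using alt_kostka_Cons_nonzero Cons.prems by (metis append_Cons)
  obtain y where y: "shifted_partition l y" "\<And>i. y i \<le> x i - int (c i)" "alt_kostka l y L2 \<noteq> 0"
    using Cons.IH[OF _ shifted_partition_strip[OF Cons.prems(2) c(1)] c(2)] by metis
  have "y i \<le> x i" for i using y(2)[of i] by linarith
  then show ?case using Cons.prems(1) y by blast
qed

lemma alt_kostka_nonzero_total:
  assumes "alt_kostka l x L \<noteq> 0"
  shows "sum_list L = (\<Sum>i<l. x i + int i)"
  using assms
proof (induction L arbitrary: x)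
  case Nil
  then obtain \<rho> where \<rho>: "\<rho> permutes {..<l}" "\<forall>i<l. x i + int (\<rho> i) = 0"
    by (auto elim!: sum.not_neutral_contains_not_neutral split: if_splits)
  have "(\<Sum>i<l. int (\<rho> i)) = (\<Sum>i<l. int i)" using sum.permute[OF \<rho>(1), of int] by (simp add: o_def)
  moreover have "(\<Sum>i<l. x i + int (\<rho> i)) = 0" using \<rho>(2) by simp
  ultimately show ?case by (simp add: sum.distrib)
next
  case (Cons r L)
  then obtain c where "c \<in> comps l r" "alt_kostka l (\<lambda>i. x i - int (c i)) L \<noteq> 0"
    by (auto elim: sum.not_neutral_contains_not_neutral)
  with Cons.IH[OF this(2)] show ?case by (simp add: comps_def sum.distrib sum_subtractf)
qed

text \<open>The shape dominates the content: the entries in \<open>L2\<close> are those that remain after removing the strips for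
  \<open>L1\<close>, and they fill a subdiagram with at most \<open>length L2\<close> rows.\<close>

lemma alt_kostka_nonzero_dominance:
  assumes "shifted_partition l x" "alt_kostka l x (L1 @ L2) \<noteq> 0" "length L2 \<le> l"
  shows "sum_list L2 \<le> (\<Sum>i<length L2. x i + int i)"
proof -
  obtain y where y: "shifted_partition l y" "\<And>i. y i \<le> x i" "alt_kostka l y L2 \<noteq> 0"
    using alt_kostka_nonzero_suffix assms(1,2) by metis
  have "sum_list L2 = (\<Sum>i<l. y i + int i)" using alt_kostka_nonzero_total[OF y(3)] .
  also have "\<dots> = (\<Sum>i<length L2. y i + int i)"
    using alt_kostka_nonzero_length[OF y(1,3)] assms(3) by (intro sum.mono_neutral_right) (auto simp: not_less)
  also have "\<dots> \<le> (\<Sum>i<length L2. x i + int i)" using y(2) by (intro sum_mono) (simp add: add_right_mono)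
  finally show ?thesis .
qed

text \<open>There is only one semistandard tableau whose content equals its shape. The content is listed from the
  last row upwards because the head of the list is removed first; each strip must then be
  the whole last row.\<close>

lemma alt_kostka_self:
  assumes "shifted_partition l x" "k \<le> l" "\<And>i. k \<le> i \<Longrightarrow> i < l \<Longrightarrow> x i = - int i"
  shows "alt_kostka l x (map (\<lambda>i. x i + int i) (rev [0..<k])) = 1"
  using assms
proof (induction k arbitrary: x)
  case 0
  then show ?case by (simp add: alt_kostka_Nil del: alt_kostka.simps)
next
  case (Suc k)
  let ?L = "map (\<lambda>i. x i + int i) (rev [0..<k])"
  define r where "r = x k + int k"
  have r: "r \<ge> 0" using shifted_partition_ge[OF Suc.prems(1), of k] Suc.prems(2) by (simp add: r_def)
  define c0 where "c0 = (\<lambda>i. if i = k then nat r else 0)"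
  have c0sum: "int (sum c0 {..<l}) = r" using Suc.prems(2) r by (simp add: c0_def)
  have c0: "c0 \<in> strips l x r"
  proof -
    have "int (c0 i) < x i - x (Suc i)" if "i < l" for i
    proof (cases "i = k")
      case True
      have "x (Suc k) = - int (Suc k)"
        using Suc.prems by (cases "Suc k = l") (auto simp: shifted_partition_def)
      then show ?thesis using True r by (simp add: c0_def r_def)
    qed (use that Suc.prems(1) in \<open>auto simp: c0_def shifted_partition_def\<close>)
    then show ?thesis using c0sum Suc.prems(2) by (auto simp: strips_def comps_def c0_def simp del: of_nat_sum)
  qed
  have uniq: "alt_kostka l (\<lambda>i. x i - int (c i)) ?L = 0" if c: "c \<in> strips l x r" "c \<noteq> c0" for c
  proof (rule ccontr)
    assume nz: "alt_kostka l (\<lambda>i. x i - int (c i)) ?L \<noteq> 0"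
    have "x k - int (c k) = - int k"
      using alt_kostka_nonzero_length[OF shifted_partition_strip[OF Suc.prems(1) c(1)] nz, of k] Suc.prems(2) by simp
    then have ck: "int (c k) = r" by (simp add: r_def)
    have "int (\<Sum>i<l. c i) = r" using c(1) by (simp add: strips_def comps_def)
    moreover have "(\<Sum>i<l. c i) = c k + sum c ({..<l} - {k})" using Suc.prems(2) by (subst sum.remove[of _ k]) auto
    ultimately have "sum c ({..<l} - {k}) = 0" using ck by linarith
    then have "c i = c0 i" for i
      using c(1) ck by (cases "i < l") (auto simp: c0_def strips_def comps_def)
    then show False using c(2) by auto
  qed
  have "alt_kostka l x (map (\<lambda>i. x i + int i) (rev [0..<Suc k])) = (\<Sum>c\<in>strips l x r. alt_kostka l (\<lambda>i. x i - int (c i)) ?L)"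
    using alt_kostka_Cons_strips[OF Suc.prems(1)] by (simp add: r_def del: alt_kostka.simps)
  also have "\<dots> = (\<Sum>c\<in>{c0}. alt_kostka l (\<lambda>i. x i - int (c i)) ?L)"
    using c0 uniq by (intro sum.mono_neutral_right) auto
  also have "\<dots> = alt_kostka l (\<lambda>i. x i - int (c0 i)) (map (\<lambda>i. (x i - int (c0 i)) + int i) (rev [0..<k]))"
  proof -
    have "?L = map (\<lambda>i. (x i - int (c0 i)) + int i) (rev [0..<k])"
      by (intro map_cong refl) (auto simp: c0_def)
    from arg_cong[OF this, of "alt_kostka l (\<lambda>i. x i - int (c0 i))"] show ?thesis
      by (simp del: map_eq_conv)
  qed
  also have "\<dots> = 1"
  proof (intro Suc.IH shifted_partition_strip[OF Suc.prems(1) c0])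
    fix i assume "k \<le> i" "i < l"
    then show "x i - int (c0 i) = - int i"
      using r Suc.prems(3)[of i] by (cases "i = k") (auto simp: c0_def r_def)
  qed (use Suc.prems in simp)
  finally show ?case .
qed

text \<open>A horizontal strip has at most one cell in each column.\<close>

lemma alt_kostka_nonzero_le:
  assumes "shifted_partition l x" "alt_kostka l x L \<noteq> 0" "r \<in> set L"
  shows "r \<le> x 0"
  using assms
proof (induction L arbitrary: x)
  case (Cons a L)
  obtain c where c: "c \<in> strips l x a" "alt_kostka l (\<lambda>i. x i - int (c i)) L \<noteq> 0"
    using alt_kostka_Cons_nonzero Cons.prems by metis
  show ?case
  proof (cases "r = a")
    case True
    have "a = (\<Sum>i<l. int (c i))" using c(1) by (simp add: strips_def comps_def)
    also have "\<dots> \<le> (\<Sum>i<l. x i - x (Suc i) - 1)" using c(1) by (intro sum_mono) (force simp: strips_def)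
    also have "\<dots> = x 0 - x l - int l"
      using sum_lessThan_telescope'[of x l] by (simp add: sum_subtractf)
    finally show ?thesis using True Cons.prems(1) by (simp add: shifted_partition_def)
  next
    case False
    then have "r \<le> x 0 - int (c 0)"
      using Cons.IH[OF shifted_partition_strip[OF Cons.prems(1) c(1)] c(2)] Cons.prems(3) by simp
    then show ?thesis by simp
  qed
qed simp

text \<open>The Jacobi-Trudi determinant of permutation characters, expanded over permutations: its \<open>(i, j)\<close> entry
  has subscript \<open>p i - i + j\<close>, where \<open>x i = p i - i\<close>.\<close>

definition jacobi_trudi :: "'a set \<Rightarrow> nat \<Rightarrow> (nat \<Rightarrow> int) \<Rightarrow> ('a \<Rightarrow> 'a) \<Rightarrow> real" where
  "jacobi_trudi A l x s =
     (\<Sum>\<rho> | \<rho> permutes {..<l}. of_int (sign \<rho>) * perm_char A {..<l} (\<lambda>i. x i + int (\<rho> i)) s)"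

lemma contingency_empty:
  "contingency {} \<pi> l \<kappa> = (if \<forall>j<l. \<kappa> j = 0 then {\<lambda>_. undefined} else {})"
  by (auto simp: contingency_def)

lemma card_contingency_insert:
  assumes "finite I" "e \<notin> I"
  shows "card (contingency (insert e I) \<pi> l \<kappa>) =
    (\<Sum>c\<in>comps l (\<pi> e). card (contingency I \<pi> l (\<lambda>j. \<kappa> j - int (c j))))"
proof -
  let ?S = "SIGMA c:comps l (\<pi> e). contingency I \<pi> l (\<lambda>j. \<kappa> j - int (c j))"
  have inj: "inj_on (\<lambda>(c, M). M(e := c)) ?S"
    by (rule inj_on_subset[OF inj_combinator[OF assms(2), of "\<lambda>i. comps l (\<pi> i)"]]) (auto simp: contingency_def)
  have sum: "(\<Sum>i\<in>I. (M(e := c)) i j) = (\<Sum>i\<in>I. M i j)" for M :: "'a \<Rightarrow> nat \<Rightarrow> nat" and c j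
    using assms(2) by (intro sum.cong) auto
  let ?P = "\<lambda>M. \<forall>j<l. int (\<Sum>i\<in>insert e I. M i j) = \<kappa> j"
  have S: "?S = {z \<in> comps l (\<pi> e) \<times> PiE I (\<lambda>i. comps l (\<pi> i)). ?P ((\<lambda>(c, M). M(e := c)) z)}"
    using assms by (auto simp: contingency_def sum algebra_simps simp del: fun_upd_apply of_nat_sum)
      (auto simp: algebra_simps)
  have "contingency (insert e I) \<pi> l \<kappa> = (\<lambda>(c, M). M(e := c)) ` ?S"
    unfolding contingency_def[of "insert e I"] PiE_insert_eq S by blast
  then have "card (contingency (insert e I) \<pi> l \<kappa>) = card ?S" using card_image[OF inj] by simp
  then show ?thesis using assms(1) by simp
qed

lemma alternating_sum_contingency:
  assumes "distinct es"
  shows "(\<Sum>\<rho> | \<rho> permutes {..<l}. sign \<rho> * int (card (contingency (set es) \<pi> l (\<lambda>i. x i + int (\<rho> i)))))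
    = alt_kostka l x (map \<pi> es)"
  using assms
proof (induction es arbitrary: x)
  case Nil
  show ?case by (auto simp: contingency_empty intro!: sum.cong)
next
  case (Cons e es)
  let ?G = "{\<rho>. \<rho> permutes {..<l}}"
  have "(\<Sum>\<rho>\<in>?G. sign \<rho> * int (card (contingency (set (e # es)) \<pi> l (\<lambda>i. x i + int (\<rho> i))))) =
    (\<Sum>\<rho>\<in>?G. \<Sum>c\<in>comps l (\<pi> e). sign \<rho> * int (card (contingency (set es) \<pi> l (\<lambda>i. (x i - int (c i)) + int (\<rho> i)))))"
    using Cons.prems by (simp add: card_contingency_insert sum_distrib_left algebra_simps)
  also have "\<dots> = (\<Sum>c\<in>comps l (\<pi> e). \<Sum>\<rho>\<in>?G. sign \<rho> * int (card (contingency (set es) \<pi> l (\<lambda>i. (x i - int (c i)) + int (\<rho> i)))))"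
    by (rule sum.swap)
  also have "\<dots> = alt_kostka l x (map \<pi> (e # es))"
    using Cons by simp
  finally show ?case .
qed

lemma avg_sum: "avg A (\<lambda>s. \<Sum>i\<in>I. f i s) = (\<Sum>i\<in>I. avg A (f i))"
  unfolding avg_def by (subst sum.swap) (simp add: sum_divide_distrib)

lemma avg_cmult: "avg A (\<lambda>s. c * f s) = c * avg A f"
  by (simp add: avg_def sum_distrib_left)

lemma avg_cong: "(\<And>s. s permutes A \<Longrightarrow> f s = g s) \<Longrightarrow> avg A f = avg A g"
  by (simp add: avg_def)

lemma avg_perm_char_times:
  assumes "finite A" "finite I" "(\<Sum>i\<in>I. \<pi> i) = int (card A)"
  shows "avg A (\<lambda>s. perm_char A I \<pi> s * perm_char A {..<l} \<kappa> s) = real (card (contingency I \<pi> l \<kappa>))"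
proof -
  have one: "avg A (perm_char A (I \<times> {..<l}) (\<lambda>(i, j). int (M i j))) = 1" if M: "M \<in> contingency I \<pi> l \<kappa>" for M
  proof (rule avg_perm_char)
    have "(\<Sum>z\<in>I \<times> {..<l}. case z of (i, j) \<Rightarrow> int (M i j)) = (\<Sum>i\<in>I. \<Sum>j<l. int (M i j))"
      by (simp add: sum.cartesian_product)
    also have "\<dots> = (\<Sum>i\<in>I. \<pi> i)"
      using M by (intro sum.cong refl) (auto simp: contingency_def comps_def)
    finally show "(\<Sum>z\<in>I \<times> {..<l}. case z of (i, j) \<Rightarrow> int (M i j)) = int (card A)"
      using assms(3) by simp
  qed (use assms in auto)
  have "avg A (\<lambda>s. perm_char A I \<pi> s * perm_char A {..<l} \<kappa> s) =
    avg A (\<lambda>s. \<Sum>M\<in>contingency I \<pi> l \<kappa>. perm_char A (I \<times> {..<l}) (\<lambda>(i, j). int (M i j)) s)"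
    by (intro avg_cong perm_char_times assms)
  also have "\<dots> = real (card (contingency I \<pi> l \<kappa>))"
    by (simp add: avg_sum one)
  finally show ?thesis .
qed

lemma avg_perm_char_times_jacobi_trudi:
  assumes "finite A" "distinct es" "(\<Sum>i\<in>set es. \<pi> i) = int (card A)"
  shows "avg A (\<lambda>s. perm_char A (set es) \<pi> s * jacobi_trudi A l x s) = of_int (alt_kostka l x (map \<pi> es))"
proof -
  let ?G = "{\<rho>. \<rho> permutes {..<l}}"
  have "avg A (\<lambda>s. perm_char A (set es) \<pi> s * jacobi_trudi A l x s) =
    avg A (\<lambda>s. \<Sum>\<rho>\<in>?G. of_int (sign \<rho>) * (perm_char A (set es) \<pi> s * perm_char A {..<l} (\<lambda>i. x i + int (\<rho> i)) s))"
    unfolding jacobi_trudi_def sum_distrib_left by (simp only: mult.left_commute)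
  also have "\<dots> = (\<Sum>\<rho>\<in>?G. of_int (sign \<rho>) * real (card (contingency (set es) \<pi> l (\<lambda>i. x i + int (\<rho> i)))))"
    using assms by (simp add: avg_sum avg_cmult avg_perm_char_times)
  also have "\<dots> = of_int (alt_kostka l x (map \<pi> es))"
    unfolding alternating_sum_contingency[OF assms(2), symmetric] by simp
  finally show ?thesis .
qed

text \<open>In the Jacobi-Trudi sum the content for \<open>\<sigma>\<close> dominates the one for the identity. If the partial sums
  compare in the other direction too, then \<open>\<sigma> = id\<close>.\<close>

lemma permutation_eq_id_if_partial_sums_le:
  fixes \<sigma> :: "nat \<Rightarrow> nat"
  assumes \<sigma>: "\<sigma> permutes {..<l}" and le: "\<And>k. k \<le> l \<Longrightarrow> (\<Sum>i<k. \<sigma> i) \<le> (\<Sum>i<k. i)"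
  shows "\<sigma> = id"
proof -
  have "\<sigma> i = i" if "i < l" for i
    using that
  proof (induction i rule: less_induct)
    case (less i)
    have eq: "\<sigma> j = j" if "j < i" for j using less that by simp
    have "\<sigma> i \<le> i" using le[of "Suc i"] less.prems eq by simp
    moreover have "\<not> \<sigma> i < i" using eq[of "\<sigma> i"] permutes_inj[OF \<sigma>] by (metis injD less_irrefl)
    ultimately show ?case by simp
  qed
  moreover have "\<sigma> i = i" if "\<not> i < l" for i using that permutes_not_in[OF \<sigma>] by simp
  ultimately show ?thesis by (auto simp: fun_eq_iff)
qed

text \<open>Expanding one factor gives an alternating sum of Kostka numbers of shape \<open>p\<close> and content
  \<open>p i - i + \<sigma> i\<close>, in which dominance kills all terms but the one for \<open>\<sigma> = id\<close>.\<close>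

lemma avg_jacobi_trudi_square:
  assumes A: "finite A" and x: "shifted_partition l x" and card: "(\<Sum>i<l. x i + int i) = int (card A)"
  shows "avg A (\<lambda>s. jacobi_trudi A l x s * jacobi_trudi A l x s) = 1"
proof -
  let ?G = "{\<rho>. \<rho> permutes {..<l}}"
  let ?row = "\<lambda>\<sigma> i. x i + int (\<sigma> i)"
  have total: "(\<Sum>i<l. ?row \<sigma> i) = int (card A)" if "\<sigma> \<in> ?G" for \<sigma>
    using card that sum.permute[of \<sigma> "{..<l}" int] by (simp add: o_def sum.distrib)
  have "avg A (\<lambda>s. jacobi_trudi A l x s * jacobi_trudi A l x s) =
    avg A (\<lambda>s. \<Sum>\<sigma>\<in>?G. of_int (sign \<sigma>) * (perm_char A (set (rev [0..<l])) (?row \<sigma>) s * jacobi_trudi A l x s))"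
    by (subst jacobi_trudi_def) (simp add: sum_distrib_right mult.assoc lessThan_atLeast0)
  also have "\<dots> = (\<Sum>\<sigma>\<in>?G. of_int (sign \<sigma>) * of_int (alt_kostka l x (map (?row \<sigma>) (rev [0..<l]))))"
    unfolding avg_sum avg_cmult using A total
    by (intro sum.cong refl arg_cong2[where f="(*)"] avg_perm_char_times_jacobi_trudi) (auto simp: lessThan_atLeast0)
  also have "\<dots> = (\<Sum>\<sigma>\<in>?G. if \<sigma> = id then 1 else 0)"
  proof (intro sum.cong refl)
    fix \<sigma> assume \<sigma>: "\<sigma> \<in> ?G"
    have "\<sigma> = id" if nz: "alt_kostka l x (map (?row \<sigma>) (rev [0..<l])) \<noteq> 0"
    proof (rule permutation_eq_id_if_partial_sums_le)
      fix k assume "k \<le> l"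
      then have "rev [0..<l] = rev [k..<l] @ rev [0..<k]"
        using upt_add_eq_append[of 0 k "l - k"] by simp
      then have "sum_list (map (?row \<sigma>) (rev [0..<k])) \<le> (\<Sum>i<k. x i + int i)"
        using alt_kostka_nonzero_dominance[OF x, of "map (?row \<sigma>) (rev [k..<l])" "map (?row \<sigma>) (rev [0..<k])"] nz \<open>k \<le> l\<close>
        by simp
      then have "(\<Sum>i<k. int (\<sigma> i)) \<le> (\<Sum>i<k. int i)"
        by (simp add: sum_list_rev interv_sum_list_conv_sum_set_nat sum.distrib lessThan_atLeast0 flip: rev_map)
      then show "(\<Sum>i<k. \<sigma> i) \<le> (\<Sum>i<k. i)" by (simp flip: of_nat_sum)
    qed (use \<sigma> in simp)
    moreover have "alt_kostka l x (map (?row id) (rev [0..<l])) = 1"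
      using alt_kostka_self[OF x, of l] by simp
    ultimately show "of_int (sign \<sigma>) * of_int (alt_kostka l x (map (?row \<sigma>) (rev [0..<l]))) = (if \<sigma> = id then 1 else 0 :: real)"
      by auto
  qed
  also have "\<dots> = 1" by (simp add: sum.delta finite_permutations)
  finally show ?thesis .
qed

section \<open>The character of a Young symmetrizer\<close>

text \<open>The row and column numbers of the points in a tableau with content \<open>\<pi>\<close> of the rows. The last assumption
  is von Neumann's lemma: a tabloid either differs from the one of the tableau by a column permutation
  or is fixed by an odd column permutation.\<close>

locale row_column =
  fixes A :: "'a set" and I :: "'i set" and \<pi> :: "'i \<Rightarrow> int" and row :: "'a \<Rightarrow> 'i" and col :: "'a \<Rightarrow> 'j"
  assumes finite_A: "finite A" and finite_I: "finite I"
    and cell_inj: "\<And>x y. x \<in> A \<Longrightarrow> y \<in> A \<Longrightarrow> row x = row y \<Longrightarrow> col x = col y \<Longrightarrow> x = y"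
    and row_coloring: "row \<in> colorings A I \<pi>"
    and alternative: "\<And>f. f \<in> colorings A I \<pi> \<Longrightarrow>
       (\<exists>q. q permutes A \<and> col \<circ> q = col \<and> f = row \<circ> q) \<or>
       (\<exists>q. q permutes A \<and> col \<circ> q = col \<and> sign q = -1 \<and> f \<circ> q = f)"
begin

definition R :: "('a \<Rightarrow> 'a) set" where "R = {s. s permutes A \<and> row \<circ> s = row}"

definition C :: "('a \<Rightarrow> 'a) set" where "C = {s. s permutes A \<and> col \<circ> s = col}"

lemma coloring_cases:
  "f \<in> colorings A I \<pi> \<Longrightarrow> (\<exists>q\<in>C. f = row \<circ> q) \<or> (\<exists>q\<in>C. sign q = -1 \<and> f \<circ> q = f)"
  using alternative by (auto simp: C_def)

abbreviation "G \<equiv> {s. s permutes A}"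

text \<open>The coefficient of \<open>x\<close> in the Young symmetrizer \<open>ab\<close>, where \<open>a\<close> is the sum of \<open>R\<close> and \<open>b\<close> the signed sum of
  \<open>C\<close>: writing \<open>x = r \<circ> inv q\<close> means that \<open>x \<circ> q\<close> preserves rows.\<close>

definition F :: "('a \<Rightarrow> 'a) \<Rightarrow> real" where
  "F x = (\<Sum>q\<in>C. if row \<circ> x \<circ> q = row then of_int (sign q) else 0)"

text \<open>The coefficient of the identity in \<open>abab\<close>; the relation \<open>abab = k ab\<close> is lemma \<open>F_convolution\<close>.\<close>

definition k :: real where "k = (\<Sum>y\<in>G. F y * F (inv y))"

text \<open>The character of the left ideal generated by the idempotent \<open>ab / k\<close>.\<close>

definition \<chi> :: "('a \<Rightarrow> 'a) \<Rightarrow> real" where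
  "\<chi> s = (\<Sum>h\<in>G. F (inv h \<circ> s \<circ> h)) / k"

lemma finite_G [simp]: "finite G" by (simp add: finite_permutations finite_A)

lemma finite_C [simp]: "finite C" and finite_R [simp]: "finite R"
  by (rule finite_subset[OF _ finite_G], auto simp: C_def R_def)+

lemma C_permutes: "q \<in> C \<Longrightarrow> q permutes A" and R_permutes: "r \<in> R \<Longrightarrow> r permutes A"
  by (auto simp: C_def R_def)

lemma o_inv_cancel:
  assumes "s permutes A"
  shows "f \<circ> s \<circ> inv s = f" "f \<circ> inv s \<circ> s = f" "inv s \<circ> (s \<circ> t) = t" "s \<circ> (inv s \<circ> t) = t"
    "inv s \<circ> s = id" "s \<circ> inv s = id"
  using permutes_inv_o[OF assms] by (simp_all add: comp_assoc) (simp_all flip: comp_assoc)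

lemma inv_comp: "s permutes A \<Longrightarrow> t permutes A \<Longrightarrow> inv (s \<circ> t) = inv t \<circ> inv s"
  by (meson o_inv_distrib permutes_bij)

lemma inv_inv: "s permutes A \<Longrightarrow> inv (inv s) = s"
  by (rule permutes_inv_inv)

lemma sign_comp: "s permutes A \<Longrightarrow> t permutes A \<Longrightarrow> sign (s \<circ> t) = sign s * sign t"
  using finite_A by (rule sign_permutes_compose)

lemma sign_inv: "s permutes A \<Longrightarrow> sign (inv s) = sign s"
  using finite_A by (meson permutes_imp_permutation sign_inverse)

lemma comp_eq_iff:
  assumes "s permutes A"
  shows "f \<circ> s = g \<longleftrightarrow> f = g \<circ> inv s" "f \<circ> s = g \<longleftrightarrow> g \<circ> inv s = f"
  using o_inv_cancel(1,2)[OF assms] by metis+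

lemma C_comp: "p \<in> C \<Longrightarrow> q \<in> C \<Longrightarrow> p \<circ> q \<in> C"
  by (auto simp: C_def permutes_compose simp flip: comp_assoc)

lemma C_inv: "q \<in> C \<Longrightarrow> inv q \<in> C"
  using comp_eq_iff[of q col col] by (auto simp: C_def permutes_inv)

lemma R_inv: "q \<in> R \<Longrightarrow> inv q \<in> R"
  using comp_eq_iff[of q row row] by (auto simp: R_def permutes_inv)

lemma id_C: "id \<in> C" by (simp add: C_def permutes_id)

lemma sum_G_left: "t permutes A \<Longrightarrow> (\<Sum>s\<in>G. f (t \<circ> s)) = (\<Sum>s\<in>G. f s)"
  using setum_permutations_compose_left[of t A f] by simp

lemma sum_G_right: "t permutes A \<Longrightarrow> (\<Sum>s\<in>G. f (s \<circ> t)) = (\<Sum>s\<in>G. f s)"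
  using sum_permutations_compose_right[of t A f] by simp

lemma sum_C_left: "t \<in> C \<Longrightarrow> (\<Sum>s\<in>C. f (t \<circ> s)) = (\<Sum>s\<in>C. f s)"
  by (rule sum.reindex_bij_witness[where i="\<lambda>s. inv t \<circ> s" and j="\<lambda>s. t \<circ> s"])
    (auto simp: C_comp C_inv o_inv_cancel C_permutes)

lemma sum_C_right: "t \<in> C \<Longrightarrow> (\<Sum>s\<in>C. f (s \<circ> t)) = (\<Sum>s\<in>C. f s)"
  by (rule sum.reindex_bij_witness[where i="\<lambda>s. s \<circ> inv t" and j="\<lambda>s. s \<circ> t"])
    (auto simp: C_comp C_inv o_inv_cancel C_permutes)

lemma sum_C_inv: "(\<Sum>s\<in>C. f (inv s)) = (\<Sum>s\<in>C. f s)"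
  by (rule sum.reindex_bij_witness[where i=inv and j=inv]) (auto simp: C_inv inv_inv C_permutes)

lemma F_left: "r \<in> R \<Longrightarrow> F (r \<circ> x) = F x"
  by (simp add: F_def R_def flip: comp_assoc)

lemma F_right:
  assumes p: "p \<in> C"
  shows "F (x \<circ> p) = of_int (sign p) * F x"
proof -
  have "F x = (\<Sum>q\<in>C. if row \<circ> x \<circ> (p \<circ> q) = row then of_int (sign (p \<circ> q)) else 0)"
    unfolding F_def by (rule sum_C_left[OF p, symmetric])
  also have "\<dots> = (\<Sum>q\<in>C. of_int (sign p) * (if row \<circ> (x \<circ> p) \<circ> q = row then of_int (sign q) else 0))"
    by (intro sum.cong refl) (auto simp: sign_comp C_permutes p comp_assoc)
  finally have "F x = of_int (sign p) * F (x \<circ> p)"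
    by (simp add: F_def sum_distrib_left)
  then show ?thesis by (simp flip: mult.assoc of_int_mult)
qed

lemma R_Int_C: 
  assumes "q \<in> C" "row \<circ> q = row"
  shows "q = id"
proof
  fix x
  have q: "q permutes A" and "col (q x) = col x" "row (q x) = row x"
    using assms by (auto simp: C_def fun_eq_iff)
  then show "q x = id x"
    using cell_inj[of "q x" x] by (cases "x \<in> A") (auto simp: permutes_in_image permutes_not_in)
qed

lemma F_id: "F id = 1"
proof -
  have "F id = (\<Sum>q\<in>C. if q = id then 1 else 0)"
    unfolding F_def using R_Int_C by (intro sum.cong refl) auto
  then show ?thesis using id_C by simp
qed

text \<open>Up to scalars, \<open>F\<close> is the only function that is invariant under \<open>R\<close> on the left and alternating under
  \<open>C\<close> on the right. By von Neumann's lemma \<open>x\<close> is either in \<open>RC\<close>, where the value follows from that at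
  \<open>id\<close>, or \<open>x \<circ> q = r \<circ> x\<close> with \<open>q\<close> odd, which forces the value to be its own negative.\<close>

lemma equivariant_eq_F:
  assumes left: "\<And>r x. r \<in> R \<Longrightarrow> x permutes A \<Longrightarrow> f (r \<circ> x) = f x"
    and right: "\<And>q x. q \<in> C \<Longrightarrow> x permutes A \<Longrightarrow> f (x \<circ> q) = of_int (sign q) * f x"
    and x: "x permutes A"
  shows "f x = f id * F x"
  using coloring_cases[OF colorings_compose[OF row_coloring x]]
proof (elim disjE bexE conjE)
  fix q assume q: "q \<in> C" "row \<circ> x = row \<circ> q"
  define r where "r = x \<circ> inv q"
  have r: "r \<in> R"
    using q x by (simp add: R_def r_def permutes_compose permutes_inv C_permutes o_inv_cancel flip: comp_assoc)
  have "x = r \<circ> id \<circ> q" using q by (simp add: r_def o_inv_cancel C_permutes)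
  then show ?thesis
    using left[OF r, of q] right[OF q(1), of id] F_left[OF r, of q] F_right[OF q(1), of id]
    by (simp add: C_permutes q F_id permutes_id)
next
  fix q assume q: "q \<in> C" "sign q = - 1" "row \<circ> x \<circ> q = row \<circ> x"
  define r where "r = x \<circ> q \<circ> inv x"
  have r: "r \<in> R"
    using q x by (simp add: R_def r_def permutes_compose permutes_inv C_permutes o_inv_cancel flip: comp_assoc)
  have "r \<circ> x = x \<circ> q" using x by (simp add: r_def o_inv_cancel)
  then have "f x = 0" "F x = 0"
    using left[OF r x] right[OF q(1) x] F_left[OF r, of x] F_right[OF q(1), of x] q(2) by simp_all
  then show ?thesis by simp
qed

lemma F_convolution:
  assumes x: "x permutes A"
  shows "(\<Sum>y\<in>G. F y * F (inv y \<circ> x)) = k * F x"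
proof -
  define f where "f x = (\<Sum>y\<in>G. F y * F (inv y \<circ> x))" for x
  have "f x = f id * F x"
  proof (rule equivariant_eq_F[OF _ _ x])
    fix r x assume r: "r \<in> R" and x: "x permutes A"
    have "f (r \<circ> x) = (\<Sum>y\<in>G. F (r \<circ> y) * F (inv (r \<circ> y) \<circ> (r \<circ> x)))"
      unfolding f_def by (rule sum_G_left[symmetric]) (rule R_permutes[OF r])
    also have "\<dots> = f x"
      unfolding f_def
      by (intro sum.cong refl) (simp add: F_left r inv_comp R_permutes comp_assoc o_inv_cancel)
    finally show "f (r \<circ> x) = f x" .
  next
    fix q x assume q: "q \<in> C"
    show "f (x \<circ> q) = of_int (sign q) * f x"
      unfolding f_def sum_distrib_left
      by (intro sum.cong refl) (simp add: F_right[OF q] flip: comp_assoc)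
  qed
  then show ?thesis by (simp add: f_def k_def)
qed

lemma sum_F_times: "(\<Sum>s\<in>G. F s * h s) = (\<Sum>q\<in>C. \<Sum>r\<in>R. of_int (sign q) * h (r \<circ> q))"
proof -
  have "(\<Sum>s\<in>G. F s * h s) = (\<Sum>q\<in>C. \<Sum>s\<in>G. if row \<circ> s \<circ> q = row then of_int (sign q) * h s else 0)"
    unfolding F_def sum_distrib_right by (subst sum.swap) (intro sum.cong refl; simp)
  also have "\<dots> = (\<Sum>q\<in>C. \<Sum>r\<in>R. of_int (sign q) * h (r \<circ> inv q))"
  proof (rule sum.cong[OF refl])
    fix q assume q: "q \<in> C"
    have "(\<Sum>s\<in>G. if row \<circ> s \<circ> q = row then of_int (sign q) * h s else 0) =
        (\<Sum>s | s \<in> G \<and> row \<circ> s \<circ> q = row. of_int (sign q) * h s)"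
      by (rule sum.inter_filter[symmetric]) simp
    also have "\<dots> = (\<Sum>r\<in>R. of_int (sign q) * h (r \<circ> inv q))"
      by (rule sum.reindex_bij_witness[where i="\<lambda>r. r \<circ> inv q" and j="\<lambda>s. s \<circ> q"])
        (use q in \<open>auto simp: R_def permutes_compose permutes_inv C_permutes o_inv_cancel simp flip: comp_assoc\<close>)
    finally show "(\<Sum>s\<in>G. if row \<circ> s \<circ> q = row then of_int (sign q) * h s else 0) =
      (\<Sum>r\<in>R. of_int (sign q) * h (r \<circ> inv q))" .
  qed
  also have "\<dots> = (\<Sum>q\<in>C. \<Sum>r\<in>R. of_int (sign (inv q)) * h (r \<circ> inv q))"
    by (intro sum.cong refl) (simp add: sign_inv C_permutes)
  also have "\<dots> = (\<Sum>q\<in>C. \<Sum>r\<in>R. of_int (sign q) * h (r \<circ> q))"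
    by (rule sum_C_inv)
  finally show ?thesis .
qed

lemma k_eq: "k = (\<Sum>q\<in>C. \<Sum>r\<in>R. of_int (sign q) * F (q \<circ> r))"
proof -
  have "k = (\<Sum>q\<in>C. \<Sum>r\<in>R. of_int (sign q) * F (inv (r \<circ> q)))"
    unfolding k_def by (rule sum_F_times)
  also have "\<dots> = (\<Sum>q\<in>C. \<Sum>r\<in>R. of_int (sign (inv q)) * F (inv q \<circ> inv r))"
    by (intro sum.cong refl) (simp add: inv_comp C_permutes R_permutes sign_inv)
  also have "\<dots> = (\<Sum>q\<in>C. \<Sum>r\<in>R. of_int (sign q) * F (q \<circ> inv r))"
    by (rule sum_C_inv)
  also have "\<dots> = (\<Sum>q\<in>C. \<Sum>r\<in>R. of_int (sign q) * F (q \<circ> r))"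
    by (intro sum.cong refl sum.reindex_bij_witness[where i=inv and j=inv]) (auto simp: R_inv inv_inv R_permutes)
  finally show ?thesis .
qed

text \<open>The function \<open>w\<close> of coefficients of \<open>bab\<close> is symmetric under inversion, so the sum of its squares is the
  coefficient of the identity in \<open>babbab\<close>, which is \<open>k\<close> times the square of \<open>|C|\<close>; and \<open>w id = |C|\<close>.\<close>

lemma k_nonzero: "k \<noteq> 0"
proof -
  define w where "w x = (\<Sum>q\<in>C. of_int (sign q) * F (q \<circ> x))" for x
  have w_right: "w (x \<circ> p) = of_int (sign p) * w x" if "p \<in> C" for x p
    unfolding w_def sum_distrib_left
    by (intro sum.cong refl) (simp add: F_right[OF that] flip: comp_assoc)
  have w_inv: "w (inv x) = w x" if x: "x permutes A" for x
  proof -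
    have w: "w x = (\<Sum>p\<in>C. \<Sum>q\<in>C. if row \<circ> (p \<circ> x \<circ> q) = row then of_int (sign p * sign q) else 0)" for x
      unfolding w_def F_def sum_distrib_left by (intro sum.cong refl) (auto simp: comp_assoc)
    have R_iff: "row \<circ> (p \<circ> inv x \<circ> q) = row \<longleftrightarrow> row \<circ> (inv q \<circ> x \<circ> inv p) = row" if "p \<in> C" "q \<in> C" for p q
    proof -
      have perm: "p permutes A" "q permutes A" "inv x permutes A" using that C_permutes x permutes_inv by auto
      have "row \<circ> (p \<circ> inv x \<circ> q) = row \<longleftrightarrow> row \<circ> inv (p \<circ> inv x \<circ> q) = row"
        by (rule comp_eq_iff) (simp add: perm permutes_compose)
      also have "inv (p \<circ> inv x \<circ> q) = inv q \<circ> x \<circ> inv p"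
        using perm x by (simp add: inv_comp permutes_compose inv_inv comp_assoc)
      finally show ?thesis .
    qed
    have "w (inv x) = (\<Sum>p\<in>C. \<Sum>q\<in>C. if row \<circ> (inv q \<circ> x \<circ> inv p) = row then of_int (sign (inv p) * sign (inv q)) else 0)"
      unfolding w by (intro sum.cong refl) (simp add: R_iff sign_inv C_permutes)
    also have "\<dots> = (\<Sum>p\<in>C. \<Sum>q\<in>C. if row \<circ> (q \<circ> x \<circ> p) = row then of_int (sign p * sign q) else 0)"
    proof -
      define g where "g p q = (if row \<circ> (q \<circ> x \<circ> p) = row then real_of_int (sign p * sign q) else 0)" for p q
      have "(\<Sum>p\<in>C. \<Sum>q\<in>C. g (inv p) (inv q)) = (\<Sum>p\<in>C. \<Sum>q\<in>C. g p q)"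
        using sum_C_inv[of "\<lambda>p. \<Sum>q\<in>C. g p (inv q)"] sum_C_inv[of "g p" for p] by simp
      then show ?thesis by (simp only: g_def)
    qed
    also have "\<dots> = w x"
      unfolding w by (subst sum.swap) (intro sum.cong refl, simp add: mult.commute)
    finally show ?thesis .
  qed
  have "(\<Sum>x\<in>G. w x * w x) = (\<Sum>x\<in>G. \<Sum>q\<in>C. of_int (sign q) * F (q \<circ> x) * w (inv x))"
    by (intro sum.cong refl) (simp add: w_inv, simp add: w_def sum_distrib_right)
  also have "\<dots> = (\<Sum>q\<in>C. \<Sum>x\<in>G. F (q \<circ> x) * w (inv (q \<circ> x)))"
  proof (subst sum.swap, intro sum.cong refl)
    fix q x assume q: "q \<in> C" and x: "x \<in> G"
    have "w (inv (q \<circ> x)) = of_int (sign q) * w (inv x)"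
      using x q w_right[OF C_inv[OF q], of "inv x"] by (simp add: inv_comp C_permutes sign_inv)
    then show "of_int (sign q) * F (q \<circ> x) * w (inv x) = F (q \<circ> x) * w (inv (q \<circ> x))" by simp
  qed
  also have "\<dots> = (\<Sum>q\<in>C. \<Sum>x\<in>G. F x * w (inv x))"
    by (intro sum.cong refl sum_G_left C_permutes)
  also have "\<dots> = real (card C) * (\<Sum>x\<in>G. F x * w (inv x))" by simp
  also have "(\<Sum>x\<in>G. F x * w (inv x)) = (\<Sum>q\<in>C. \<Sum>x\<in>G. of_int (sign q) * F x * F (q \<circ> inv x))"
    unfolding w_def sum_distrib_left by (subst sum.swap) (simp add: mult_ac)
  also have "\<dots> = (\<Sum>q\<in>C. \<Sum>x\<in>G. of_int (sign q) * F (x \<circ> q) * F (q \<circ> inv (x \<circ> q)))"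
    by (intro sum.cong refl sum_G_right[symmetric] C_permutes)
  also have "\<dots> = (\<Sum>q\<in>C. \<Sum>x\<in>G. F x * F (inv x))"
    by (intro sum.cong refl) (simp add: inv_comp C_permutes F_right o_inv_cancel flip: of_int_mult mult.assoc)
  also have "\<dots> = real (card C) * k" by (simp add: k_def)
  finally have "(\<Sum>x\<in>G. w x * w x) = real (card C) * (real (card C) * k)" .
  moreover have "w id = real (card C)"
    using F_right[of _ id] by (simp add: w_def F_id flip: of_int_mult mult.assoc)
  moreover have "w id * w id \<le> (\<Sum>x\<in>G. w x * w x)"
    by (rule member_le_sum[of id G "\<lambda>x. w x * w x"]) (auto simp: permutes_id)
  moreover have "card C > 0" using id_C by (auto simp: card_gt_0_iff)
  ultimately show ?thesis by auto
qed

text \<open>All conjugates of \<open>F\<close> that make up \<open>\<chi>\<close> have the same inner product with a class function.\<close>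

lemma avg_\<chi>_times:
  assumes "\<And>s h. s permutes A \<Longrightarrow> h permutes A \<Longrightarrow> \<phi> (inv h \<circ> s \<circ> h) = \<phi> s"
  shows "avg A (\<lambda>s. \<chi> s * \<phi> s) = (\<Sum>s\<in>G. F s * \<phi> s) / k"
proof -
  have "(\<Sum>s\<in>G. \<chi> s * \<phi> s) = (\<Sum>h\<in>G. \<Sum>s\<in>G. F (inv h \<circ> s \<circ> h) * \<phi> s) / k"
    unfolding \<chi>_def by (subst sum.swap) (simp add: sum_distrib_right sum_divide_distrib)
  also have "(\<Sum>h\<in>G. \<Sum>s\<in>G. F (inv h \<circ> s \<circ> h) * \<phi> s) = (\<Sum>h\<in>G. \<Sum>s\<in>G. F s * \<phi> s)"
  proof (rule sum.cong[OF refl])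
    fix h assume h: "h \<in> G"
    have "(\<Sum>s\<in>G. F (inv h \<circ> s \<circ> h) * \<phi> s) = (\<Sum>s\<in>G. F (inv h \<circ> s \<circ> h) * \<phi> (inv h \<circ> s \<circ> h))"
      using h by (intro sum.cong refl) (simp add: assms)
    also have "\<dots> = (\<Sum>s\<in>G. F (s \<circ> h) * \<phi> (s \<circ> h))"
      using h by (intro sum_G_left[of "inv h" "\<lambda>s. F (s \<circ> h) * \<phi> (s \<circ> h)"]) (simp add: permutes_inv)
    also have "\<dots> = (\<Sum>s\<in>G. F s * \<phi> s)"
      using h by (intro sum_G_right[of h "\<lambda>s. F s * \<phi> s"]) simp
    finally show "(\<Sum>s\<in>G. F (inv h \<circ> s \<circ> h) * \<phi> s) = (\<Sum>s\<in>G. F s * \<phi> s)" .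
  qed
  also have "\<dots> = fact (card A) * (\<Sum>s\<in>G. F s * \<phi> s)"
    by (simp add: card_permutes finite_A)
  finally show ?thesis by (simp add: avg_def)
qed

lemma \<chi>_conj:
  assumes "s permutes A" "h permutes A"
  shows "\<chi> (inv h \<circ> s \<circ> h) = \<chi> s"
proof -
  have "(\<Sum>g\<in>G. F (inv g \<circ> (inv h \<circ> s \<circ> h) \<circ> g)) = (\<Sum>g\<in>G. F (inv (h \<circ> g) \<circ> s \<circ> (h \<circ> g)))"
    using assms by (intro sum.cong refl) (simp add: inv_comp comp_assoc)
  also have "\<dots> = (\<Sum>g\<in>G. F (inv g \<circ> s \<circ> g))"
    using assms by (intro sum_G_left[of h "\<lambda>g. F (inv g \<circ> s \<circ> g)"])
  finally show ?thesis by (simp add: \<chi>_def)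
qed

text \<open>Inversion exchanges the coefficients of \<open>ab\<close> and \<open>ba\<close>, and \<open>r \<circ> q\<close> is conjugate to \<open>q \<circ> r\<close>.\<close>

lemma \<chi>_inv:
  assumes s: "s permutes A"
  shows "\<chi> (inv s) = \<chi> s"
proof -
  have iff: "row \<circ> (inv h \<circ> inv s \<circ> h) \<circ> q = row \<longleftrightarrow> row \<circ> (inv (h \<circ> q) \<circ> s \<circ> (h \<circ> q)) \<circ> inv q = row"
    if "q \<in> C" "h \<in> G" for h q
  proof -
    have perm: "q permutes A" "h permutes A" using that C_permutes by auto
    let ?y = "inv h \<circ> inv s \<circ> h \<circ> q"
    have y: "?y permutes A" using perm s by (simp add: permutes_compose permutes_inv)
    have "row \<circ> ?y = row \<longleftrightarrow> row \<circ> inv ?y = row" by (rule comp_eq_iff[OF y])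
    also have "inv ?y = inv (h \<circ> q) \<circ> s \<circ> (h \<circ> q) \<circ> inv q"
      using perm s by (simp add: inv_comp inv_inv permutes_compose permutes_inv comp_assoc o_inv_cancel)
    finally show ?thesis by (simp only: comp_assoc)
  qed
  have "(\<Sum>h\<in>G. F (inv h \<circ> inv s \<circ> h)) =
      (\<Sum>q\<in>C. \<Sum>h\<in>G. if row \<circ> (inv (h \<circ> q) \<circ> s \<circ> (h \<circ> q)) \<circ> inv q = row then of_int (sign q) else 0)"
    unfolding F_def by (subst sum.swap) (intro sum.cong refl if_cong iff)
  also have "\<dots> = (\<Sum>q\<in>C. \<Sum>h\<in>G. if row \<circ> (inv h \<circ> s \<circ> h) \<circ> inv q = row then of_int (sign q) else 0)"
  proof (rule sum.cong[OF refl])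
    fix q assume "q \<in> C"
    from sum_G_right[OF C_permutes[OF this], of "\<lambda>h. if row \<circ> (inv h \<circ> s \<circ> h) \<circ> inv q = row then of_int (sign q) else 0"]
    show "(\<Sum>h\<in>G. if row \<circ> (inv (h \<circ> q) \<circ> s \<circ> (h \<circ> q)) \<circ> inv q = row then of_int (sign q) else 0) =
      (\<Sum>h\<in>G. if row \<circ> (inv h \<circ> s \<circ> h) \<circ> inv q = row then of_int (sign q) else (0 :: real))" .
  qed
  also have "\<dots> = (\<Sum>q\<in>C. \<Sum>h\<in>G. if row \<circ> (inv h \<circ> s \<circ> h) \<circ> inv q = row then of_int (sign (inv q)) else 0)"
    by (intro sum.cong refl) (simp add: sign_inv C_permutes)
  also have "\<dots> = (\<Sum>q\<in>C. \<Sum>h\<in>G. if row \<circ> (inv h \<circ> s \<circ> h) \<circ> q = row then of_int (sign q) else 0)"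
    by (rule sum_C_inv)
  also have "\<dots> = (\<Sum>h\<in>G. F (inv h \<circ> s \<circ> h))"
    unfolding F_def by (rule sum.swap)
  finally show ?thesis by (simp add: \<chi>_def)
qed

text \<open>For each \<open>h\<close> the product of \<open>ab\<close> with \<open>h ab\<close> is a multiple of \<open>ab\<close>, by \<open>equivariant_eq_F\<close>. Summing over \<open>h\<close>
  leaves the coefficient of the identity in \<open>ababab = k\<^sup>2 ab\<close>, that is \<open>k\<^sup>2\<close>.\<close>

lemma avg_\<chi>_square: "avg A (\<lambda>s. \<chi> s * \<chi> s) = 1"
proof -
  have "(\<Sum>s\<in>G. F s * \<chi> s) = (\<Sum>s\<in>G. F s * \<chi> (inv s))"
    by (intro sum.cong refl) (simp add: \<chi>_inv)
  also have "\<dots> = (\<Sum>h\<in>G. \<Sum>s\<in>G. F s * F (inv h \<circ> inv s \<circ> h)) / k"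
    unfolding \<chi>_def by (subst sum.swap) (simp add: sum_distrib_left sum_divide_distrib)
  also have "(\<Sum>h\<in>G. \<Sum>s\<in>G. F s * F (inv h \<circ> inv s \<circ> h)) = (\<Sum>h\<in>G. \<Sum>s\<in>G. F s * F (inv h \<circ> inv s) * F h)"
  proof (rule sum.cong[OF refl])
    fix h assume h: "h \<in> G"
    define f where "f x = (\<Sum>s\<in>G. F s * F (inv h \<circ> inv s \<circ> x))" for x
    have "f h = f id * F h"
    proof (rule equivariant_eq_F)
      fix r x assume r: "r \<in> R"
      have "f (r \<circ> x) = (\<Sum>s\<in>G. F (r \<circ> s) * F (inv h \<circ> inv (r \<circ> s) \<circ> (r \<circ> x)))"
        unfolding f_def by (rule sum_G_left[symmetric]) (rule R_permutes[OF r])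
      also have "\<dots> = f x"
        unfolding f_def
        by (intro sum.cong refl) (simp add: F_left r inv_comp R_permutes comp_assoc o_inv_cancel)
      finally show "f (r \<circ> x) = f x" .
    next
      fix q x assume q: "q \<in> C"
      show "f (x \<circ> q) = of_int (sign q) * f x"
        unfolding f_def sum_distrib_left
        by (intro sum.cong refl) (simp add: F_right[OF q] flip: comp_assoc)
    qed (use h in simp)
    then show "(\<Sum>s\<in>G. F s * F (inv h \<circ> inv s \<circ> h)) = (\<Sum>s\<in>G. F s * F (inv h \<circ> inv s) * F h)"
      by (simp add: f_def sum_distrib_right)
  qed
  also have "\<dots> = (\<Sum>s\<in>G. F s * (\<Sum>h\<in>G. F h * F (inv h \<circ> inv s)))"
    by (subst sum.swap) (simp add: sum_distrib_left mult_ac)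
  also have "\<dots> = (\<Sum>s\<in>G. F s * (k * F (inv s)))"
    by (intro sum.cong refl) (simp add: F_convolution permutes_inv)
  also have "\<dots> = k * k" by (simp add: k_def sum_distrib_left mult_ac)
  finally show ?thesis using avg_\<chi>_times[of \<chi>, OF \<chi>_conj] k_nonzero by simp
qed

lemma perm_char_conj:
  assumes "s permutes A" "h permutes A"
  shows "perm_char A J \<kappa> (inv h \<circ> s \<circ> h) = perm_char A J \<kappa> s"
proof -
  have iff: "f \<circ> inv h \<circ> s = f \<circ> inv h \<longleftrightarrow> f \<circ> (inv h \<circ> s \<circ> h) = f" for f
  proof -
    have "f \<circ> (inv h \<circ> s \<circ> h) = f \<longleftrightarrow> f \<circ> inv h \<circ> s \<circ> h = f" by (simp add: comp_assoc)
    also have "\<dots> \<longleftrightarrow> f \<circ> inv h \<circ> s = f \<circ> inv h" by (rule comp_eq_iff[OF assms(2)])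
    finally show ?thesis by simp
  qed
  have "bij_betw (\<lambda>f. f \<circ> inv h) {f \<in> colorings A J \<kappa>. f \<circ> (inv h \<circ> s \<circ> h) = f} {f \<in> colorings A J \<kappa>. f \<circ> s = f}"
  proof (rule bij_betwI[where g="\<lambda>f. f \<circ> h"])
    show "(\<lambda>f. f \<circ> inv h) \<in> {f \<in> colorings A J \<kappa>. f \<circ> (inv h \<circ> s \<circ> h) = f} \<rightarrow> {f \<in> colorings A J \<kappa>. f \<circ> s = f}"
      using assms iff by (auto simp: colorings_compose permutes_inv)
    show "(\<lambda>f. f \<circ> h) \<in> {f \<in> colorings A J \<kappa>. f \<circ> s = f} \<rightarrow> {f \<in> colorings A J \<kappa>. f \<circ> (inv h \<circ> s \<circ> h) = f}"
      using assms iff[of "_ \<circ> h"] by (auto simp: colorings_compose o_inv_cancel)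
  qed (use assms in \<open>auto simp: o_inv_cancel\<close>)
  then show ?thesis using bij_betw_same_card by (auto simp: perm_char_def)
qed

text \<open>The diagonal coefficient of \<open>ab\<close> at the coloring \<open>f\<close>, so that its sum over all colorings is the trace of \<open>ab\<close>
  on the permutation module.\<close>

definition signed_fixings :: "('a \<Rightarrow> 'b) \<Rightarrow> real" where
  "signed_fixings f = (\<Sum>r\<in>R. \<Sum>q\<in>C. if f \<circ> r \<circ> q = f then of_int (sign q) else 0)"

lemma avg_\<chi>_perm_char:
  assumes "finite J"
  shows "avg A (\<lambda>s. \<chi> s * perm_char A J \<kappa> s) = (\<Sum>f\<in>colorings A J \<kappa>. signed_fixings f) / k"
proof -
  have fin: "finite (colorings A J \<kappa>)" using finite_A assms by (rule finite_colorings)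
  have pc: "perm_char A J \<kappa> s = (\<Sum>f\<in>colorings A J \<kappa>. if f \<circ> s = f then 1 else 0)" for s
    using fin by (simp add: perm_char_def sum.inter_filter[symmetric])
  have "(\<Sum>s\<in>G. F s * perm_char A J \<kappa> s) = (\<Sum>q\<in>C. \<Sum>r\<in>R. \<Sum>f\<in>colorings A J \<kappa>. if f \<circ> r \<circ> q = f then of_int (sign q) else 0)"
    unfolding sum_F_times unfolding pc sum_distrib_left by (intro sum.cong refl) (simp add: comp_assoc)
  also have "\<dots> = (\<Sum>f\<in>colorings A J \<kappa>. signed_fixings f)"
    unfolding signed_fixings_def
    by (subst sum.swap, subst (2) sum.swap, subst sum.swap, rule refl)
  finally show ?thesis by (simp add: avg_\<chi>_times perm_char_conj)
qed

text \<open>Composition with \<open>p\<close> is a sign reversing bijection of the terms.\<close>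

lemma signed_fixings_eq_0:
  assumes p: "p \<in> C" "sign p = -1" "f \<circ> p = f"
  shows "signed_fixings f = 0"
proof -
  have "signed_fixings f = (\<Sum>r\<in>R. \<Sum>q\<in>C. if f \<circ> r \<circ> (q \<circ> p) = f then of_int (sign (q \<circ> p)) else 0)"
    unfolding signed_fixings_def by (intro sum.cong refl sum_C_right[symmetric] p)
  also have "\<dots> = (\<Sum>r\<in>R. \<Sum>q\<in>C. - (if f \<circ> r \<circ> q = f then of_int (sign q) else 0))"
  proof (intro sum.cong refl)
    fix r q assume q: "q \<in> C"
    have "f \<circ> inv p = f" using p(3) comp_eq_iff(2)[OF C_permutes[OF p(1)], of f f] by simp
    then have iff: "f \<circ> r \<circ> (q \<circ> p) = f \<longleftrightarrow> f \<circ> r \<circ> q = f"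
      using comp_eq_iff(1)[OF C_permutes[OF p(1)], of "f \<circ> r \<circ> q" f] by (simp only: comp_assoc)
    show "(if f \<circ> r \<circ> (q \<circ> p) = f then of_int (sign (q \<circ> p)) else 0) =
        - (if f \<circ> r \<circ> q = f then of_int (sign q) else (0 :: real))"
      unfolding iff using q p(1,2) by (simp add: sign_comp C_permutes)
  qed
  also have "\<dots> = - signed_fixings f" by (simp add: signed_fixings_def sum_negf)
  finally show ?thesis by simp
qed

lemma avg_\<chi>_perm_char_eq_0:
  assumes "finite J" "\<And>f. f \<in> colorings A J \<kappa> \<Longrightarrow> \<exists>q\<in>C. sign q = -1 \<and> f \<circ> q = f"
  shows "avg A (\<lambda>s. \<chi> s * perm_char A J \<kappa> s) = 0"
  using assms signed_fixings_eq_0 by (auto simp: avg_\<chi>_perm_char intro!: sum.neutral)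

text \<open>Only the colorings \<open>row \<circ> p\<close> with \<open>p\<close> in \<open>C\<close> contribute, and their contributions add up to the formula
  \<open>k_eq\<close> for \<open>k\<close>.\<close>

lemma avg_\<chi>_perm_char_self: "avg A (\<lambda>s. \<chi> s * perm_char A I \<pi> s) = 1"
proof -
  have "(\<Sum>f\<in>colorings A I \<pi>. signed_fixings f) = (\<Sum>f\<in>(\<lambda>p. row \<circ> p) ` C. signed_fixings f)"
  proof (rule sum.mono_neutral_right)
    show "finite (colorings A I \<pi>)" using finite_A finite_I by (rule finite_colorings)
    show "(\<lambda>p. row \<circ> p) ` C \<subseteq> colorings A I \<pi>" using colorings_compose[OF row_coloring] C_permutes by auto
    show "\<forall>f\<in>colorings A I \<pi> - (\<lambda>p. row \<circ> p) ` C. signed_fixings f = 0"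
      using coloring_cases signed_fixings_eq_0 by blast
  qed
  also have "\<dots> = (\<Sum>p\<in>C. signed_fixings (row \<circ> p))"
  proof (rule sum.reindex_cong[OF _ refl refl], rule inj_onI)
    fix p q assume p: "p \<in> C" and q: "q \<in> C" and eq: "row \<circ> p = row \<circ> q"
    then have "row \<circ> (p \<circ> inv q) = row"
      using comp_eq_iff(2)[OF C_permutes[OF q], of row "row \<circ> p"] by (metis comp_assoc)
    then have "p \<circ> inv q = id" by (intro R_Int_C C_comp C_inv p q)
    then have "id \<circ> q = p" using o_inv_cancel(2)[OF C_permutes[OF q], of p] by simp
    then show "p = q" by simp
  qed
  also have "\<dots> = (\<Sum>p\<in>C. \<Sum>r\<in>R. of_int (sign p) * F (p \<circ> r))"
  proof (rule sum.cong[OF refl])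
    fix p assume p: "p \<in> C"
    have "signed_fixings (row \<circ> p) = (\<Sum>r\<in>R. \<Sum>q\<in>C. if row \<circ> p \<circ> r \<circ> (q \<circ> p) = row \<circ> p then of_int (sign (q \<circ> p)) else 0)"
      unfolding signed_fixings_def by (intro sum.cong refl sum_C_right[symmetric] p)
    also have "\<dots> = (\<Sum>r\<in>R. \<Sum>q\<in>C. of_int (sign p) * (if row \<circ> (p \<circ> r) \<circ> q = row then of_int (sign q) else 0))"
    proof (intro sum.cong refl)
      fix r q assume q: "q \<in> C"
      have "row \<circ> p \<circ> r \<circ> (q \<circ> p) = row \<circ> p \<longleftrightarrow> row \<circ> (p \<circ> r) \<circ> q \<circ> p = row \<circ> p" by (simp add: comp_assoc)
      also have "\<dots> \<longleftrightarrow> row \<circ> (p \<circ> r) \<circ> q = row \<circ> p \<circ> inv p" by (rule comp_eq_iff[OF C_permutes[OF p]])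
      finally show "(if row \<circ> p \<circ> r \<circ> (q \<circ> p) = row \<circ> p then of_int (sign (q \<circ> p)) else 0) =
          of_int (sign p) * (if row \<circ> (p \<circ> r) \<circ> q = row then of_int (sign q) else (0 :: real))"
        using p q by (simp add: sign_comp C_permutes o_inv_cancel)
    qed
    finally show "signed_fixings (row \<circ> p) = (\<Sum>r\<in>R. of_int (sign p) * F (p \<circ> r))"
      by (simp add: F_def sum_distrib_left)
  qed
  finally show ?thesis using k_nonzero by (simp add: avg_\<chi>_perm_char finite_I k_eq)
qed

end

section \<open>Row and column groups of a filled diagram\<close>

lemma sorted_wrt_ge_nth_mono:
  fixes p :: "nat list"
  assumes "is_partition p" "i \<le> j" "j < length p"
  shows "p ! j \<le> p ! i"
  using assms sorted_wrt_nth_less[of "(\<ge>)" p i j] by (cases "i = j") (auto simp: is_partition_def)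

lemma finite_diagram: "finite (diagram p)" and card_diagram: "card (diagram p) = sum_list p"
proof -
  have D: "diagram p = (SIGMA i:{..<length p}. {..<p ! i})" by (auto simp: diagram_def)
  show "finite (diagram p)" by (simp add: D)
  show "card (diagram p) = sum_list p" by (simp add: D sum_list_sum_nth lessThan_atLeast0)
qed

locale filled_diagram =
  fixes p :: "nat list" and A :: "'a set" and row col :: "'a \<Rightarrow> nat"
  assumes partition: "is_partition p"
    and bij: "bij_betw (\<lambda>x. (row x, col x)) A (diagram p)"
begin

lemma finite_A: "finite A"
  using bij finite_diagram bij_betw_finite by blast

lemma inj: "x \<in> A \<Longrightarrow> y \<in> A \<Longrightarrow> row x = row y \<Longrightarrow> col x = col y \<Longrightarrow> x = y"
  using bij by (auto simp: bij_betw_def inj_on_def)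

lemma cell: "x \<in> A \<Longrightarrow> (row x, col x) \<in> diagram p"
  using bij by (auto simp: bij_betw_def)

lemma cell_ex:
  assumes "(i, j) \<in> diagram p"
  obtains x where "x \<in> A" "row x = i" "col x = j"
proof -
  have "(i, j) \<in> (\<lambda>x. (row x, col x)) ` A" using assms bij by (simp add: bij_betw_def)
  then show ?thesis using that by auto
qed

text \<open>Points of one column with distinct colors have at most \<open>k\<close> colors below \<open>k\<close>, and the number of cells of the
  column in the first \<open>k\<close> rows is the smaller one of \<open>k\<close> and the column length because the diagram is
  a partition.\<close>

lemma column_row_bound:
  assumes inj_f: "inj_on f {x\<in>A. col x = j}"
  shows "card {x\<in>A. col x = j \<and> f x < (k :: nat)} \<le> card {x\<in>A. col x = j \<and> row x < k}"
proof (cases "\<forall>i<k. (i, j) \<in> diagram p")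
  case True
  have "{..<k} \<subseteq> row ` {x\<in>A. col x = j \<and> row x < k}"
  proof
    fix i assume "i \<in> {..<k}"
    then obtain x where "x \<in> A" "row x = i" "col x = j" using True cell_ex[of i j] by auto
    then show "i \<in> row ` {x\<in>A. col x = j \<and> row x < k}" using \<open>i \<in> {..<k}\<close> by auto
  qed
  then have "k \<le> card {x\<in>A. col x = j \<and> row x < k}"
    using surj_card_le[of "{x\<in>A. col x = j \<and> row x < k}" "{..<k}" row] finite_A by simp
  moreover have "card {x\<in>A. col x = j \<and> f x < k} \<le> card {..<k}"
    by (rule card_inj_on_le[of f]) (use inj_f in \<open>auto simp: inj_on_def\<close>)
  ultimately show ?thesis by simp
next
  case False
  then obtain i where i: "i < k" "(i, j) \<notin> diagram p" by auto
  have "row x < k" if "x \<in> A" "col x = j" for x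
  proof (rule ccontr)
    assume "\<not> row x < k"
    then have "i \<le> row x" using i by simp
    moreover have "(row x, j) \<in> diagram p" using cell that by auto
    ultimately have "(i, j) \<in> diagram p"
      using sorted_wrt_ge_nth_mono[OF partition, of i "row x"] by (auto simp: diagram_def)
    then show False using i by simp
  qed
  then show ?thesis using finite_A by (intro card_mono) auto
qed

context
  fixes f :: "'a \<Rightarrow> nat"
  assumes inj_f: "\<And>x y. x \<in> A \<Longrightarrow> y \<in> A \<Longrightarrow> col x = col y \<Longrightarrow> f x = f y \<Longrightarrow> x = y"
begin

lemma inj_f_column: "inj_on f {x\<in>A. col x = j}"
  using inj_f by (auto simp: inj_on_def)

lemma card_by_columns: "card {x\<in>A. P x} = (\<Sum>j\<in>col ` A. card {x\<in>A. col x = j \<and> P x})"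
proof -
  have "{x\<in>{x\<in>A. P x}. col x = j} = {x\<in>A. col x = j \<and> P x}" for j by auto
  then show ?thesis using card_eq_sum_fibres[of "{x\<in>A. P x}" "col ` A" col] finite_A by simp
qed

text \<open>Summing over the columns: the shape dominates the content of any coloring that is injective on columns.\<close>

lemma card_below_le: "card {x\<in>A. f x < k} \<le> card {x\<in>A. row x < k}"
  unfolding card_by_columns[of "\<lambda>x. f x < k"] card_by_columns[of "\<lambda>x. row x < k"]
  by (intro sum_mono column_row_bound inj_f_column)

text \<open>If dominance is an equality for every \<open>k\<close>, it is an equality in each column, so each column has the same
  colors as row numbers.\<close>

lemma column_permutation:
  assumes eq: "\<And>k. card {x\<in>A. f x < k} = card {x\<in>A. row x < k}"
  obtains q where "q permutes A" "\<And>x. x \<in> A \<Longrightarrow> f x = row (q x)" "\<And>x. x \<in> A \<Longrightarrow> col x = col (q x)"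
proof -
  have below: "card {x\<in>A. col x = j \<and> f x < k} = card {x\<in>A. col x = j \<and> row x < k}" for j k
  proof (cases "j \<in> col ` A")
    case True
    show ?thesis
    proof (rule sum_mono_inv[where I="col ` A" and i=j])
      show "(\<Sum>j\<in>col ` A. card {x\<in>A. col x = j \<and> f x < k}) = (\<Sum>j\<in>col ` A. card {x\<in>A. col x = j \<and> row x < k})"
        using eq[of k] unfolding card_by_columns[of "\<lambda>x. f x < k"] card_by_columns[of "\<lambda>x. row x < k"] .
    qed (use True finite_A column_row_bound inj_f_column in auto)
  next
    case False
    then have "{x\<in>A. col x = j \<and> f x < k} = {}" "{x\<in>A. col x = j \<and> row x < k} = {}" by auto
    then show ?thesis by (simp only:)
  qed
  have split: "card {x\<in>A. col x = j \<and> g x < Suc k} = card {x\<in>A. col x = j \<and> g x < k} + card {x\<in>A. (g x, col x) = (k, j)}"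
    for g :: "'a \<Rightarrow> nat" and j k
  proof -
    have "{x\<in>A. col x = j \<and> g x < Suc k} = {x\<in>A. col x = j \<and> g x < k} \<union> {x\<in>A. (g x, col x) = (k, j)}" by auto
    then show ?thesis using finite_A by (simp only:) (rule card_Un_disjoint; auto)
  qed
  show ?thesis
  proof (rule permutes_between_equal_fibres[OF finite_A, of "\<lambda>x. (f x, col x)" "\<lambda>x. (row x, col x)"])
    show "card {x\<in>A. (f x, col x) = z} = card {x\<in>A. (row x, col x) = z}" for z
      using split[of "snd z" f "fst z"] split[of "snd z" row "fst z"] below[of "snd z" "fst z"] below[of "snd z" "Suc (fst z)"]
      by simp
  next
    fix q assume "q permutes A" and q: "\<And>x. x \<in> A \<Longrightarrow> (f x, col x) = (row (q x), col (q x))"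
    then show ?thesis using that[of q] q by blast
  qed
qed

end

lemma card_row: "i < length p \<Longrightarrow> card {x\<in>A. row x = i} = p ! i"
proof -
  assume i: "i < length p"
  have "bij_betw col {x\<in>A. row x = i} {..<p ! i}"
  proof (rule bij_betw_imageI)
    show "inj_on col {x\<in>A. row x = i}" using inj by (auto simp: inj_on_def)
    show "col ` {x\<in>A. row x = i} = {..<p ! i}"
    proof
      show "col ` {x\<in>A. row x = i} \<subseteq> {..<p ! i}" using cell by (auto simp: diagram_def)
      show "{..<p ! i} \<subseteq> col ` {x\<in>A. row x = i}"
      proof
        fix j assume "j \<in> {..<p ! i}"
        then obtain x where "x \<in> A" "row x = i" "col x = j" using i cell_ex[of i j] by (auto simp: diagram_def)
        then show "j \<in> col ` {x\<in>A. row x = i}" by auto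
      qed
    qed
  qed
  then show ?thesis using bij_betw_same_card by fastforce
qed

text \<open>Two points of one column with equal color can be transposed.\<close>

lemma transposition_or_inj:
  fixes f :: "'a \<Rightarrow> 'b"
  obtains q where "q permutes A" "col \<circ> q = col" "sign q = -1" "f \<circ> q = f"
  | "\<And>x y. x \<in> A \<Longrightarrow> y \<in> A \<Longrightarrow> col x = col y \<Longrightarrow> f x = f y \<Longrightarrow> x = y"
proof (cases "\<exists>x\<in>A. \<exists>y\<in>A. col x = col y \<and> f x = f y \<and> x \<noteq> y")
  case True
  then obtain x y where xy: "x \<in> A" "y \<in> A" "col x = col y" "f x = f y" "x \<noteq> y" by blast
  show ?thesis
  proof (rule that(1)[of "transpose x y"])
    show "transpose x y permutes A" using xy by (intro permutes_swap_id)
  qed (use xy in \<open>auto simp: sign_swap_id fun_eq_iff transpose_def\<close>)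
qed (use that(2) in blast)

end

lemma card_coloring_below:
  fixes l k :: nat
  assumes "finite A" "f \<in> colorings A {..<l} \<kappa>" "k \<le> l"
  shows "int (card {x\<in>A. f x < k}) = (\<Sum>i<k. \<kappa> i)"
proof -
  have "{x\<in>{x\<in>A. f x < k}. f x = i} = {x\<in>A. f x = i}" if "i < k" for i using that by auto
  then have "card {x\<in>A. f x < k} = (\<Sum>i<k. card {x\<in>A. f x = i})"
    using card_eq_sum_fibres[of "{x\<in>A. f x < k}" "{..<k}" f] assms(1) by simp
  then show ?thesis using assms(2,3) by (simp add: colorings_def)
qed

lemma perm_char_cong:
  assumes "\<And>i. i \<in> I \<Longrightarrow> \<pi> i = \<kappa> i"
  shows "perm_char A I \<pi> = perm_char A I \<kappa>"
  using assms by (auto simp: perm_char_def colorings_def fun_eq_iff cong: conj_cong)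

text \<open>The vector \<open>p i - i\<close> extended beyond the length of \<open>p\<close>, as \<open>shifted_partition\<close> needs its value at the length.\<close>

definition shifted :: "nat list \<Rightarrow> nat \<Rightarrow> int" where
  "shifted p i = (if i < length p then int (p ! i) else 0) - int i"

lemma shifted_partition_shifted:
  assumes "is_partition p"
  shows "shifted_partition (length p) (shifted p)"
proof -
  have "shifted p (Suc i) < shifted p i" if "i < length p" for i
    using sorted_wrt_ge_nth_mono[OF assms, of i "Suc i"] that by (auto simp: shifted_def)
  then show ?thesis by (simp add: shifted_partition_def shifted_def)
qed

text \<open>Colorings are extensional functions, hence so must be the row numbers in order to be one of them.\<close>

locale filled_diagram_ext = filled_diagram p A row col
  for p :: "nat list" and A :: "'a set" and row col +
  assumes row_ext: "row \<in> extensional A" and col_ext: "col \<in> extensional A"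
begin

lemma row_coloring: "row \<in> colorings A {..<length p} (\<lambda>i. int (p ! i))"
  using row_ext cell card_row by (auto simp: colorings_def PiE_iff diagram_def)

lemma rows_alternative:
  assumes f: "f \<in> colorings A {..<length p} (\<lambda>i. int (p ! i))"
  shows "(\<exists>q. q permutes A \<and> col \<circ> q = col \<and> f = row \<circ> q) \<or>
     (\<exists>q. q permutes A \<and> col \<circ> q = col \<and> sign q = -1 \<and> f \<circ> q = f)"
proof (cases rule: transposition_or_inj[of f])
  case 2
  have "card {x\<in>A. f x < k} = card {x\<in>A. row x < k}" for k
  proof (cases "k \<le> length p")
    case True
    then have "int (card {x\<in>A. f x < k}) = int (card {x\<in>A. row x < k})"
      using card_coloring_below[OF finite_A f True] card_coloring_below[OF finite_A row_coloring True] by simp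
    then show ?thesis by simp
  next
    case False
    then have "{x\<in>A. f x < k} = A" "{x\<in>A. row x < k} = A"
      using f row_coloring by (auto simp: colorings_def PiE_iff)
    then show ?thesis by simp
  qed
  from column_permutation[of f, OF 2 this]
  obtain q where q: "q permutes A" "\<And>x. x \<in> A \<Longrightarrow> f x = row (q x)" "\<And>x. x \<in> A \<Longrightarrow> col x = col (q x)"
    by blast
  have "f x = row (q x)" for x
    using q f row_ext by (cases "x \<in> A") (auto simp: colorings_def PiE_iff extensional_def permutes_not_in)
  moreover have "col x = col (q x)" for x
    using q by (cases "x \<in> A") (auto simp: permutes_not_in)
  ultimately show ?thesis using q(1) by (auto simp: fun_eq_iff)
qed blast

sublocale row_column A "{..<length p}" "\<lambda>i. int (p ! i)" row col
  by unfold_locales (use finite_A inj row_coloring rows_alternative in auto)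

lemma card_A: "card A = sum_list p"
  using bij_betw_same_card[OF bij] by (simp add: card_diagram)

text \<open>If \<open>\<sigma>\<close> is not the identity, the content is not dominated by the shape, so every coloring has two points of
  equal color in some column.\<close>

lemma avg_\<chi>_jacobi_trudi_term:
  assumes \<sigma>: "\<sigma> permutes {..<length p}"
  shows "avg A (\<lambda>s. \<chi> s * perm_char A {..<length p} (\<lambda>i. shifted p i + int (\<sigma> i)) s) = (if \<sigma> = id then 1 else 0)"
proof (cases "\<sigma> = id")
  case True
  have "perm_char A {..<length p} (\<lambda>i. shifted p i + int (id i)) = perm_char A {..<length p} (\<lambda>i. int (p ! i))"
    by (rule perm_char_cong) (simp add: shifted_def)
  then show ?thesis using True avg_\<chi>_perm_char_self by simp
next
  case False
  have "\<exists>q\<in>C. sign q = -1 \<and> f \<circ> q = f" if f: "f \<in> colorings A {..<length p} (\<lambda>i. shifted p i + int (\<sigma> i))" for f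
  proof (cases rule: transposition_or_inj[of f])
    case (1 q)
    then show ?thesis by (auto simp: C_def)
  next
    case 2
    have "\<sigma> = id"
    proof (rule permutation_eq_id_if_partial_sums_le[OF \<sigma>])
      fix k assume k: "k \<le> length p"
      have "(\<Sum>i<k. shifted p i + int (\<sigma> i)) \<le> (\<Sum>i<k. int (p ! i))"
        using card_below_le[of f k, OF 2] card_coloring_below[OF finite_A f k] card_coloring_below[OF finite_A row_coloring k]
        by linarith
      also have "\<dots> = (\<Sum>i<k. shifted p i + int i)"
        using k by (intro sum.cong) (auto simp: shifted_def)
      finally show "(\<Sum>i<k. \<sigma> i) \<le> (\<Sum>i<k. i)" by (simp add: sum.distrib flip: of_nat_sum)
    qed
    then show ?thesis using False by simp
  qed
  then have "avg A (\<lambda>s. \<chi> s * perm_char A {..<length p} (\<lambda>i. shifted p i + int (\<sigma> i)) s) = 0"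
    by (intro avg_\<chi>_perm_char_eq_0) auto
  then show ?thesis using False by simp
qed

text \<open>Both characters have norm 1 and inner product 1, so their difference has norm 0.\<close>

lemma \<chi>_eq_jacobi_trudi:
  assumes s: "s permutes A"
  shows "\<chi> s = jacobi_trudi A (length p) (shifted p) s"
proof -
  let ?\<psi> = "jacobi_trudi A (length p) (shifted p)"
  have "avg A (\<lambda>s. \<chi> s * ?\<psi> s) =
    avg A (\<lambda>s. \<Sum>\<rho> | \<rho> permutes {..<length p}. of_int (sign \<rho>) * (\<chi> s * perm_char A {..<length p} (\<lambda>i. shifted p i + int (\<rho> i)) s))"
    unfolding jacobi_trudi_def sum_distrib_left by (simp only: mult.left_commute)
  also have "\<dots> = (\<Sum>\<rho> | \<rho> permutes {..<length p}. if \<rho> = id then 1 else 0)"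
    unfolding avg_sum avg_cmult by (intro sum.cong refl) (simp add: avg_\<chi>_jacobi_trudi_term)
  also have "\<dots> = 1" by (simp add: finite_permutations)
  finally have cross: "avg A (\<lambda>s. \<chi> s * ?\<psi> s) = 1" .
  have total: "(\<Sum>i<length p. shifted p i + int i) = int (card A)"
    by (simp add: card_A sum_list_sum_nth lessThan_atLeast0 shifted_def)
  have \<psi>\<psi>: "avg A (\<lambda>s. ?\<psi> s * ?\<psi> s) = 1"
    by (rule avg_jacobi_trudi_square[OF finite_A shifted_partition_shifted[OF partition] total])
  have "avg A (\<lambda>s. (\<chi> s - ?\<psi> s)\<^sup>2) = avg A (\<lambda>s. \<chi> s * \<chi> s) - 2 * avg A (\<lambda>s. \<chi> s * ?\<psi> s) + avg A (\<lambda>s. ?\<psi> s * ?\<psi> s)"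
    by (simp add: avg_def power2_eq_square algebra_simps sum.distrib sum_subtractf add_divide_distrib diff_divide_distrib sum_distrib_left)
  then have "avg A (\<lambda>s. (\<chi> s - ?\<psi> s)\<^sup>2) = 0" using cross \<psi>\<psi> avg_\<chi>_square by simp
  then have "(\<Sum>s\<in>G. (\<chi> s - ?\<psi> s)\<^sup>2) = 0" by (simp add: avg_def)
  then show ?thesis using s by (simp add: sum_nonneg_eq_0_iff)
qed

end

section \<open>The trace on a Specht module\<close>

lemma sum_apply: "(\<Sum>i\<in>I. f i) x = (\<Sum>i\<in>I. f i x)"
  for f :: "'i \<Rightarrow> 'a \<Rightarrow> complex"
  by (induction I rule: infinite_finite_induct) simp_all

text \<open>The functions \<open>K x\<close> are the images of the unit vectors under a projection onto \<open>V\<close>; the trace on \<open>V\<close> is the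
  trace of \<open>F\<close> after this projection, which can be read off from the diagonal entries.\<close>

lemma trace_on_by_projection:
  fixes K :: "'a \<Rightarrow> 'a \<Rightarrow> complex"
  assumes X: "finite X" and V: "cfun.subspace V" and K: "\<And>x. x \<in> X \<Longrightarrow> K x \<in> V"
    and proj: "\<And>v. v \<in> V \<Longrightarrow> v = (\<Sum>x\<in>X. fscale (v x) (K x))"
    and F_add: "\<And>f g. F (f + g) = F f + F g" and F_scale: "\<And>c f. F (fscale c f) = fscale c (F f)"
    and F_V: "\<And>v. v \<in> V \<Longrightarrow> F v \<in> V"
  shows "trace_on V F = (\<Sum>x\<in>X. F (K x) x)"
proof -
  define B where "B = (SOME B. cfun.independent B \<and> cfun.span B = V)"
  have "\<exists>B. cfun.independent B \<and> cfun.span B = V"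
    by (metis V cfun.maximal_independent_subset cfun.span_minimal subset_antisym)
  then have B: "cfun.independent B" "cfun.span B = V"
    unfolding B_def by (metis (mono_tags, lifting) someI_ex)+
  have "V \<subseteq> cfun.span (K ` X)"
  proof
    fix v assume "v \<in> V"
    then have "v = (\<Sum>x\<in>X. fscale (v x) (K x))" by (rule proj)
    also have "\<dots> \<in> cfun.span (K ` X)"
      by (intro cfun.span_sum cfun.span_scale cfun.span_base imageI)
    finally show "v \<in> cfun.span (K ` X)" .
  qed
  then have finB: "finite B"
    using cfun.independent_span_bound[of "K ` X" B] X B cfun.span_superset[of B] by auto
  define rep where "rep = cfun.representation B"
  have F0: "F 0 = 0" using F_scale[of 0 0] by (simp only: cfun.scale_zero_left)
  have F_sum: "F (\<Sum>x\<in>X. g x) = (\<Sum>x\<in>X. F (g x))" for g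
    by (induction X rule: infinite_finite_induct)
      (simp_all only: sum.infinite sum.empty sum.insert F0 F_add not_False_eq_True)
  have expand: "v x = (\<Sum>b\<in>B. rep v b * b x)" if "v \<in> V" for v x
  proof -
    have "v x = (\<Sum>b\<in>B. fscale (rep v b) b) x"
      using cfun.sum_representation_eq[OF B(1) _ finB, of v] that B(2) by (simp add: rep_def)
    then show ?thesis by (simp add: sum_apply fscale_def)
  qed
  have coeff: "rep (F b) b' = (\<Sum>x\<in>X. b x * rep (F (K x)) b')" if b: "b \<in> V" for b b'
  proof -
    have FK: "F (K x) \<in> cfun.span B" if "x \<in> X" for x using that K F_V B by simp
    have "F b = F (\<Sum>x\<in>X. fscale (b x) (K x))" using proj[OF b] by simp
    then have "F b = (\<Sum>x\<in>X. fscale (b x) (F (K x)))" by (simp add: F_sum F_scale)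
    then have "rep (F b) b' = (\<Sum>x\<in>X. rep (fscale (b x) (F (K x))) b')"
      unfolding rep_def
      by (simp only:) (subst cfun.representation_sum[OF B(1)], rule cfun.span_scale, rule FK, assumption, rule refl)
    also have "\<dots> = (\<Sum>x\<in>X. b x * rep (F (K x)) b')"
      unfolding rep_def using cfun.representation_scale[OF B(1) FK] by (intro sum.cong refl) metis
    finally show ?thesis .
  qed
  have "trace_on V F = (\<Sum>b\<in>B. rep (F b) b)"
    by (simp add: trace_on_def Let_def B_def rep_def)
  also have "\<dots> = (\<Sum>b\<in>B. \<Sum>x\<in>X. rep (F (K x)) b * b x)"
    using B cfun.span_superset[of B] by (intro sum.cong refl) (auto simp: coeff mult.commute)
  also have "\<dots> = (\<Sum>x\<in>X. F (K x) x)"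
    using expand K F_V by (subst sum.swap) simp
  finally show ?thesis .
qed

text \<open>All tableaux of shape \<open>p\<close> are \<open>h \<circ> T\<close> for permutations \<open>h\<close>, so one tableau \<open>T\<close> provides
  coordinates for the whole Specht module.\<close>

locale tableau =
  fixes p :: "nat list" and T :: "nat \<times> nat \<Rightarrow> nat"
  assumes is_part: "is_partition p" and T: "T \<in> tableaux p"
begin

definition A :: "nat set" where "A = {1..sum_list p}"

definition row :: "nat \<Rightarrow> nat" where "row = (\<lambda>x\<in>A. fst (inv_into (diagram p) T x))"

definition col :: "nat \<Rightarrow> nat" where "col = (\<lambda>x\<in>A. snd (inv_into (diagram p) T x))"

lemma T_bij: "bij_betw T (diagram p) A"
  using T by (simp add: tableaux_def A_def)

lemma row_col_T: 
  assumes "(i, j) \<in> diagram p"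
  shows "row (T (i, j)) = i" "col (T (i, j)) = j"
  using assms T_bij bij_betw_inv_into_left[OF T_bij assms] by (auto simp: row_def col_def bij_betw_def)

lemma T_row_col: 
  assumes "x \<in> A"
  shows "(row x, col x) \<in> diagram p" "T (row x, col x) = x"
proof -
  have "x \<in> T ` diagram p" using assms T_bij by (simp add: bij_betw_def)
  then show "(row x, col x) \<in> diagram p" "T (row x, col x) = x"
    using assms inv_into_into[of x T "diagram p"] f_inv_into_f[of x T "diagram p"] by (auto simp: row_def col_def)
qed

sublocale filled_diagram_ext p A row col
proof
  show "is_partition p" by (rule is_part)
  show "bij_betw (\<lambda>x. (row x, col x)) A (diagram p)"
    by (rule bij_betwI[where g=T]) (use T_row_col row_col_T bij_betwE[OF T_bij] in auto)
qed (simp_all add: row_def col_def)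

lemma row_set: "{T (i, j) | j. (i, j) \<in> diagram p} = {x\<in>A. row x = i}"
proof
  show "{T (i, j) | j. (i, j) \<in> diagram p} \<subseteq> {x\<in>A. row x = i}"
    using row_col_T bij_betwE[OF T_bij] by blast
  show "{x\<in>A. row x = i} \<subseteq> {T (i, j) | j. (i, j) \<in> diagram p}"
  proof
    fix x assume "x \<in> {x\<in>A. row x = i}"
    then have "x = T (i, col x)" "(i, col x) \<in> diagram p" using T_row_col[of x] by auto
    then show "x \<in> {T (i, j) | j. (i, j) \<in> diagram p}" by blast
  qed
qed

lemma col_set: "{T (i, j) | i. (i, j) \<in> diagram p} = {x\<in>A. col x = j}"
proof
  show "{T (i, j) | i. (i, j) \<in> diagram p} \<subseteq> {x\<in>A. col x = j}"
    using row_col_T bij_betwE[OF T_bij] by blast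
  show "{x\<in>A. col x = j} \<subseteq> {T (i, j) | i. (i, j) \<in> diagram p}"
  proof
    fix x assume "x \<in> {x\<in>A. col x = j}"
    then have "x = T (row x, j)" "(row x, j) \<in> diagram p" using T_row_col[of x] by auto
    then show "x \<in> {T (i, j) | i. (i, j) \<in> diagram p}" by blast
  qed
qed

lemma tabloid_eq: "tabloid p (g \<circ> T) = (\<lambda>i. g ` {x\<in>A. row x = i})"
proof
  fix i
  have "tabloid p (g \<circ> T) i = g ` {T (i, j) | j. (i, j) \<in> diagram p}" by (auto simp: tabloid_def)
  then show "tabloid p (g \<circ> T) i = g ` {x\<in>A. row x = i}" by (simp only: row_set)
qed

lemma preserves_fibres_iff:
  assumes s: "s permutes A" and ext: "c \<in> extensional A"
  shows "(\<forall>j. s ` {x\<in>A. c x = j} = {x\<in>A. c x = j}) \<longleftrightarrow> c \<circ> s = c"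
proof
  assume img: "\<forall>j. s ` {x\<in>A. c x = j} = {x\<in>A. c x = j}"
  have "c (s x) = c x" for x
  proof (cases "x \<in> A")
    case True
    then have "s x \<in> s ` {y\<in>A. c y = c x}" by blast
    then show ?thesis using img by blast
  qed (use s in \<open>simp add: permutes_not_in\<close>)
  then show "c \<circ> s = c" by auto
next
  assume c: "c \<circ> s = c"
  have "s ` {x\<in>A. c x = j} = {x\<in>A. c x = j}" for j
  proof (rule endo_inj_surj)
    show "s ` {x\<in>A. c x = j} \<subseteq> {x\<in>A. c x = j}"
      using c s permutes_in_image[OF s] by (auto simp: fun_eq_iff)
  qed (use permutes_inj[OF s] finite_A in \<open>auto intro: inj_on_subset\<close>)
  then show "\<forall>j. s ` {x\<in>A. c x = j} = {x\<in>A. c x = j}" by blast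
qed

lemma tabloid_eq_iff:
  assumes g: "g permutes A" and h: "h permutes A"
  shows "tabloid p (g \<circ> T) = tabloid p (h \<circ> T) \<longleftrightarrow> row \<circ> (inv g \<circ> h) = row"
proof -
  have "tabloid p (g \<circ> T) = tabloid p (h \<circ> T) \<longleftrightarrow> (\<forall>i. h ` {x\<in>A. row x = i} = g ` {x\<in>A. row x = i})"
    by (auto simp: tabloid_eq fun_eq_iff)
  also have "\<dots> \<longleftrightarrow> (\<forall>i. (inv g \<circ> h) ` {x\<in>A. row x = i} = {x\<in>A. row x = i})"
  proof -
    have "h ` S = g ` S \<longleftrightarrow> (inv g \<circ> h) ` S = S" for S
    proof -
      have "(inv g \<circ> h) ` S = S \<longleftrightarrow> g ` ((inv g \<circ> h) ` S) = g ` S"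
        using permutes_inj[OF g] by (simp add: inj_image_eq_iff)
      also have "g ` ((inv g \<circ> h) ` S) = h ` S"
        by (simp add: image_image permutes_inverses[OF g])
      finally show ?thesis by simp
    qed
    then show ?thesis by simp
  qed
  also have "\<dots> \<longleftrightarrow> row \<circ> (inv g \<circ> h) = row"
    by (rule preserves_fibres_iff) (use g h row_ext in \<open>simp_all add: permutes_compose permutes_inv\<close>)
  finally show ?thesis .
qed

text \<open>The column stabilizer of \<open>h \<circ> T\<close> is conjugate to that of \<open>T\<close>, which allows polytabloids to be written as
  sums over the fixed group \<open>C\<close>.\<close>

lemma column_stabilizer_eq:
  assumes h: "h permutes A"
  shows "column_stabilizer p (h \<circ> T) = (\<lambda>q. h \<circ> q \<circ> inv h) ` C"
proof -
  have iff: "s \<in> column_stabilizer p (h \<circ> T) \<longleftrightarrow> inv h \<circ> s \<circ> h \<in> C" if s: "s permutes A" for s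
  proof -
    have col_h: "{(h \<circ> T) (i, j) | i. (i, j) \<in> diagram p} = h ` {x\<in>A. col x = j}" for j
      unfolding col_set[symmetric] by auto
    have perm: "inv h \<circ> s \<circ> h permutes A" using s h by (simp add: permutes_compose permutes_inv)
    have "s ` (h ` S) = h ` S \<longleftrightarrow> (inv h \<circ> s \<circ> h) ` S = S" for S
    proof -
      have "(inv h \<circ> s \<circ> h) ` S = S \<longleftrightarrow> h ` ((inv h \<circ> s \<circ> h) ` S) = h ` S"
        using permutes_inj[OF h] by (simp add: inj_image_eq_iff)
      also have "h ` ((inv h \<circ> s \<circ> h) ` S) = s ` (h ` S)"
        by (simp add: image_image permutes_inverses[OF h])
      finally show ?thesis by simp
    qed
    then have "s \<in> column_stabilizer p (h \<circ> T) \<longleftrightarrow> (\<forall>j. (inv h \<circ> s \<circ> h) ` {x\<in>A. col x = j} = {x\<in>A. col x = j})"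
      unfolding column_stabilizer_def col_h A_def[symmetric] using s by simp
    also have "\<dots> \<longleftrightarrow> inv h \<circ> s \<circ> h \<in> C"
      using preserves_fibres_iff[OF perm col_ext] perm by (simp add: C_def)
    finally show ?thesis .
  qed
  show ?thesis
  proof
    show "column_stabilizer p (h \<circ> T) \<subseteq> (\<lambda>q. h \<circ> q \<circ> inv h) ` C"
    proof
      fix s assume s: "s \<in> column_stabilizer p (h \<circ> T)"
      then have "s permutes A" by (simp add: column_stabilizer_def A_def)
      moreover have "s = h \<circ> (inv h \<circ> s \<circ> h) \<circ> inv h" using h by (simp add: comp_assoc o_inv_cancel)
      ultimately show "s \<in> (\<lambda>q. h \<circ> q \<circ> inv h) ` C" using iff s by blast
    qed
    show "(\<lambda>q. h \<circ> q \<circ> inv h) ` C \<subseteq> column_stabilizer p (h \<circ> T)"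
    proof
      fix s assume "s \<in> (\<lambda>q. h \<circ> q \<circ> inv h) ` C"
      then obtain q where q: "q \<in> C" "s = h \<circ> q \<circ> inv h" by blast
      then have "s permutes A" "inv h \<circ> s \<circ> h = q"
        using h C_permutes by (auto simp: permutes_compose permutes_inv comp_assoc o_inv_cancel)
      then show "s \<in> column_stabilizer p (h \<circ> T)" using iff q by simp
    qed
  qed
qed

lemma polytabloid_eq:
  assumes h: "h permutes A"
  shows "polytabloid p (h \<circ> T) X = (\<Sum>q\<in>C. if X = tabloid p (h \<circ> q \<circ> T) then of_int (sign q) else 0)"
proof -
  have inj: "inj_on (\<lambda>q. h \<circ> q \<circ> inv h) C"
  proof (rule inj_onI)
    fix q q' assume "h \<circ> q \<circ> inv h = h \<circ> q' \<circ> inv h"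
    then have "inv h \<circ> (h \<circ> q \<circ> inv h) \<circ> h = inv h \<circ> (h \<circ> q' \<circ> inv h) \<circ> h" by (simp only:)
    then show "q = q'" using h by (simp add: comp_assoc o_inv_cancel)
  qed
  have "h \<circ> q \<circ> inv h \<circ> (h \<circ> T) = h \<circ> q \<circ> T" for q
    using h by (simp add: comp_assoc) (simp add: o_inv_cancel(3)[OF h, of T])
  moreover have "sign (h \<circ> q \<circ> inv h) = sign q" if "q \<in> C" for q
    using h C_permutes[OF that] by (simp add: sign_comp sign_inv permutes_compose permutes_inv)
  ultimately show ?thesis
    unfolding polytabloid_def column_stabilizer_eq[OF h] sum.reindex[OF inj]
    by (intro sum.cong refl) simp
qed

text \<open>The coefficients of polytabloids are those of the Young symmetrizer. Everything about the Specht module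
  is derived from this formula.\<close>

lemma polytabloid_tabloid:
  assumes "h permutes A" "g permutes A"
  shows "polytabloid p (h \<circ> T) (tabloid p (g \<circ> T)) = of_real (F (inv g \<circ> h))"
proof -
  have "tabloid p (g \<circ> T) = tabloid p (h \<circ> q \<circ> T) \<longleftrightarrow> row \<circ> (inv g \<circ> h) \<circ> q = row" if "q \<in> C" for q
    using tabloid_eq_iff[of g "h \<circ> q"] assms C_permutes[OF that] by (simp add: permutes_compose comp_assoc)
  then show ?thesis
    using assms unfolding polytabloid_eq[OF assms(1)] F_def by (auto simp: intro!: sum.cong)
qed

lemma polytabloid_outside:
  assumes "h permutes A" "X \<notin> (\<lambda>g. tabloid p (g \<circ> T)) ` G"
  shows "polytabloid p (h \<circ> T) X = 0"
proof -
  have "X \<noteq> tabloid p (h \<circ> q \<circ> T)" if "q \<in> C" for q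
    using assms that by (auto simp: permutes_compose C_permutes)
  then show ?thesis unfolding polytabloid_eq[OF assms(1)] by (intro sum.neutral) simp
qed

lemma polytabloid_eqI:
  assumes "\<And>g. g permutes A \<Longrightarrow> v (tabloid p (g \<circ> T)) = of_real (F (inv g \<circ> h))"
    and "\<And>X. X \<notin> (\<lambda>g. tabloid p (g \<circ> T)) ` G \<Longrightarrow> v X = 0" and h: "h permutes A"
  shows "v = polytabloid p (h \<circ> T)"
proof
  fix X
  show "v X = polytabloid p (h \<circ> T) X"
    using assms(1,2) polytabloid_tabloid[OF h] polytabloid_outside[OF h, of X]
    by (cases "X \<in> (\<lambda>g. tabloid p (g \<circ> T)) ` G") auto
qed

text \<open>A tableau is specified on the diagram only, whereas \<open>h \<circ> T\<close> also has values elsewhere; polytabloids do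
  not depend on these.\<close>

lemma polytabloid_image: "polytabloid p ` tableaux p = (\<lambda>h. polytabloid p (h \<circ> T)) ` G"
proof
  show "(\<lambda>h. polytabloid p (h \<circ> T)) ` G \<subseteq> polytabloid p ` tableaux p"
    using bij_betw_trans[OF T_bij permutes_imp_bij]
    unfolding tableaux_def A_def[symmetric] by blast
  show "polytabloid p ` tableaux p \<subseteq> (\<lambda>h. polytabloid p (h \<circ> T)) ` G"
  proof
    fix v assume "v \<in> polytabloid p ` tableaux p"
    then obtain T' where T': "bij_betw T' (diagram p) A" "v = polytabloid p T'"
      unfolding tableaux_def A_def[symmetric] by blast
    define h where "h x = (if x \<in> A then T' (inv_into (diagram p) T x) else x)" for x
    have "bij_betw (T' \<circ> inv_into (diagram p) T) A A"
      using bij_betw_trans[OF bij_betw_inv_into[OF T_bij] T'(1)] .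
    then have "bij_betw h A A"
      by (rule bij_betw_cong[THEN iffD1, rotated]) (simp add: h_def)
    then have h: "h permutes A" by (rule bij_imp_permutes) (simp add: h_def)
    have agree: "T' c = (h \<circ> T) c" if "c \<in> diagram p" for c
      using that bij_betw_inv_into_left[OF T_bij that] bij_betwE[OF T_bij] by (simp add: h_def)
    have tab: "tabloid p (s \<circ> T') = tabloid p (s \<circ> (h \<circ> T))" for s
      unfolding tabloid_def using agree by (intro ext Collect_cong) (metis comp_apply)
    have colset: "{T' (i, j) | i. (i, j) \<in> diagram p} = {(h \<circ> T) (i, j) | i. (i, j) \<in> diagram p}" for j
      using agree by metis
    have "column_stabilizer p T' = column_stabilizer p (h \<circ> T)"
      unfolding column_stabilizer_def colset ..
    then have "v = polytabloid p (h \<circ> T)"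
      unfolding T'(2) polytabloid_def tab by simp
    then show "v \<in> (\<lambda>h. polytabloid p (h \<circ> T)) ` G" using h by blast
  qed
qed

lemma perm_action_polytabloid:
  assumes s: "s permutes A" and h: "h permutes A"
  shows "perm_action s (polytabloid p (h \<circ> T)) = polytabloid p ((s \<circ> h) \<circ> T)"
proof (rule polytabloid_eqI)
  fix g assume g: "g permutes A"
  have "(\<lambda>i. inv s ` tabloid p (g \<circ> T) i) = tabloid p ((inv s \<circ> g) \<circ> T)"
    unfolding tabloid_eq by (simp only: image_comp)
  then show "perm_action s (polytabloid p (h \<circ> T)) (tabloid p (g \<circ> T)) = of_real (F (inv g \<circ> (s \<circ> h)))"
    using s g h polytabloid_tabloid[OF h, of "inv s \<circ> g"]
    by (simp add: perm_action_def permutes_compose permutes_inv inv_comp inv_inv comp_assoc)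
next
  fix X assume X: "X \<notin> (\<lambda>g. tabloid p (g \<circ> T)) ` G"
  have "(\<lambda>i. inv s ` X i) \<notin> (\<lambda>g. tabloid p (g \<circ> T)) ` G"
  proof
    assume "(\<lambda>i. inv s ` X i) \<in> (\<lambda>g. tabloid p (g \<circ> T)) ` G"
    then obtain g where g: "g permutes A" "\<And>i. inv s ` X i = g ` {x\<in>A. row x = i}"
      by (auto simp: tabloid_eq fun_eq_iff)
    have "X i = (s \<circ> g) ` {x\<in>A. row x = i}" for i
    proof -
      have "X i = s ` (inv s ` X i)" by (simp add: image_image permutes_inverses[OF s])
      then show ?thesis by (simp only: g(2) image_comp)
    qed
    then have "X = tabloid p ((s \<circ> g) \<circ> T)" unfolding tabloid_eq by blast
    then show False using X s g(1) by (auto simp: permutes_compose)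
  qed
  then show "perm_action s (polytabloid p (h \<circ> T)) X = 0"
    using polytabloid_outside[OF h] by (simp add: perm_action_def)
qed (use s h in \<open>simp add: permutes_compose\<close>)

text \<open>Sending the tabloid \<open>X\<close> to \<open>1 / k\<close> times the sum of the polytabloids of all tableaux in \<open>X\<close> is a projection
  onto the Specht module: on the coefficients of polytabloids this is the convolution identity
  \<open>F_convolution\<close>. The diagonal entries of the action after this projection add up to \<open>\<chi>\<close>.\<close>

lemma irr_char_eq_\<chi>:
  assumes s: "s permutes A"
  shows "irr_char p s = of_real (\<chi> s)"
proof -
  define V where "V = specht_module p"
  define tab where "tab g = tabloid p (g \<circ> T)" for g :: "nat \<Rightarrow> nat"
  define e where "e h = polytabloid p (h \<circ> T)" for h :: "nat \<Rightarrow> nat"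
  define K where "K X = fscale (1 / of_real k) (\<Sum>g | g \<in> G \<and> tab g = X. e g)" for X
  have V: "V = cfun.span (e ` G)"
    by (simp add: V_def specht_module_def polytabloid_image e_def)
  have tot: "(\<Sum>X\<in>tab ` G. fscale (v X) (K X)) = fscale (1 / of_real k) (\<Sum>g\<in>G. fscale (v (tab g)) (e g))" for v
  proof -
    have "(\<Sum>X\<in>tab ` G. fscale (v X) (K X)) =
        fscale (1 / of_real k) (\<Sum>X\<in>tab ` G. \<Sum>g | g \<in> G \<and> tab g = X. fscale (v (tab g)) (e g))"
    proof -
      have "fscale (v X) (K X) = fscale (1 / of_real k) (\<Sum>g | g \<in> G \<and> tab g = X. fscale (v (tab g)) (e g))" for X
      proof -
        have "(\<Sum>g | g \<in> G \<and> tab g = X. fscale (v (tab g)) (e g)) = fscale (v X) (\<Sum>g | g \<in> G \<and> tab g = X. e g)"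
          unfolding cfun.scale_sum_right by (intro sum.cong refl) simp
        then show ?thesis by (simp add: K_def fscale_def fun_eq_iff)
      qed
      then show ?thesis by (simp only: cfun.scale_sum_right)
    qed
    also have "(\<Sum>X\<in>tab ` G. \<Sum>g | g \<in> G \<and> tab g = X. fscale (v (tab g)) (e g)) = (\<Sum>g\<in>G. fscale (v (tab g)) (e g))"
      by (rule sum.group) auto
    finally show ?thesis .
  qed
  have e_tab: "e h (tab g) = of_real (F (inv g \<circ> h))" if "h \<in> G" "g \<in> G" for g h
    using that polytabloid_tabloid by (simp add: e_def tab_def)
  have proj_e: "e h = (\<Sum>X\<in>tab ` G. fscale (e h X) (K X))" if h: "h \<in> G" for h
    unfolding tot
  proof (subst (1) e_def, rule polytabloid_eqI[symmetric])
    fix x assume x: "x permutes A"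
    have "(\<Sum>g\<in>G. F (inv g \<circ> h) * F (inv x \<circ> g)) = (\<Sum>y\<in>G. F y * F (inv y \<circ> (inv x \<circ> h)))"
    proof -
      have "(\<Sum>y\<in>G. F y * F (inv y \<circ> (inv x \<circ> h))) = (\<Sum>g\<in>G. F (inv x \<circ> g) * F (inv (inv x \<circ> g) \<circ> (inv x \<circ> h)))"
        using x by (intro sum_G_left[symmetric, of "inv x" "\<lambda>y. F y * F (inv y \<circ> (inv x \<circ> h))"]) (simp add: permutes_inv)
      also have "\<dots> = (\<Sum>g\<in>G. F (inv g \<circ> h) * F (inv x \<circ> g))"
        using x by (intro sum.cong refl) (simp add: inv_comp permutes_inv inv_inv comp_assoc o_inv_cancel)
      finally show ?thesis by simp
    qed
    also have "\<dots> = k * F (inv x \<circ> h)"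
      using x h by (intro F_convolution) (simp add: permutes_compose permutes_inv)
    finally have conv: "(\<Sum>g\<in>G. F (inv g \<circ> h) * F (inv x \<circ> g)) = k * F (inv x \<circ> h)" .
    have "fscale (1 / of_real k) (\<Sum>g\<in>G. fscale (e h (tab g)) (e g)) (tab x) =
        of_real ((\<Sum>g\<in>G. F (inv g \<circ> h) * F (inv x \<circ> g)) / k)"
      using h x by (simp add: fscale_def sum_apply e_tab)
    then show "fscale (1 / of_real k) (\<Sum>g\<in>G. fscale (e h (tab g)) (e g)) (tabloid p (x \<circ> T)) = of_real (F (inv x \<circ> h))"
      using k_nonzero by (simp add: conv tab_def)
  next
    fix X assume "X \<notin> (\<lambda>g. tabloid p (g \<circ> T)) ` G"
    then have "e g X = 0" if "g \<in> G" for g using polytabloid_outside that by (simp add: e_def)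
    then show "fscale (1 / of_real k) (\<Sum>g\<in>G. fscale (e h (tab g)) (e g)) X = 0"
      by (simp add: fscale_def sum_apply)
  qed (use h in simp)
  have add: "perm_action s (f + g) = perm_action s f + perm_action s g" for f g
    by (simp add: perm_action_def fun_eq_iff)
  have scale: "perm_action s (fscale c f) = fscale c (perm_action s f)" for c f
    by (simp add: perm_action_def fscale_def)
  have act: "perm_action s (e h) = e (s \<circ> h)" if "h \<in> G" for h
    using that perm_action_polytabloid[OF s] by (simp add: e_def)
  have "irr_char p s = trace_on V (perm_action s)" by (simp add: irr_char_def V_def)
  also have "\<dots> = (\<Sum>X\<in>tab ` G. perm_action s (K X) X)"
  proof (rule trace_on_by_projection[OF _ _ _ _ add scale])
    show "cfun.subspace V" by (simp add: V)
    show "K X \<in> V" for X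
      unfolding K_def V by (intro cfun.span_scale cfun.span_sum cfun.span_base) auto
    show "v = (\<Sum>X\<in>tab ` G. fscale (v X) (K X))" if "v \<in> V" for v
      using that unfolding V
    proof (induction rule: cfun.span_induct_alt)
      case base
      show ?case by (simp add: fscale_def fun_eq_iff sum_apply)
    next
      case (step c u v)
      have u: "u = (\<Sum>X\<in>tab ` G. fscale (u X) (K X))"
        using step(1) proj_e by blast
      have scale: "fscale ((fscale c u + v) X) (K X) = fscale c (fscale (u X) (K X)) + fscale (v X) (K X)" for X
        by (simp add: fscale_def fun_eq_iff algebra_simps)
      have "fscale c u + v = fscale c (\<Sum>X\<in>tab ` G. fscale (u X) (K X)) + (\<Sum>X\<in>tab ` G. fscale (v X) (K X))"
        by (rule arg_cong2[OF u step(2), of "\<lambda>f g. fscale c f + g"])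
      also have "\<dots> = (\<Sum>X\<in>tab ` G. fscale ((fscale c u + v) X) (K X))"
        by (simp only: scale sum.distrib cfun.scale_sum_right)
      finally show ?case .
    qed
    show "perm_action s v \<in> V" if "v \<in> V" for v
      using that unfolding V
    proof (induction rule: cfun.span_induct_alt)
      case base
      have "perm_action s 0 = 0" by (simp add: perm_action_def fun_eq_iff)
      then show ?case by (simp only: cfun.span_zero)
    next
      case (step c u v)
      have "perm_action s u \<in> e ` G" using step(1) act s by (auto simp: permutes_compose)
      then show ?case unfolding add scale by (intro cfun.span_add cfun.span_scale cfun.span_base step)
    qed
  qed simp
  also have "\<dots> = (\<Sum>X\<in>tab ` G. \<Sum>g | g \<in> G \<and> tab g = X. e (s \<circ> g) (tab g) / of_real k)"
  proof (rule sum.cong[OF refl])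
    fix X
    have "perm_action s (K X) X = (\<Sum>g | g \<in> G \<and> tab g = X. perm_action s (e g) X) / of_real k"
      by (simp add: K_def perm_action_def fscale_def sum_apply)
    also have "\<dots> = (\<Sum>g | g \<in> G \<and> tab g = X. e (s \<circ> g) (tab g) / of_real k)"
      unfolding sum_divide_distrib by (intro sum.cong refl) (auto simp: act)
    finally show "perm_action s (K X) X = (\<Sum>g | g \<in> G \<and> tab g = X. e (s \<circ> g) (tab g) / of_real k)" .
  qed
  also have "\<dots> = (\<Sum>g\<in>G. e (s \<circ> g) (tab g) / of_real k)"
    by (rule sum.group) auto
  also have "\<dots> = of_real (\<chi> s)"
    using s by (simp add: e_tab permutes_compose \<chi>_def sum_divide_distrib comp_assoc)
  finally show ?thesis .
qed

end

lemma irr_char_jacobi_trudi: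
  assumes "is_partition p" "s permutes {1..sum_list p}"
  shows "irr_char p s = of_real (jacobi_trudi {1..sum_list p} (length p) (shifted p) s)"
proof -
  obtain T where "bij_betw T (diagram p) {1..sum_list p}"
    using finite_same_card_bij[OF finite_diagram, of "{1..sum_list p}" p] card_diagram by auto
  then interpret tableau p T using assms(1) by unfold_locales (simp_all add: tableaux_def)
  show ?thesis using irr_char_eq_\<chi>[of s] \<chi>_eq_jacobi_trudi[of s] assms(2) by (simp add: A_def)
qed

section \<open>Stabilization of Kostka numbers and their sums over matrices\<close>

definition stabilizes :: "(nat \<Rightarrow> 'b) \<Rightarrow> bool" where
  "stabilizes f \<longleftrightarrow> (\<exists>c. \<forall>\<^sub>F n in sequentially. f n = c)"

lemma stabilizes_const: "stabilizes (\<lambda>_. c)"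
  by (auto simp: stabilizes_def)

lemma stabilizes_cong:
  assumes "\<forall>\<^sub>F n in sequentially. f n = g n" "stabilizes g"
  shows "stabilizes f"
proof -
  obtain c where "\<forall>\<^sub>F n in sequentially. g n = c" using assms(2) by (auto simp: stabilizes_def)
  with assms(1) have "\<forall>\<^sub>F n in sequentially. f n = c" by eventually_elim simp
  then show ?thesis by (auto simp: stabilizes_def)
qed

lemma stabilizes_comp:
  assumes "stabilizes f"
  shows "stabilizes (\<lambda>n. h (f n))"
proof -
  obtain c where "\<forall>\<^sub>F n in sequentially. f n = c" using assms by (auto simp: stabilizes_def)
  then have "\<forall>\<^sub>F n in sequentially. h (f n) = h c" by eventually_elim simp
  then show ?thesis by (auto simp: stabilizes_def)
qed

lemma stabilizes_sum:
  assumes "finite S" "\<And>c. c \<in> S \<Longrightarrow> stabilizes (f c)"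
  shows "stabilizes (\<lambda>n. \<Sum>c\<in>S. f c n)"
proof -
  obtain d where d: "\<And>c. c \<in> S \<Longrightarrow> \<forall>\<^sub>F n in sequentially. f c n = d c"
    using assms(2) unfolding stabilizes_def by metis
  then have "\<forall>\<^sub>F n in sequentially. \<forall>c\<in>S. f c n = d c"
    using assms(1) by (simp add: eventually_ball_finite)
  then have "\<forall>\<^sub>F n in sequentially. (\<Sum>c\<in>S. f c n) = (\<Sum>c\<in>S. d c)"
    by eventually_elim simp
  then show ?thesis by (auto simp: stabilizes_def)
qed

text \<open>Adding \<open>n\<close> columns of length \<open>N\<close> to a partition.\<close>

definition stretch :: "nat \<Rightarrow> (nat \<Rightarrow> int) \<Rightarrow> nat \<Rightarrow> nat \<Rightarrow> int" where
  "stretch N x n = (\<lambda>i. x i + (if i < N then int n else 0))"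

text \<open>The condition that \<open>stretch N x n\<close> is a shifted partition for large \<open>n\<close>: rows \<open>N - 1\<close> and \<open>N\<close> are
  separated by the stretching itself.\<close>

definition cut_partition :: "nat \<Rightarrow> nat \<Rightarrow> (nat \<Rightarrow> int) \<Rightarrow> bool" where
  "cut_partition l N x \<longleftrightarrow> N \<le> l \<and> (\<forall>i<l. Suc i \<noteq> N \<longrightarrow> x (Suc i) < x i) \<and> x l = - int l"

lemma eventually_int_ge: "\<forall>\<^sub>F n in sequentially. b \<le> int n"
  using eventually_ge_at_top[of "nat b"] by eventually_elim simp

lemma eventually_shifted_partition_stretch:
  assumes "cut_partition l N x"
  shows "\<forall>\<^sub>F n in sequentially. shifted_partition l (stretch N x n)"
  using eventually_int_ge[of "x N - x (N - 1) + 1"]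
proof eventually_elim
  case (elim n)
  have "stretch N x n (Suc i) < stretch N x n i" if "i < l" for i
    using assms elim that by (cases "Suc i = N") (auto simp: stretch_def cut_partition_def)
  then show ?case using assms by (auto simp: shifted_partition_def cut_partition_def stretch_def)
qed

text \<open>A strip of fixed size is eventually too small to notice the condition between the rows \<open>N - 1\<close> and \<open>N\<close>, so for
  large \<open>n\<close> the strips no longer depend on \<open>n\<close>.\<close>

lemma stabilizes_alt_kostka_Cons_fixed:
  assumes x: "cut_partition l N x"
    and IH: "\<And>y. cut_partition l N y \<Longrightarrow> stabilizes (\<lambda>n. alt_kostka l (stretch N y n) (G n))"
  shows "stabilizes (\<lambda>n. alt_kostka l (stretch N x n) (r # G n))"
proof -
  define S where "S = {c \<in> comps l r. \<forall>i<l. Suc i \<noteq> N \<longrightarrow> int (c i) < x i - x (Suc i)}"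
  have "\<forall>\<^sub>F n in sequentially. alt_kostka l (stretch N x n) (r # G n) =
    (\<Sum>c\<in>S. alt_kostka l (stretch N (\<lambda>i. x i - int (c i)) n) (G n))"
    using eventually_int_ge[of "r + 1 + x N - x (N - 1)"] eventually_shifted_partition_stretch[OF x]
  proof eventually_elim
    case (elim n)
    have "strips l (stretch N x n) r = S"
    proof -
      have "int (c i) < stretch N x n i - stretch N x n (Suc i) \<longleftrightarrow> (Suc i \<noteq> N \<longrightarrow> int (c i) < x i - x (Suc i))"
        if c: "c \<in> comps l r" and i: "i < l" for c i
      proof (cases "Suc i = N")
        case True
        have "c i \<le> (\<Sum>j<l. c j)" using i by (intro member_le_sum) auto
        moreover have "int (\<Sum>j<l. c j) = r" using c by (simp add: comps_def)
        ultimately have "int (c i) \<le> r" by linarith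
        then show ?thesis using True elim by (auto simp: stretch_def)
      qed (auto simp: stretch_def)
      then show ?thesis by (auto simp: strips_def S_def)
    qed
    moreover have "(\<lambda>i. stretch N x n i - int (c i)) = stretch N (\<lambda>i. x i - int (c i)) n" for c :: "nat \<Rightarrow> nat"
      by (auto simp: stretch_def)
    ultimately show ?case using alt_kostka_Cons_strips[OF elim(2), of r "G n"] by simp
  qed
  moreover have "stabilizes (\<lambda>n. \<Sum>c\<in>S. alt_kostka l (stretch N (\<lambda>i. x i - int (c i)) n) (G n))"
  proof (rule stabilizes_sum)
    fix c assume "c \<in> S"
    then show "stabilizes (\<lambda>n. alt_kostka l (stretch N (\<lambda>i. x i - int (c i)) n) (G n))"
      using x by (intro IH) (force simp: cut_partition_def S_def comps_def)
  qed (simp add: S_def)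
  ultimately show ?thesis by (rule stabilizes_cong)
qed

text \<open>A strip of size \<open>b + n\<close> has bounded length in all rows but the last stretched one, \<open>k\<close>, because the
  neighbouring rows differ by a constant there. So it takes \<open>n\<close> cells from row \<open>k\<close> up to a bounded
  error, and what remains is stretched in \<open>k\<close> rows only.\<close>

lemma stabilizes_alt_kostka_Cons_stretched:
  assumes x: "cut_partition l (Suc k) x"
    and IH: "\<And>y. cut_partition l k y \<Longrightarrow> stabilizes (\<lambda>n. alt_kostka l (stretch k y n) (G n))"
  shows "stabilizes (\<lambda>n. alt_kostka l (stretch (Suc k) x n) ((b + int n) # G n))"
proof -
  have k: "k < l" using x by (simp add: cut_partition_def)
  \<comment> \<open>the strips with \<open>n\<close> cells of row \<open>k\<close> left out; the entry at \<open>k\<close> may be negative\<close>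
  define S where "S = {d :: nat \<Rightarrow> int. (\<forall>i<l. d i < x i - x (Suc i)) \<and> (\<forall>i<l. i \<noteq> k \<longrightarrow> 0 \<le> d i) \<and>
     (\<forall>i\<ge>l. d i = 0) \<and> (\<Sum>i<l. d i) = b}"
  define B where "B = \<bar>b\<bar> + (\<Sum>i<l. \<bar>x i - x (Suc i)\<bar>)"
  have single: "\<bar>x i - x (Suc i)\<bar> \<le> (\<Sum>i<l. \<bar>x i - x (Suc i)\<bar>)" if "i < l" for i
    using that by (intro member_le_sum) auto
  have bound: "\<bar>d i\<bar> \<le> B" if d: "d \<in> S" for d i
  proof (cases "i < l")
    case i: True
    have up: "d i \<le> \<bar>x i - x (Suc i)\<bar>" if "i < l" for i using d that by (force simp: S_def)
    show ?thesis
    proof (cases "i = k")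
      case True
      have "b = d k + sum d ({..<l} - {k})" using d k by (simp add: S_def sum.remove[of _ k])
      moreover have "sum d ({..<l} - {k}) \<le> (\<Sum>i\<in>{..<l} - {k}. \<bar>x i - x (Suc i)\<bar>)" 
        using up by (intro sum_mono) auto
      moreover have "\<dots> \<le> (\<Sum>i<l. \<bar>x i - x (Suc i)\<bar>)" by (intro sum_mono2) auto
      ultimately show ?thesis using up[OF i] single[OF i] True by (simp add: B_def)
    next
      case False
      then have "0 \<le> d i" using d i by (simp add: S_def)
      then show ?thesis using up[OF i] single[OF i] by (simp add: B_def)
    qed
  qed (use d in \<open>auto simp: S_def B_def sum_nonneg\<close>)
  have finS: "finite S"
  proof (rule finite_subset)
    show "S \<subseteq> {d. \<forall>i. (i \<in> {..<l} \<longrightarrow> d i \<in> {-B..B}) \<and> (i \<notin> {..<l} \<longrightarrow> d i = 0)}"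
      using bound by (auto simp: abs_le_iff S_def) (smt (verit) bound abs_le_iff S_def)+
  qed (intro finite_set_of_finite_funs; simp)
  have "\<forall>\<^sub>F n in sequentially. alt_kostka l (stretch (Suc k) x n) ((b + int n) # G n) =
    (\<Sum>d\<in>S. alt_kostka l (stretch k (\<lambda>i. x i - d i) n) (G n))"
    using eventually_int_ge[of B] eventually_shifted_partition_stretch[OF x]
  proof eventually_elim
    case (elim n)
    define sh where "sh i = (if i = k then int n else 0)" for i
    have shsum: "(\<Sum>i<l. sh i) = int n" using k by (simp add: sh_def)
    have shi: "stretch (Suc k) x n i - stretch (Suc k) x n (Suc i) = x i - x (Suc i) + sh i" for i
      by (auto simp: stretch_def sh_def)
    have nn: "d i + sh i \<ge> 0" if "d \<in> S" for d i
      using that bound[OF that, of i] elim(1) by (cases "i < l") (auto simp: sh_def S_def)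
    let ?f = "\<lambda>d i. nat (d i + sh i)" and ?g = "\<lambda>c i. int (c i) - sh i"
    have bij: "bij_betw ?f S (strips l (stretch (Suc k) x n) (b + int n))"
    proof (rule bij_betwI[where g="?g"])
      show "?f \<in> S \<rightarrow> strips l (stretch (Suc k) x n) (b + int n)"
      proof
        fix d assume d: "d \<in> S"
        have "(\<Sum>i<l. int (?f d i)) = (\<Sum>i<l. d i + sh i)" using nn[OF d] by simp
        also have "\<dots> = b + int n" using d shsum by (simp add: S_def sum.distrib)
        finally have "int (\<Sum>i<l. ?f d i) = b + int n" by simp
        moreover have "?f d i = 0" if "i \<ge> l" for i using that d k by (simp add: S_def sh_def)
        moreover have "int (?f d i) < x i - x (Suc i) + sh i" if "i < l" for i
          using that d nn[OF d, of i] by (simp add: S_def)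
        ultimately show "?f d \<in> strips l (stretch (Suc k) x n) (b + int n)"
          by (simp add: strips_def comps_def shi del: of_nat_sum)
      qed
      show "?g \<in> strips l (stretch (Suc k) x n) (b + int n) \<rightarrow> S"
      proof
        fix c assume c: "c \<in> strips l (stretch (Suc k) x n) (b + int n)"
        have "(\<Sum>i<l. ?g c i) = int (\<Sum>i<l. c i) - (\<Sum>i<l. sh i)" by (simp add: sum_subtractf)
        also have "\<dots> = b" using c shsum by (simp add: strips_def comps_def del: of_nat_sum)
        finally have "(\<Sum>i<l. ?g c i) = b" .
        moreover have "?g c i < x i - x (Suc i)" if "i < l" for i
          using c that by (auto simp: strips_def shi)
        moreover have "?g c i = 0" if "i \<ge> l" for i using that c k by (auto simp: strips_def comps_def sh_def)
        ultimately show "?g c \<in> S" by (auto simp: S_def sh_def)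
      qed
    qed (use nn in auto)
    have eq: "(\<lambda>i. stretch (Suc k) x n i - int (?f d i)) = stretch k (\<lambda>i. x i - d i) n" if "d \<in> S" for d
      using nn[OF that] by (auto simp: stretch_def sh_def fun_eq_iff less_Suc_eq)
    have "alt_kostka l (stretch (Suc k) x n) ((b + int n) # G n) =
      (\<Sum>c\<in>strips l (stretch (Suc k) x n) (b + int n). alt_kostka l (\<lambda>i. stretch (Suc k) x n i - int (c i)) (G n))"
      by (rule alt_kostka_Cons_strips[OF elim(2)])
    also have "\<dots> = (\<Sum>d\<in>S. alt_kostka l (\<lambda>i. stretch (Suc k) x n i - int (?f d i)) (G n))"
      by (rule sum.reindex_bij_betw[OF bij, symmetric])
    also have "\<dots> = (\<Sum>d\<in>S. alt_kostka l (stretch k (\<lambda>i. x i - d i) n) (G n))"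
      by (intro sum.cong refl) (simp only: eq)
    finally show ?case .
  qed
  moreover have "stabilizes (\<lambda>n. \<Sum>d\<in>S. alt_kostka l (stretch k (\<lambda>i. x i - d i) n) (G n))"
  proof (rule stabilizes_sum[OF finS])
    fix d assume d: "d \<in> S"
    have "x (Suc i) - d (Suc i) < x i - d i" if "i < l" "Suc i \<noteq> k" for i
    proof -
      have "d (Suc i) \<ge> 0" using d that by (cases "Suc i < l") (auto simp: S_def)
      moreover have "d i < x i - x (Suc i)" using d that by (simp add: S_def)
      ultimately show ?thesis by simp
    qed
    then show "stabilizes (\<lambda>n. alt_kostka l (stretch k (\<lambda>i. x i - d i) n) (G n))"
      using x d by (intro IH) (auto simp: cut_partition_def S_def)
  qed
  ultimately show ?thesis by (rule stabilizes_cong)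
qed

lemma stabilizes_alt_kostka:
  assumes "cut_partition l (length bs) x"
  shows "stabilizes (\<lambda>n. alt_kostka l (stretch (length bs) x n) (cs @ map (\<lambda>b. b + int n) bs))"
proof -
  have base: "stabilizes (\<lambda>n. alt_kostka l (stretch (length bs) x n) (map (\<lambda>b. b + int n) bs))"
    if "cut_partition l (length bs) x" for x
    using that
  proof (induction bs arbitrary: x)
    case Nil
    then show ?case by (simp add: stretch_def stabilizes_const del: alt_kostka.simps)
  next
    case (Cons b bs)
    show ?case
      using stabilizes_alt_kostka_Cons_stretched[of l "length bs" x, OF _ Cons.IH] Cons.prems
      by (simp del: alt_kostka.simps)
  qed
  show ?thesis
    using assms
  proof (induction cs arbitrary: x)
    case Nil
    then show ?case using base by simp
  next
    case (Cons c cs)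
    show ?case
      using stabilizes_alt_kostka_Cons_fixed[OF Cons.prems Cons.IH] by (simp del: alt_kostka.simps)
  qed
qed

text \<open>The weight \<open>w i j = 2 a i - 2 j - 1\<close> is odd, positive on the diagram and negative off it, and its sum against
  the deviation \<open>B\<close> of \<open>M\<close> from \<open>n\<close> times the diagram depends on \<open>u\<close> and \<open>v\<close> only. All deviations have the
  direction that lowers this sum, except for the slack \<open>m\<close>, so none of them can be large.\<close>

lemma near_diagram_matrix:
  fixes M :: "nat \<Rightarrow> nat \<Rightarrow> int" and a :: "nat \<Rightarrow> nat" and m :: int
  assumes a: "\<And>i. i < p \<Longrightarrow> a i \<le> q" and m: "0 \<le> m"
    and nonneg: "\<And>i j. i < p \<Longrightarrow> j < q \<Longrightarrow> 0 \<le> M i j"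
    and le: "\<And>i j. i < p \<Longrightarrow> j < q \<Longrightarrow> M i j \<le> m + n"
    and rows: "\<And>i. i < p \<Longrightarrow> (\<Sum>j<q. M i j) = u i + n * int (a i)"
    and cols: "\<And>j. j < q \<Longrightarrow> (\<Sum>i<p. M i j) = v j + n * int (card {i. i < p \<and> j < a i})"
    and ij: "i < p" "j < q"
  shows "\<bar>M i j - (if j < a i then n else 0)\<bar> \<le> 
     m + m * (\<Sum>i<p. \<Sum>j<a i. 2 * int (a i) - 2 * int j - 1) - (\<Sum>i<p. 2 * int (a i) * u i) + (\<Sum>j<q. (2 * int j + 1) * v j)"
proof -
  define w where "w i j = 2 * int (a i) - 2 * int j - 1" for i j
  define B where "B i j = M i j - (if j < a i then n else 0)" for i j
  \<comment> \<open>the nonnegative defect: each unit of it costs at least one unit of weight\<close>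
  define e where "e i j = (if j < a i then m - B i j else B i j)" for i j
  have rowsum: "(\<Sum>j<q. if j < a i then g j else 0) = (\<Sum>j<a i. g j)" if "i < p" for i and g :: "nat \<Rightarrow> int"
    using a[OF that] by (simp add: sum.inter_filter[symmetric]) (intro sum.cong; auto)
  have Brow: "(\<Sum>j<q. B i j) = u i" if "i < p" for i
    using rows[OF that] rowsum[OF that, of "\<lambda>_. n"] by (simp add: B_def sum_subtractf)
  have Bcol: "(\<Sum>i<p. B i j) = v j" if "j < q" for j
  proof -
    have "(\<Sum>i<p. if j < a i then n else 0) = n * int (card {i. i < p \<and> j < a i})"
      by (simp add: sum.inter_filter[symmetric] lessThan_def)
    then show ?thesis using cols[OF that] by (simp add: B_def sum_subtractf)
  qed
  have "(\<Sum>i<p. \<Sum>j<q. w i j * B i j) = (\<Sum>i<p. \<Sum>j<q. 2 * int (a i) * B i j) - (\<Sum>i<p. \<Sum>j<q. (2 * int j + 1) * B i j)"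
    by (simp add: w_def algebra_simps sum_subtractf sum.distrib)
  also have "(\<Sum>i<p. \<Sum>j<q. 2 * int (a i) * B i j) = (\<Sum>i<p. 2 * int (a i) * u i)"
    using Brow by (simp flip: sum_distrib_left)
  also have "(\<Sum>i<p. \<Sum>j<q. (2 * int j + 1) * B i j) = (\<Sum>j<q. (2 * int j + 1) * v j)"
    using Bcol by (subst sum.swap) (simp flip: sum_distrib_left)
  finally have wB: "(\<Sum>i<p. \<Sum>j<q. w i j * B i j) = (\<Sum>i<p. 2 * int (a i) * u i) - (\<Sum>j<q. (2 * int j + 1) * v j)" .
  have we: "\<bar>w i j\<bar> * e i j = (if j < a i then m * w i j else 0) - w i j * B i j" for i j
    by (auto simp: w_def e_def algebra_simps abs_if)
  have "(\<Sum>i<p. \<Sum>j<q. \<bar>w i j\<bar> * e i j) = m * (\<Sum>i<p. \<Sum>j<a i. w i j) - (\<Sum>i<p. \<Sum>j<q. w i j * B i j)"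
    unfolding we using rowsum by (simp add: sum_subtractf sum_distrib_left)
  moreover have e0: "0 \<le> e i j" if "i < p" "j < q" for i j
    using nonneg[OF that] le[OF that] by (auto simp: e_def B_def)
  moreover have "e i j \<le> \<bar>w i j\<bar> * e i j"
  proof -
    have "1 \<le> \<bar>w i j\<bar>" unfolding w_def by presburger
    then show ?thesis using e0[OF ij] mult_right_mono[of 1 "\<bar>w i j\<bar>" "e i j"] by simp
  qed
  moreover have "\<bar>w i j\<bar> * e i j \<le> (\<Sum>j<q. \<bar>w i j\<bar> * e i j)"
    using e0 ij by (intro member_le_sum) auto
  moreover have "(\<Sum>j<q. \<bar>w i j\<bar> * e i j) \<le> (\<Sum>i<p. \<Sum>j<q. \<bar>w i j\<bar> * e i j)"
    using e0 ij by (intro member_le_sum[of i "{..<p}" "\<lambda>i. \<Sum>j<q. \<bar>w i j\<bar> * e i j"]) (auto intro!: sum_nonneg)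
  ultimately have "e i j \<le> m * (\<Sum>i<p. \<Sum>j<a i. w i j) - (\<Sum>i<p. 2 * int (a i) * u i) + (\<Sum>j<q. (2 * int j + 1) * v j)"
    using wB by linarith
  moreover have "\<bar>B i j\<bar> \<le> m + e i j" using m e0[OF ij] by (auto simp: e_def)
  ultimately show ?thesis by (simp add: B_def w_def)
qed

text \<open>The cells of a \<open>p\<close> by \<open>q\<close> rectangle with those of the diagram at the end: the contents that grow with \<open>n\<close> have to
  come last in \<open>stabilizes_alt_kostka\<close>.\<close>

definition cells :: "nat \<Rightarrow> nat \<Rightarrow> (nat \<Rightarrow> nat) \<Rightarrow> (nat \<times> nat) list" where
  "cells p q a = filter (\<lambda>(i, j). \<not> j < a i) (List.product [0..<p] [0..<q]) @
     filter (\<lambda>(i, j). j < a i) (List.product [0..<p] [0..<q])"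

lemma set_cells: "set (cells p q a) = {..<p} \<times> {..<q}"
  by (auto simp: cells_def)

lemma distinct_cells: "distinct (cells p q a)"
  by (auto simp: cells_def distinct_product)

text \<open>The matrices with nonzero Kostka number are \<open>n\<close> times the diagram plus a matrix from the fixed finite set
  \<open>S\<close>, and each element of \<open>S\<close> contributes an eventually constant number.\<close>

lemma stabilizes_sum_contingency:
  fixes a :: "nat \<Rightarrow> nat"
  assumes a: "\<And>i. i < p \<Longrightarrow> a i \<le> q" and z: "cut_partition l (\<Sum>i<p. a i) z"
  shows "stabilizes (\<lambda>n. \<Sum>M\<in>contingency {..<p} (\<lambda>i. u i + int n * int (a i)) q
      (\<lambda>j. v j + int n * int (card {i. i < p \<and> j < a i})).
     alt_kostka l (stretch (\<Sum>i<p. a i) z n) (map (\<lambda>(i, j). int (M i j)) (cells p q a)))"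
proof -
  define N where "N = (\<Sum>i<p. a i)"
  define m where "m = max 0 (z 0)"
  define C where "C = max 0 (m + m * (\<Sum>i<p. \<Sum>j<a i. 2 * int (a i) - 2 * int j - 1)
     - (\<Sum>i<p. 2 * int (a i) * u i) + (\<Sum>j<q. (2 * int j + 1) * v j))"
  define T where "T n = contingency {..<p} (\<lambda>i. u i + int n * int (a i)) q
      (\<lambda>j. v j + int n * int (card {i. i < p \<and> j < a i}))" for n
  define G where "G n M = alt_kostka l (stretch N z n) (map (\<lambda>(i, j). int (M i j)) (cells p q a))"
    for n and M :: "nat \<Rightarrow> nat \<Rightarrow> nat"
  define S where "S = {B \<in> PiE {..<p} (\<lambda>_. {b :: nat \<Rightarrow> int. \<forall>j. (j \<in> {..<q} \<longrightarrow> b j \<in> {-C..C}) \<and> (j \<notin> {..<q} \<longrightarrow> b j = 0)}).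
     (\<forall>i<p. \<forall>j<q. \<not> j < a i \<longrightarrow> 0 \<le> B i j) \<and> (\<forall>i<p. (\<Sum>j<q. B i j) = u i) \<and> (\<forall>j<q. (\<Sum>i<p. B i j) = v j)}"
  have finS: "finite S"
    unfolding S_def by (rule finite_subset[OF Collect_restrict]) (intro finite_PiE finite_set_of_finite_funs; simp)
  define outs where "outs = filter (\<lambda>(i, j). \<not> j < a i) (List.product [0..<p] [0..<q])"
  define ins where "ins = filter (\<lambda>(i, j). j < a i) (List.product [0..<p] [0..<q])"
  have len: "length ins = N"
  proof -
    have "distinct ins" by (simp add: ins_def distinct_product)
    then have "length ins = card (set ins)" by (simp only: distinct_card)
    also have "set ins = (SIGMA i:{..<p}. {..<a i})" using a by (auto simp: ins_def) (meson less_le_trans)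
    finally show ?thesis by (simp add: N_def)
  qed
  define sh where "sh n i j = (if j < a i then int n else 0)" for n i j
  have "\<forall>\<^sub>F n in sequentially. (\<Sum>M\<in>T n. G n M) =
    (\<Sum>B\<in>S. alt_kostka l (stretch N z n) (map (\<lambda>(i, j). B i j) outs @ map (\<lambda>b. b + int n) (map (\<lambda>(i, j). B i j) ins)))"
    using eventually_int_ge[of C] eventually_shifted_partition_stretch[OF z[folded N_def]]
  proof eventually_elim
    case (elim n)
    let ?f = "\<lambda>B. \<lambda>i\<in>{..<p}. \<lambda>j. nat (B i j + sh n i j)"
    let ?g = "\<lambda>M. \<lambda>i\<in>{..<p}. \<lambda>j. int (M i j) - sh n i j"
    define T' where "T' = {M \<in> T n. \<forall>i<p. \<forall>j<q. \<bar>int (M i j) - sh n i j\<bar> \<le> C}"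
    have rowsh: "(\<Sum>j<q. sh n i j) = int n * int (a i)" if "i < p" for i
    proof -
      have "{j. j < q \<and> j < a i} = {..<a i}" using a[OF that] by auto
      then show ?thesis by (simp add: sh_def sum.inter_filter[symmetric])
    qed
    have colsh: "(\<Sum>i<p. sh n i j) = int n * int (card {i. i < p \<and> j < a i})" for j
      by (simp add: sh_def sum.inter_filter[symmetric] lessThan_def)
    have nn: "B i j + sh n i j \<ge> 0" if "B \<in> S" "i < p" for B i j
    proof (cases "j < q")
      case True
      have "B i j \<in> {-C..C}" using that True by (simp add: S_def PiE_iff)
      then have "- C \<le> B i j" by simp
      then show ?thesis using that True elim(1) by (auto simp: S_def sh_def)
    next
      case False
      then show ?thesis using that by (auto simp: S_def sh_def PiE_iff)
    qed
    have bij: "bij_betw ?f S T'"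
    proof (rule bij_betwI[where g="?g"])
      show "?f \<in> S \<rightarrow> T'"
      proof
        fix B assume B: "B \<in> S"
        have zero: "B i j + sh n i j = 0" if "i < p" "\<not> j < q" for i j
          using B that a[OF that(1)] by (auto simp: S_def PiE_iff sh_def)
        have row: "(\<Sum>j<q. B i j + sh n i j) = u i + int n * int (a i)" if "i < p" for i
          using B that rowsh[OF that] by (simp add: S_def sum.distrib)
        have col: "(\<Sum>i<p. B i j + sh n i j) = v j + int n * int (card {i. i < p \<and> j < a i})" if "j < q" for j
          using B that colsh[of j] by (simp add: S_def sum.distrib)
        have "\<bar>B i j\<bar> \<le> C" if "i < p" "j < q" for i j
        proof -
          have "B i j \<in> {-C..C}" using B that by (simp add: S_def PiE_iff)
          then show ?thesis by (simp add: abs_le_iff)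
        qed
        then show "?f B \<in> T'"
          using nn[OF B] row col zero by (auto simp: T'_def T_def contingency_def comps_def)
      qed
      show "?g \<in> T' \<rightarrow> S"
      proof
        fix M assume M: "M \<in> T'"
        have row: "(\<Sum>j<q. int (M i j) - sh n i j) = u i" if "i < p" for i
          using M that rowsh[OF that] by (auto simp: T'_def T_def contingency_def comps_def PiE_iff sum_subtractf)
        have col: "(\<Sum>i<p. int (M i j) - sh n i j) = v j" if "j < q" for j
          using M that colsh[of j] by (auto simp: T'_def T_def contingency_def sum_subtractf)
        have zero: "int (M i j) - sh n i j = 0" if "i < p" "\<not> j < q" for i j
          using M that a[OF that(1)] by (auto simp: T'_def T_def contingency_def comps_def PiE_iff sh_def)
        have "int (M i j) - sh n i j \<in> {-C..C}" if "i < p" "j < q" for i j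
        proof -
          have "\<bar>int (M i j) - sh n i j\<bar> \<le> C" using M that by (simp add: T'_def)
          then show ?thesis by (auto simp: abs_le_iff)
        qed
        moreover have "0 \<le> int (M i j) - sh n i j" if "\<not> j < a i" for i j
          using that by (simp add: sh_def)
        ultimately show "?g M \<in> S"
          using row col zero by (simp add: S_def PiE_iff del: of_nat_sum atLeastAtMost_iff)
      qed
      show "?g (?f B) = B" if "B \<in> S" for B
        using nn[OF that] that by (auto simp: S_def PiE_iff extensional_def fun_eq_iff)
      show "?f (?g M) = M" if "M \<in> T'" for M
        using that by (auto simp: T'_def T_def contingency_def PiE_iff extensional_def fun_eq_iff)
    qed
    have "(\<Sum>M\<in>T n. G n M) = (\<Sum>M\<in>T'. G n M)"
    proof (rule sum.mono_neutral_right)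
      show "finite (T n)" "T' \<subseteq> T n" by (auto simp: T_def T'_def)
      show "\<forall>M\<in>T n - T'. G n M = 0"
      proof (intro ballI, rule ccontr)
        fix M assume M: "M \<in> T n - T'" and "G n M \<noteq> 0"
        then have "alt_kostka l (stretch N z n) (map (\<lambda>(i, j). int (M i j)) (cells p q a)) \<noteq> 0"
          by (simp add: G_def)
        then have "int (M i j) \<le> stretch N z n 0" if "i < p" "j < q" for i j
          using alt_kostka_nonzero_le[OF elim(2)] that by (force simp: set_cells)
        moreover have "stretch N z n 0 \<le> m + int n" by (simp add: stretch_def m_def max_def)
        ultimately have le: "int (M i j) \<le> m + int n" if "i < p" "j < q" for i j
          using that by (meson order_trans)
        have "\<bar>int (M i j) - (if j < a i then int n else 0)\<bar> \<le> C" if "i < p" "j < q" for i j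
          unfolding C_def
          by (rule max.coboundedI2, rule near_diagram_matrix)
            (use a le that M in \<open>auto simp: T_def contingency_def comps_def m_def PiE_iff\<close>)
        then show False using M by (auto simp: T'_def sh_def)
      qed
    qed
    also have "\<dots> = (\<Sum>B\<in>S. G n (?f B))"
      by (rule sum.reindex_bij_betw[OF bij, symmetric])
    also have "\<dots> = (\<Sum>B\<in>S. alt_kostka l (stretch N z n)
        (map (\<lambda>(i, j). B i j) outs @ map (\<lambda>b. b + int n) (map (\<lambda>(i, j). B i j) ins)))"
    proof (rule sum.cong[OF refl])
      fix B assume B: "B \<in> S"
      have "map (\<lambda>(i, j). int (?f B i j)) (cells p q a) = map (\<lambda>(i, j). B i j) outs @ map (\<lambda>b. b + int n) (map (\<lambda>(i, j). B i j) ins)"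
        using nn[OF B] by (auto simp: cells_def outs_def ins_def sh_def)
      then show "G n (?f B) = alt_kostka l (stretch N z n)
        (map (\<lambda>(i, j). B i j) outs @ map (\<lambda>b. b + int n) (map (\<lambda>(i, j). B i j) ins))"
        unfolding G_def by (rule arg_cong)
    qed
    finally show ?case .
  qed
  moreover have "stabilizes (\<lambda>n. \<Sum>B\<in>S. alt_kostka l (stretch N z n)
      (map (\<lambda>(i, j). B i j) outs @ map (\<lambda>b. b + int n) (map (\<lambda>(i, j). B i j) ins)))"
    using stabilizes_alt_kostka[of l "map (\<lambda>(i, j). B i j) ins" z for B] z len finS
    by (intro stabilizes_sum) (simp_all add: N_def)
  ultimately have "stabilizes (\<lambda>n. \<Sum>M\<in>T n. G n M)" by (rule stabilizes_cong)
  then show ?thesis by (simp only: T_def G_def N_def)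
qed

section \<open>Stability of the Kronecker coefficients\<close>

definition part :: "nat list \<Rightarrow> nat \<Rightarrow> nat" where
  "part p i = (if i < length p then p ! i else 0)"

lemma shifted_eq_part: "shifted p i = int (part p i) - int i"
  by (simp add: shifted_def part_def)

lemma length_padd: "length (padd xs ys) = max (length xs) (length ys)"
  by (induction xs ys rule: padd.induct) auto

lemma part_Cons: "part (x # xs) i = (case i of 0 \<Rightarrow> x | Suc j \<Rightarrow> part xs j)"
  by (cases i) (simp_all add: part_def)

lemma part_padd: "part (padd xs ys) i = part xs i + part ys i"
proof (induction xs ys arbitrary: i rule: padd.induct)
  case (3 x xs y ys)
  then show ?case by (cases i) (simp_all add: part_Cons)
qed (simp_all add: part_def)

lemma sum_list_padd: "sum_list (padd xs ys) = sum_list xs + sum_list ys"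
  by (induction xs ys rule: padd.induct) auto

lemma padd_bounded:
  "(\<forall>z\<in>set xs. z \<le> x) \<Longrightarrow> (\<forall>z\<in>set ys. z \<le> y) \<Longrightarrow> \<forall>z\<in>set (padd xs ys). z \<le> x + y"
  by (induction xs ys rule: padd.induct) (auto intro: add_mono trans_le_add1 trans_le_add2)

lemma is_partition_Nil: "is_partition []"
  by (simp add: is_partition_def)

lemma is_partition_Cons: "is_partition (x # xs) \<longleftrightarrow> 0 < x \<and> (\<forall>y\<in>set xs. y \<le> x) \<and> is_partition xs"
  by (auto simp: is_partition_def)

lemma is_partition_padd: "is_partition xs \<Longrightarrow> is_partition ys \<Longrightarrow> is_partition (padd xs ys)"
  by (induction xs ys rule: padd.induct) (auto simp: is_partition_Cons padd_bounded)

lemma is_partition_pscale: "is_partition p \<Longrightarrow> 0 < n \<Longrightarrow> is_partition (pscale n p)"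
  by (induction p) (auto simp: pscale_def is_partition_Cons is_partition_Nil)

lemma is_partition_replicate: "0 < n \<Longrightarrow> is_partition (replicate k n)"
  by (induction k) (auto simp: is_partition_Cons is_partition_Nil)

lemma length_pscale: "length (pscale n p) = length p"
  by (simp add: pscale_def)

lemma part_pscale: "part (pscale n p) i = n * part p i"
  by (simp add: part_def pscale_def)

lemma sum_list_pscale: "sum_list (pscale n p) = n * sum_list p"
  by (simp add: pscale_def sum_list_const_mult)

lemma part_antimono:
  assumes "is_partition p"
  shows "part p (Suc i) \<le> part p i"
  using sorted_wrt_ge_nth_mono[OF assms, of i "Suc i"] by (auto simp: part_def)

lemma sum_part:
  assumes "length p \<le> l"
  shows "(\<Sum>i<l. part p i) = sum_list p"
proof -
  have "(\<Sum>i<l. part p i) = (\<Sum>i<length p. part p i)"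
    using assms by (intro sum.mono_neutral_right) (auto simp: part_def)
  then show ?thesis by (simp add: part_def sum_list_sum_nth lessThan_atLeast0)
qed

lemma part_le_hd:
  assumes "is_partition (a # p)"
  shows "part (a # p) i \<le> a"
  using assms by (cases i) (auto simp: part_def is_partition_Cons)

lemma length_conjugate: 
  assumes "is_partition p"
  shows "part p i \<le> length (conjugate p)"
  using part_le_hd assms by (cases p) (auto simp: conjugate_def part_def[of "[]"])

lemma part_conjugate:
  assumes p: "is_partition p" and l: "length p \<le> l"
  shows "part (conjugate p) j = card {i. i < l \<and> j < part p i}"
proof -
  have set: "{i. i < l \<and> j < part p i} = {i. i < length p \<and> j < p ! i}"
    using l by (auto simp: part_def)
  show ?thesis
  proof (cases p)
    case Nil
    then show ?thesis by (simp add: conjugate_def part_def)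
  next
    case (Cons a q)
    show ?thesis
    proof (cases "j < a")
      case True
      then have "part (conjugate p) j = length (filter (\<lambda>x. j < x) p)"
        by (simp add: conjugate_def part_def Cons)
      then show ?thesis unfolding set by (simp only: length_filter_conv_card)
    next
      case False
      then have "{i. i < l \<and> j < part p i} = {}"
        using part_le_hd[OF p[unfolded Cons]] Cons by (auto simp: not_less intro: order_trans)
      then show ?thesis using Cons False by (simp add: conjugate_def part_def[of "map _ _"])
    qed
  qed
qed

lemma is_partition_conjugate:
  assumes p: "is_partition p"
  shows "is_partition (conjugate p)"
proof (cases p)
  case Nil
  then show ?thesis by (simp add: conjugate_def is_partition_Nil)
next
  case (Cons a q)
  have mono: "length (filter (\<lambda>x. j < x) xs) \<le> length (filter (\<lambda>x. i < x) xs)" if "i < j" for i j :: nat and xs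
    using that by (induction xs) auto
  have "sorted_wrt (\<ge>) (conjugate p)"
    using mono[of _ _ p] by (simp add: conjugate_def Cons(1) sorted_wrt_map sorted_wrt_iff_nth_less del: filter.simps)
  moreover have "0 \<notin> set (conjugate p)"
    using Cons by (auto simp: conjugate_def)
  ultimately show ?thesis by (simp add: is_partition_def)
qed

lemma sum_list_conjugate:
  assumes p: "is_partition p"
  shows "sum_list (conjugate p) = sum_list p"
proof -
  let ?l = "length p" and ?m = "length (conjugate p)"
  have "sum_list (conjugate p) = (\<Sum>j<?m. card {i. i < ?l \<and> j < part p i})"
    using sum_part[of "conjugate p" ?m] by (simp add: part_conjugate[OF p, of ?l])
  also have "\<dots> = (\<Sum>j<?m. \<Sum>i<?l. if j < part p i then 1 else 0)"
    by (simp add: sum.inter_filter[symmetric] lessThan_def)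
  also have "\<dots> = (\<Sum>i<?l. \<Sum>j<?m. if j < part p i then 1 else 0)"
    by (rule sum.swap)
  also have "\<dots> = (\<Sum>i<?l. part p i)"
  proof (rule sum.cong[OF refl])
    fix i
    have "{j. j < ?m \<and> j < part p i} = {..<part p i}"
      using length_conjugate[OF p, of i] by auto
    then show "(\<Sum>j<?m. if j < part p i then 1 else 0) = part p i"
      by (simp add: sum.inter_filter[symmetric])
  qed
  finally show ?thesis by (simp add: sum_part)
qed

lemma kronecker_eq_avg:
  assumes "is_partition p" "is_partition q" "is_partition r" "sum_list q = sum_list p" "sum_list r = sum_list p"
  shows "kronecker p q r = of_real (avg {1..sum_list p} (\<lambda>s.
     jacobi_trudi {1..sum_list p} (length p) (shifted p) s *
     jacobi_trudi {1..sum_list p} (length q) (shifted q) s *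
     jacobi_trudi {1..sum_list p} (length r) (shifted r) s))"
proof -
  have "irr_char p s * irr_char q s * cnj (irr_char r s) = of_real (
     jacobi_trudi {1..sum_list p} (length p) (shifted p) s *
     jacobi_trudi {1..sum_list p} (length q) (shifted q) s *
     jacobi_trudi {1..sum_list p} (length r) (shifted r) s)" if "s permutes {1..sum_list p}" for s
    using irr_char_jacobi_trudi[of p s] irr_char_jacobi_trudi[of q s] irr_char_jacobi_trudi[of r s] assms that
    by simp
  then have "(\<Sum>s | s permutes {1..sum_list p}. irr_char p s * irr_char q s * cnj (irr_char r s)) =
    of_real (\<Sum>s | s permutes {1..sum_list p}.
     jacobi_trudi {1..sum_list p} (length p) (shifted p) s *
     jacobi_trudi {1..sum_list p} (length q) (shifted q) s *
     jacobi_trudi {1..sum_list p} (length r) (shifted r) s)"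
    unfolding of_real_sum by (intro sum.cong refl) simp
  then show ?thesis by (simp add: kronecker_def char_inner_def avg_def)
qed

lemma avg_perm_chars_jacobi_trudi:
  fixes a b :: nat
  assumes A: "finite A" and es: "distinct es" "set es = {..<a} \<times> {..<b}"
    and total: "(\<Sum>i<a. \<pi> i) = int (card A)"
  shows "avg A (\<lambda>s. perm_char A {..<a} \<pi> s * perm_char A {..<b} \<kappa> s * jacobi_trudi A l x s) =
    of_int (\<Sum>M\<in>contingency {..<a} \<pi> b \<kappa>. alt_kostka l x (map (\<lambda>(i, j). int (M i j)) es))"
proof -
  have M: "avg A (\<lambda>s. perm_char A ({..<a} \<times> {..<b}) (\<lambda>(i, j). int (M i j)) s * jacobi_trudi A l x s) =
      of_int (alt_kostka l x (map (\<lambda>(i, j). int (M i j)) es))" if M: "M \<in> contingency {..<a} \<pi> b \<kappa>" for M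
  proof -
    have "(\<Sum>z\<in>{..<a} \<times> {..<b}. case z of (i, j) \<Rightarrow> int (M i j)) = (\<Sum>i<a. \<Sum>j<b. int (M i j))"
      by (simp add: sum.cartesian_product)
    also have "\<dots> = (\<Sum>i<a. \<pi> i)"
      using M by (intro sum.cong refl) (auto simp: contingency_def comps_def)
    finally show ?thesis
      using avg_perm_char_times_jacobi_trudi[OF A es(1), of "\<lambda>(i, j). int (M i j)" l x] es(2) total by simp
  qed
  have "avg A (\<lambda>s. perm_char A {..<a} \<pi> s * perm_char A {..<b} \<kappa> s * jacobi_trudi A l x s) =
    avg A (\<lambda>s. \<Sum>M\<in>contingency {..<a} \<pi> b \<kappa>. perm_char A ({..<a} \<times> {..<b}) (\<lambda>(i, j). int (M i j)) s * jacobi_trudi A l x s)"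
    using A by (intro avg_cong) (simp add: perm_char_times sum_distrib_right)
  also have "\<dots> = of_int (\<Sum>M\<in>contingency {..<a} \<pi> b \<kappa>. alt_kostka l x (map (\<lambda>(i, j). int (M i j)) es))"
    unfolding avg_sum of_int_sum by (intro sum.cong refl M)
  finally show ?thesis .
qed

text \<open>The first two characters are expanded into permutation characters, whose product is again a sum of
  permutation characters; the third one is kept, since its inner product with a permutation character
  is a single Kostka number.\<close>

lemma kronecker_expansion:
  assumes "is_partition p" "is_partition q" "is_partition r" "sum_list q = sum_list p" "sum_list r = sum_list p"
    and es: "distinct es" "set es = {..<length p} \<times> {..<length q}"
  shows "kronecker p q r = of_int (\<Sum>\<sigma> | \<sigma> permutes {..<length p}. \<Sum>\<tau> | \<tau> permutes {..<length q}.
    sign \<sigma> * sign \<tau> *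
    (\<Sum>M\<in>contingency {..<length p} (\<lambda>i. shifted p i + int (\<sigma> i)) (length q) (\<lambda>j. shifted q j + int (\<tau> j)).
      alt_kostka (length r) (shifted r) (map (\<lambda>(i, j). int (M i j)) es)))"
proof -
  let ?A = "{1..sum_list p}"
  have total: "(\<Sum>i<length p. shifted p i + int (\<sigma> i)) = int (card ?A)" if "\<sigma> permutes {..<length p}" for \<sigma>
  proof -
    have "(\<Sum>i<length p. int (\<sigma> i)) = (\<Sum>i<length p. int i)"
      using sum.permute[OF that, of int] by (simp add: o_def)
    moreover have "(\<Sum>i<length p. int (part p i)) = int (sum_list p)"
      using sum_part[of p "length p"] by (simp flip: of_nat_sum)
    ultimately show ?thesis by (simp add: shifted_eq_part sum.distrib sum_subtractf)
  qed
  let ?\<psi> = "jacobi_trudi ?A (length r) (shifted r)"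
  have "avg ?A (\<lambda>s. jacobi_trudi ?A (length p) (shifted p) s * jacobi_trudi ?A (length q) (shifted q) s * ?\<psi> s) =
    avg ?A (\<lambda>s. \<Sum>\<sigma> | \<sigma> permutes {..<length p}. \<Sum>\<tau> | \<tau> permutes {..<length q}. of_int (sign \<sigma> * sign \<tau>) *
      (perm_char ?A {..<length p} (\<lambda>i. shifted p i + int (\<sigma> i)) s *
       perm_char ?A {..<length q} (\<lambda>j. shifted q j + int (\<tau> j)) s * ?\<psi> s))"
    unfolding jacobi_trudi_def[of _ "length p"] jacobi_trudi_def[of _ "length q"] sum_product
    unfolding sum_distrib_right by (simp only: of_int_mult mult_ac)
  also have "\<dots> = (\<Sum>\<sigma> | \<sigma> permutes {..<length p}. \<Sum>\<tau> | \<tau> permutes {..<length q}. of_int (sign \<sigma> * sign \<tau>) *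
    of_int (\<Sum>M\<in>contingency {..<length p} (\<lambda>i. shifted p i + int (\<sigma> i)) (length q) (\<lambda>j. shifted q j + int (\<tau> j)).
      alt_kostka (length r) (shifted r) (map (\<lambda>(i, j). int (M i j)) es)))"
    unfolding avg_sum avg_cmult using total es
    by (intro sum.cong refl arg_cong2[where f="(*)"] avg_perm_chars_jacobi_trudi) auto
  finally show ?thesis
    unfolding kronecker_eq_avg[OF assms(1-5)] by simp
qed

theorem corollary1p4:
  fixes \<alpha> lam \<mu> \<nu> :: "nat list"
  assumes "is_partition \<alpha>"
    and "is_partition lam" and "is_partition \<mu>" and "is_partition \<nu>"
    and "sum_list lam = sum_list \<mu>" and "sum_list \<mu> = sum_list \<nu>"
  shows "\<exists>L\<ge>1. \<forall>n\<ge>L.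
    kronecker (padd lam (pscale n \<alpha>)) (padd \<mu> (pscale n (conjugate \<alpha>)))
      (padd \<nu> (replicate (sum_list \<alpha>) n)) =
    kronecker (padd lam (pscale L \<alpha>)) (padd \<mu> (pscale L (conjugate \<alpha>)))
      (padd \<nu> (replicate (sum_list \<alpha>) L))"
proof -
  define P where "P n = padd lam (pscale n \<alpha>)" for n
  define Q where "Q n = padd \<mu> (pscale n (conjugate \<alpha>))" for n
  define R where "R n = padd \<nu> (replicate (sum_list \<alpha>) n)" for n
  define a b l N where "a = max (length lam) (length \<alpha>)" and "b = max (length \<mu>) (length (conjugate \<alpha>))"
    and "l = max (length \<nu>) (sum_list \<alpha>)" and "N = (\<Sum>i<a. part \<alpha> i)"
  have N: "N = sum_list \<alpha>" unfolding N_def a_def by (rule sum_part) simp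
  have len: "length (P n) = a" "length (Q n) = b" "length (R n) = l" for n
    by (simp_all add: P_def Q_def R_def a_def b_def l_def length_padd length_pscale)
  define z where "z i = int (part \<nu> i) - int i" for i
  define es where "es = cells a b (part \<alpha>)"
  define W where "W \<sigma> \<tau> n = (\<Sum>M\<in>contingency {..<a} (\<lambda>i. (int (part lam i) - int i + int (\<sigma> i)) + int n * int (part \<alpha> i)) b
      (\<lambda>j. (int (part \<mu> j) - int j + int (\<tau> j)) + int n * int (card {i. i < a \<and> j < part \<alpha> i})).
     alt_kostka l (stretch N z n) (map (\<lambda>(i, j). int (M i j)) es))" for \<sigma> \<tau> :: "nat \<Rightarrow> nat" and n
  have "z (Suc i) < z i" for i
    using part_antimono[OF \<open>is_partition \<nu>\<close>, of i] by (simp add: z_def)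
  moreover have "z l = - int l" by (simp add: z_def part_def l_def)
  ultimately have cut: "cut_partition l N z"
    by (simp add: cut_partition_def N l_def)
  have W: "stabilizes (W \<sigma> \<tau>)" for \<sigma> \<tau>
    unfolding W_def es_def N_def
  proof (rule stabilizes_sum_contingency)
    show "part \<alpha> i \<le> b" for i using length_conjugate[OF assms(1), of i] by (simp add: b_def)
  qed (use cut N_def in simp)
  have expand: "kronecker (P n) (Q n) (R n) =
     of_int (\<Sum>\<sigma> | \<sigma> permutes {..<a}. \<Sum>\<tau> | \<tau> permutes {..<b}. sign \<sigma> * sign \<tau> * W \<sigma> \<tau> n)" if n: "n \<ge> 1" for n
  proof -
    have part: "is_partition (P n)" "is_partition (Q n)" "is_partition (R n)"
      using assms n by (auto simp: P_def Q_def R_def intro!: is_partition_padd is_partition_pscale is_partition_conjugate is_partition_replicate)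
    have sums: "sum_list (Q n) = sum_list (P n)" "sum_list (R n) = sum_list (P n)"
      using assms by (simp_all add: P_def Q_def R_def sum_list_padd sum_list_pscale sum_list_conjugate sum_list_replicate)
    have sP: "shifted (P n) i = (int (part lam i) - int i) + int n * int (part \<alpha> i)" for i
      by (simp add: shifted_eq_part P_def part_padd part_pscale)
    have sQ: "shifted (Q n) j = (int (part \<mu> j) - int j) + int n * int (card {i. i < a \<and> j < part \<alpha> i})" for j
      using part_conjugate[OF assms(1), of a j] by (simp add: shifted_eq_part Q_def part_padd part_pscale a_def)
    have sR: "shifted (R n) = stretch N z n"
      by (auto simp: fun_eq_iff shifted_eq_part R_def part_padd stretch_def z_def N part_def[of "replicate _ _"])
    have es: "distinct es" "set es = {..<length (P n)} \<times> {..<length (Q n)}"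
      by (simp_all add: es_def distinct_cells set_cells len)
    show ?thesis
      unfolding kronecker_expansion[OF part sums es] len sP sQ sR W_def by (simp only: add_ac)
  qed
  have "stabilizes (\<lambda>n. of_int (\<Sum>\<sigma> | \<sigma> permutes {..<a}. \<Sum>\<tau> | \<tau> permutes {..<b}. sign \<sigma> * sign \<tau> * W \<sigma> \<tau> n) :: complex)"
    using W by (intro stabilizes_comp[where h=of_int] stabilizes_sum stabilizes_comp[where h="\<lambda>x. sign _ * sign _ * x"])
      (auto simp: finite_permutations)
  moreover have "\<forall>\<^sub>F n in sequentially. kronecker (P n) (Q n) (R n) =
     of_int (\<Sum>\<sigma> | \<sigma> permutes {..<a}. \<Sum>\<tau> | \<tau> permutes {..<b}. sign \<sigma> * sign \<tau> * W \<sigma> \<tau> n)"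
    using eventually_ge_at_top[of 1] by eventually_elim (rule expand)
  ultimately have "stabilizes (\<lambda>n. kronecker (P n) (Q n) (R n))" by (rule stabilizes_cong[rotated])
  then obtain c L where L: "\<And>n. n \<ge> L \<Longrightarrow> kronecker (P n) (Q n) (R n) = c"
    by (auto simp: stabilizes_def eventually_sequentially)
  have "\<forall>n\<ge>max 1 L. kronecker (P n) (Q n) (R n) = kronecker (P (max 1 L)) (Q (max 1 L)) (R (max 1 L))"
    using L by simp
  then have "\<exists>L\<ge>1. \<forall>n\<ge>L. kronecker (P n) (Q n) (R n) = kronecker (P L) (Q L) (R L)"
    using max.cobounded1[of 1 L] by blast
  then show ?thesis by (simp only: P_def Q_def R_def)
qed

end
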